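(* Let $(A(n))_{n\ge1}$ be an i.i.d. sequence of random topical operators on $\mathbb R^d$ with the memory loss property and let $X^0$ be an $\mathbb R^d$-valued random variable independent of $(A(n))$. Assume there is a topical $\phi:\mathbb R^d\to\mathbb R$ such that $\sup_x|\phi(A(1)x)-\phi(x)|$ has a finite second moment. Let $\alpha$ be the measure on $\mathbb R^d$ whose image by $x\mapsto(\bar x,\phi(x))$ is $\nu_0\otimes$(Lebesgue measure on $\mathbb R$). If $\gamma>0$ and the system is weakly non arithmetic, then for every continuous function $h$ with compact support on $\mathbb R^d$, $$\lim_{a\to-\infty}\sum_{n\ge1}\mathbb E[h(x(n,X^0)-a\mathbf 1)]=0,\qquad \lim_{a\to+\infty}\sum_{n\ge1}\mathbb E[h(x(n,X^0)-a\mathbf 1)]=\frac{\alpha(h)}{\gamma}.$$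
   Context: A map $A:\mathbb R^d\to\mathbb R^d$ is topical if it is isotone ($x\le y$ coordinatewise implies $Ax\le Ay$) and additively homogeneous ($A(x+a\mathbf 1)=Ax+a\mathbf 1$, $\mathbf 1=(1,\dots,1)'$). A map $\phi:\mathbb R^d\to\mathbb R$ is topical if isotone and $\phi(x+a\mathbf 1)=\phi(x)+a$. $Top_d$ is the set of topical operators, with the topology of uniform convergence on compact sets. $\mathbb{PR}^d_{\max}$ is the quotient of $\mathbb R^d$ by $x\sim y\iff x-y\in\mathbb R\mathbf 1$, $\bar x$ the class of $x$. $A$ has rank 1 if $\overline{Ax}$ does not depend on $x$. The sequence has the memory loss property if some $A(N)\cdots A(1)$ has rank 1 with positive probability. $x(0,X^0)=X^0$, $x(n,X^0)=A(n)x(n-1,X^0)$; $\gamma$ is the Lyapunov exponent ($x(n,X^0)/n\to\gamma\mathbf 1$ a.s.). $\nu_0$ is the unique invariant probability measure on $\mathbb{PR}^d_{\max}$ of the Markov chain $\bar x(n,\cdot)$. Weak non arithmeticity: let $E=Top_d\times\mathbb{PR}^d_{\max}$, $Q((A,\bar x),D)=\mathbb P((A(1),\overline{Ax})\in D)$, $\xi(A,\bar x)=\phi(Ax)-\phi(x)$, $j(A,\bar x)=\overline{Ax}$, and $\mathcal B^\infty=\{f\circ j: f$ bounded continuous complex function on $\mathbb{PR}^d_{\max}\}$ with sup norm. For $t\in\mathbb R$, $Q_t(z,dy)=e^{it\xi(y)}Q(z,dy)$. The system is weakly non arithmetic if $t\mapsto Q_t$ is continuous from $\mathbb R$ to the bounded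 operators on $\mathcal B^\infty$ and $\mathrm{Id}-Q_t$ is invertible on $\mathcal B^\infty$ for every $t\ne0$. *)

theory Defs
  imports "HOL-Probability.Probability"
begin

definition ones :: "real^'d" where
  "ones = (\<chi> i. 1)"

definition topical_op :: "(real^'d \<Rightarrow> real^'d) \<Rightarrow> bool" where
  "topical_op A \<longleftrightarrow>
     (\<forall>x y. (\<forall>i. x $ i \<le> y $ i) \<longrightarrow> (\<forall>i. A x $ i \<le> A y $ i)) \<and>
     (\<forall>x a. A (x + a *\<^sub>R ones) = A x + a *\<^sub>R ones)"

definition topical_fun :: "(real^'d \<Rightarrow> real) \<Rightarrow> bool" where
  "topical_fun \<phi> \<longleftrightarrow>
     (\<forall>x y. (\<forall>i. x $ i \<le> y $ i) \<longrightarrow> \<phi> x \<le> \<phi> y) \<and>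
     (\<forall>x a. \<phi> (x + a *\<^sub>R ones) = \<phi> x + a)"

text \<open>Projective space: x ~ y iff x - y is a multiple of ones.  A class is
  represented by its canonical representative pnorm x (maximal coordinate 0);
  PR^d is identified with the set projspace of such representatives, with the
  subspace topology / Borel structure of real^'d (homeomorphic to the quotient).\<close>

definition pequiv :: "real^'d \<Rightarrow> real^'d \<Rightarrow> bool" where
  "pequiv x y \<longleftrightarrow> (\<exists>c. x - y = c *\<^sub>R ones)"

definition pnorm :: "real^'d \<Rightarrow> real^'d" where
  "pnorm x = x - (Max (range (\<lambda>i. x $ i))) *\<^sub>R ones"

definition projspace :: "(real^'d) set" where
  "projspace = range pnorm"

definition rank_one :: "(real^'d \<Rightarrow> real^'d) \<Rightarrow> bool" where
  "rank_one A \<longleftrightarrow> (\<forall>x y. pequiv (A x) (A y))"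

text \<open>Measurable structure on operators: generated by evaluations (on the
  Polish space Top_d this is its Borel sigma-algebra).\<close>

definition op_space :: "(real^'d \<Rightarrow> real^'d) measure" where
  "op_space = Pi\<^sub>M UNIV (\<lambda>_. borel)"

primrec opprod :: "(nat \<Rightarrow> 'w \<Rightarrow> real^'d \<Rightarrow> real^'d) \<Rightarrow> 'w \<Rightarrow> nat \<Rightarrow> real^'d \<Rightarrow> real^'d" where
  "opprod A \<omega> 0 = id"
| "opprod A \<omega> (Suc n) = A (Suc n) \<omega> \<circ> opprod A \<omega> n"

primrec xseq :: "(nat \<Rightarrow> 'w \<Rightarrow> real^'d \<Rightarrow> real^'d) \<Rightarrow> ('w \<Rightarrow> real^'d) \<Rightarrow> 'w \<Rightarrow> nat \<Rightarrow> real^'d" where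
  "xseq A X0 \<omega> 0 = X0 \<omega>"
| "xseq A X0 \<omega> (Suc n) = A (Suc n) \<omega> (xseq A X0 \<omega> n)"

definition memory_loss :: "'w measure \<Rightarrow> (nat \<Rightarrow> 'w \<Rightarrow> real^'d \<Rightarrow> real^'d) \<Rightarrow> bool" where
  "memory_loss M A \<longleftrightarrow> (\<exists>N\<ge>1. measure M {\<omega> \<in> space M. rank_one (opprod A \<omega> N)} > 0)"

definition Etop :: "((real^'d \<Rightarrow> real^'d) \<times> (real^'d)) set" where
  "Etop = {(B, x). topical_op B \<and> x \<in> projspace}"

definition xi :: "(real^'d \<Rightarrow> real) \<Rightarrow> (real^'d \<Rightarrow> real^'d) \<times> (real^'d) \<Rightarrow> real" where
  "xi \<phi> z = \<phi> (fst z (snd z)) - \<phi> (snd z)"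

definition jmap :: "(real^'d \<Rightarrow> real^'d) \<times> (real^'d) \<Rightarrow> real^'d" where
  "jmap z = pnorm (fst z (snd z))"

definition Binf :: "((real^'d \<Rightarrow> real^'d) \<times> (real^'d) \<Rightarrow> complex) set" where
  "Binf = {f \<circ> jmap | f. continuous_on projspace f \<and> bounded (f ` projspace)}"

definition supE :: "((real^'d \<Rightarrow> real^'d) \<times> (real^'d) \<Rightarrow> complex) \<Rightarrow> real" where
  "supE g = (SUP z\<in>Etop. cmod (g z))"

text \<open>Q_t g (B, x) = E[ exp(i t xi(A(1), Bx)) g(A(1), Bx) ], since
  Q((B,x), .) is the law of (A(1), class of Bx).\<close>

definition Qt :: "'w measure \<Rightarrow> (nat \<Rightarrow> 'w \<Rightarrow> real^'d \<Rightarrow> real^'d) \<Rightarrow> (real^'d \<Rightarrow> real) \<Rightarrow> real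
     \<Rightarrow> ((real^'d \<Rightarrow> real^'d) \<times> (real^'d) \<Rightarrow> complex) \<Rightarrow> (real^'d \<Rightarrow> real^'d) \<times> (real^'d) \<Rightarrow> complex" where
  "Qt M A \<phi> t g z =
     (\<integral>\<omega>. exp (\<i> * complex_of_real (t * xi \<phi> (A 1 \<omega>, pnorm (fst z (snd z)))))
            * g (A 1 \<omega>, pnorm (fst z (snd z))) \<partial>M)"

definition weakly_non_arith ::
    "'w measure \<Rightarrow> (nat \<Rightarrow> 'w \<Rightarrow> real^'d \<Rightarrow> real^'d) \<Rightarrow> (real^'d \<Rightarrow> real) \<Rightarrow> bool" where
  "weakly_non_arith M A \<phi> \<longleftrightarrow>
     (\<forall>t. \<forall>g\<in>Binf. Qt M A \<phi> t g \<in> Binf) \<and>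
     (\<forall>t0 \<epsilon>. \<epsilon> > 0 \<longrightarrow> (\<exists>\<delta>>0. \<forall>t. \<bar>t - t0\<bar> < \<delta> \<longrightarrow>
         (\<forall>g\<in>Binf. supE (\<lambda>z. Qt M A \<phi> t g z - Qt M A \<phi> t0 g z) \<le> \<epsilon> * supE g))) \<and>
     (\<forall>t. t \<noteq> 0 \<longrightarrow> (\<exists>R C. \<forall>g\<in>Binf. R g \<in> Binf \<and> supE (R g) \<le> C * supE g \<and>
         R (\<lambda>z. g z - Qt M A \<phi> t g z) = g \<and>
         (\<lambda>z. R g z - Qt M A \<phi> t (R g) z) = g))"

end

theory Submission
  imports Defs
begin

text \<open>
  Write \<open>G x = (\<Sum>n. E h (X\<^sub>n x))\<close> for the renewal functional of the chain started at the constant point \<open>x\<close>.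
  Since the drift is positive uniformly over all starting points (topical maps do not expand distances), with
  probability at least 1/2 the chain leaves a slab of \<open>\<phi>\<close>-values for good after a fixed number of steps; so
  it makes boundedly many visits on average and \<open>G\<close> is bounded.

  Over a long window of levels the projective classes equidistribute with respect to \<open>\<nu>0\<close>: shifting time by \<open>j\<close>
  costs only a boundary term, and memory loss makes the class at time \<open>j\<close> almost independent of the start. Summing
  the increments of a ramp function of \<open>\<phi>\<close> along the chain counts the visits to the window, which gives the
  factor \<open>1 / \<gamma>\<close>. Hence the averages of \<open>a \<mapsto> G (x - a *\<^sub>R ones)\<close> over long windows converge to the
  expected limit.

  It remains to pass from long windows to single levels. The difference of the smoothings of \<open>G\<close> by a narrow and a
  wide kernel is a Fourier integral over frequencies bounded away from zero and infinity, where weak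
  non arithmeticity makes \<open>Id - Q\<^sub>t\<close> invertible with locally bounded inverse; by the Riemann--Lebesgue lemma it
  vanishes as \<open>a\<close> tends to infinity. The narrow smoothing is close to \<open>G\<close> and the wide one to the window average.
\<close>

subsection \<open>Topical maps and projective classes\<close>

text \<open>Frequency 0 is the obstacle: \<open>Pt 0\<close> fixes the constants, so
  \<open>Id - Pt 0\<close> is not invertible and the Fourier transform of the renewal functional has
  no control there. The two smoothing kernels are therefore chosen with transforms equal to 1 near
  0, so that their difference contains no low frequency at all; this is why a de la Vallee Poussin
  kernel replaces the Fejer kernel. What happens at frequency 0 is supplied by the window averages,
  which rest on coupling and drift alone. Away from 0 the hypothesis yields a bounded inverse but no
  bound on the spectral radius, so the Neumann series of \<open>Pt t\<close> may fail to converge;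
  its partial sums are averaged in the sense of Cesaro instead. The second moment enters where a
  step crosses the end of a window: such a step is likely in proportion to its size and is weighted
  by its size. All estimates are uniform in a deterministic start, so the random start is integrated
  out at the very end by dominated convergence.\<close>

lemma ones_nth [simp]: "ones $ i = 1"
  by (simp add: ones_def)

lemma topical_funD_mono: "topical_fun \<phi> \<Longrightarrow> (\<And>i. x $ i \<le> y $ i) \<Longrightarrow> \<phi> x \<le> \<phi> y"
  by (auto simp: topical_fun_def)

lemma topical_funD_add: "topical_fun \<phi> \<Longrightarrow> \<phi> (x + a *\<^sub>R ones) = \<phi> x + a"
  by (auto simp: topical_fun_def)

lemma topical_opD_add: "topical_op C \<Longrightarrow> C (x + a *\<^sub>R ones) = C x + a *\<^sub>R ones"
  by (auto simp: topical_op_def)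

lemma topical_opD_diff: "topical_op C \<Longrightarrow> C (x - a *\<^sub>R ones) = C x - a *\<^sub>R ones"
  using topical_opD_add[of C x "-a"] by simp

lemma topical_funD_diff: "topical_fun \<phi> \<Longrightarrow> \<phi> (x - a *\<^sub>R ones) = \<phi> x - a"
  using topical_funD_add[of \<phi> x "-a"] by simp

text \<open>Every coordinate of \<open>x - y\<close> is at most its Euclidean norm, so
  \<open>x\<close> lies below \<open>y\<close> raised by \<open>norm (x - y)\<close> in all
  coordinates; monotonicity and homogeneity turn this into the Lipschitz bound.\<close>

lemma topical_fun_dist:
  fixes \<phi> :: "real^'d \<Rightarrow> real"
  assumes "topical_fun \<phi>"
  shows "\<bar>\<phi> x - \<phi> y\<bar> \<le> norm (x - y)"
proof -
  have *: "\<phi> x \<le> \<phi> y + norm (x - y)" for x y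
  proof -
    have "x $ i \<le> (y + norm (x - y) *\<^sub>R ones) $ i" for i
      using component_le_norm_cart[of "x - y" i] by simp
    then show ?thesis
      using topical_funD_mono[OF assms] topical_funD_add[OF assms] by metis
  qed
  show ?thesis using *[of x y] *[of y x] by (simp add: norm_minus_commute abs_le_iff)
qed

lemma topical_fun_continuous:
  assumes "topical_fun \<phi>" shows "continuous_on UNIV \<phi>"
  unfolding continuous_on_iff
proof (intro ballI allI impI)
  fix x and e :: real assume "e > 0"
  then show "\<exists>d>0. \<forall>x'\<in>UNIV. dist x' x < d \<longrightarrow> dist (\<phi> x') (\<phi> x) < e"
    using topical_fun_dist[OF assms]
    by (intro exI[of _ e]) (auto simp: dist_norm intro: le_less_trans)
qed

lemma topical_op_component: "topical_op C \<Longrightarrow> topical_fun (\<lambda>x. C x $ i)"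
  by (auto simp: topical_op_def topical_fun_def)

lemma topical_op_continuous:
  fixes C :: "real^'d \<Rightarrow> real^'d"
  assumes "topical_op C" shows "continuous_on UNIV C"
proof -
  have "continuous_on UNIV (\<lambda>x. \<chi> i. C x $ i)"
    by (intro continuous_on_vec_lambda topical_fun_continuous topical_op_component assms)
  then show ?thesis by simp
qed

lemma topical_op_id: "topical_op (\<lambda>x. x)"
  by (auto simp: topical_op_def)

lemma topical_op_comp: "topical_op C \<Longrightarrow> topical_op D \<Longrightarrow> topical_op (\<lambda>x. C (D x))"
  by (auto simp: topical_op_def)

lemma topical_fun_comp: "topical_fun \<phi> \<Longrightarrow> topical_op D \<Longrightarrow> topical_fun (\<lambda>x. \<phi> (D x))"
  by (auto simp: topical_fun_def topical_op_def)

lemma topical_fun_Max: "topical_fun (\<lambda>x::real^'d. Max (range (\<lambda>i. x $ i)))"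
proof -
  have "Max (range (\<lambda>i. x $ i)) \<le> Max (range (\<lambda>i. y $ i))"
    if "\<forall>i. x $ i \<le> y $ i" for x y :: "real^'d"
  proof (rule Max.boundedI)
    fix a assume "a \<in> range (\<lambda>i. x $ i)"
    then obtain i where "a = x $ i" by auto
    then have "a \<le> y $ i" using that by auto
    also have "\<dots> \<le> Max (range (\<lambda>i. y $ i))" by (rule Max_ge) auto
    finally show "a \<le> Max (range (\<lambda>i. y $ i))" .
  qed auto
  moreover have "Max (range (\<lambda>i. (x + a *\<^sub>R ones) $ i)) = Max (range (\<lambda>i. x $ i)) + a"
    for x :: "real^'d" and a
  proof -
    have "Max ((\<lambda>t. t + a) ` range (\<lambda>i. x $ i)) = Max (range (\<lambda>i. x $ i)) + a"
      by (subst mono_Max_commute[symmetric]) (auto simp: mono_def)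
    then show ?thesis by (simp add: image_image)
  qed
  ultimately show ?thesis unfolding topical_fun_def by blast
qed

lemma pnorm_add_ones [simp]: "pnorm (x + a *\<^sub>R ones) = pnorm x"
  using topical_funD_add[OF topical_fun_Max, of x a] by (simp add: pnorm_def algebra_simps)

lemma continuous_on_pnorm: "continuous_on S pnorm"
  unfolding pnorm_def
  by (intro continuous_intros continuous_on_subset[OF topical_fun_continuous[OF topical_fun_Max]]) auto

lemma measurable_pnorm [measurable]: "pnorm \<in> borel_measurable borel"
  by (intro borel_measurable_continuous_onI continuous_on_pnorm)

lemma ones_neq_0: "(ones :: real^'d) \<noteq> 0"
  by (metis ones_nth zero_index zero_neq_one)

lemma pnorm_decomp: "x = pnorm x + Max (range (\<lambda>i. x $ i)) *\<^sub>R ones"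
  by (simp add: pnorm_def)

lemma pnorm_idem [simp]: "pnorm (pnorm x) = pnorm x"
  by (metis pnorm_add_ones pnorm_decomp)

lemma pnorm_in_projspace [simp]: "pnorm x \<in> projspace"
  by (simp add: projspace_def)

lemma pnorm_eq_iff: "pnorm x = pnorm y \<longleftrightarrow> (\<exists>c. x = y + c *\<^sub>R ones)"
proof
  assume "pnorm x = pnorm y"
  then have "x = pnorm y + Max (range (\<lambda>i. x $ i)) *\<^sub>R ones"
    using pnorm_decomp[of x] by simp
  also have "\<dots> = y + (Max (range (\<lambda>i. x $ i)) - Max (range (\<lambda>i. y $ i))) *\<^sub>R ones"
    by (simp add: pnorm_def algebra_simps)
  finally show "\<exists>c. x = y + c *\<^sub>R ones" by blast
qed auto

lemma pequiv_iff: "pequiv x y \<longleftrightarrow> pnorm x = pnorm y"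
  by (auto simp: pequiv_def pnorm_eq_iff algebra_simps)

text \<open>Functions on the projective space are handled as functions on the full vector space that
  are constant along \<open>ones\<close>, so that no restriction to \<open>projspace\<close> has to
  be carried along.\<close>

definition proj_inv :: "(real^'d \<Rightarrow> 'b) \<Rightarrow> bool" where
  "proj_inv f \<longleftrightarrow> (\<forall>x a. f (x + a *\<^sub>R ones) = f x)"

lemma proj_invD: "proj_inv f \<Longrightarrow> f (x + a *\<^sub>R ones) = f x"
  by (simp add: proj_inv_def)

lemma proj_inv_pnorm: "proj_inv f \<Longrightarrow> f (pnorm x) = f x"
  by (metis pnorm_decomp proj_invD)

lemma proj_inv_cong: "proj_inv f \<Longrightarrow> pnorm x = pnorm y \<Longrightarrow> f x = f y"
  by (metis proj_inv_pnorm)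

lemma topical_op_pnorm_cong: "topical_op C \<Longrightarrow> pnorm x = pnorm y \<Longrightarrow> pnorm (C x) = pnorm (C y)"
  by (auto simp: pnorm_eq_iff) (metis topical_opD_add)

lemma rank_one_iff: "rank_one C \<longleftrightarrow> (\<forall>x. pnorm (C x) = pnorm (C 0))"
  by (auto simp: rank_one_def pequiv_iff) metis

section \<open>Countable dense sets and joint measurability of evaluation\<close>

lemma obtain_dense_seq:
  obtains d :: "nat \<Rightarrow> real^'d" where "closure (range d) = UNIV"
proof -
  obtain D :: "(real^'d) set" where D: "countable D" "D \<subseteq> UNIV" "UNIV \<subseteq> closure D"
    by (rule separable[of UNIV])
  then have "D \<noteq> {}" by auto
  then have "range (from_nat_into D) = D" using D(1) by (rule range_from_nat_into)
  then show ?thesis using that[of "from_nat_into D"] D by auto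
qed

text \<open>Reduces closed conditions on all points, such as having rank one or a uniform lower
  bound on increments, to countably many points; this is how the corresponding events are shown to
  be measurable.\<close>

lemma Collect_dense_all:
  fixes d :: "nat \<Rightarrow> real^'d"
  assumes "closure (range d) = UNIV" "closed {x. P x}" "\<And>i. P (d i)"
  shows "P x"
proof -
  have "closure (range d) \<subseteq> {x. P x}" using assms(2,3) by (intro closure_minimal) auto
  then show ?thesis using assms(1) by auto
qed

text \<open>Each rounding has countable range and the roundings converge to the point, so evaluating
  a random map at a random point becomes a limit of countable case distinctions.\<close>

definition dyadic_round :: "nat \<Rightarrow> real^'d \<Rightarrow> real^'d" where
  "dyadic_round n x = (\<chi> i. of_int \<lfloor>2 ^ n * x $ i\<rfloor> / 2 ^ n)"

lemma countable_range_dyadic_round: "countable (range (dyadic_round n :: real^'d \<Rightarrow> real^'d))"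
proof -
  have "range (dyadic_round n) \<subseteq> range (\<lambda>v::'d \<Rightarrow> int. (\<chi> i. of_int (v i) / 2 ^ n) :: real^'d)"
    by (auto simp: dyadic_round_def)
  then show ?thesis
    by (rule countable_subset) auto
qed

lemma measurable_dyadic_round [measurable]: "dyadic_round n \<in> borel_measurable borel"
  by (subst borel_measurable_euclidean_space)
    (auto simp: dyadic_round_def Basis_vec_def inner_axis)

lemma dyadic_round_tendsto: "(\<lambda>n. dyadic_round n x) \<longlonglongrightarrow> x"
proof (rule vec_tendstoI)
  fix i
  have "\<bar>real_of_int \<lfloor>2 ^ n * x $ i\<rfloor> / 2 ^ n - x $ i\<bar> \<le> (1/2) ^ n" for n
  proof -
    have "\<bar>real_of_int \<lfloor>2 ^ n * x $ i\<rfloor> - 2 ^ n * x $ i\<bar> \<le> 1" by linarith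
    then have "\<bar>real_of_int \<lfloor>2 ^ n * x $ i\<rfloor> - 2 ^ n * x $ i\<bar> / 2 ^ n \<le> 1 / 2 ^ n"
      by (intro divide_right_mono) auto
    also have "\<bar>real_of_int \<lfloor>2 ^ n * x $ i\<rfloor> - 2 ^ n * x $ i\<bar> / 2 ^ n
        = \<bar>(real_of_int \<lfloor>2 ^ n * x $ i\<rfloor> - 2 ^ n * x $ i) / 2 ^ n\<bar>" by simp
    finally show ?thesis by (simp add: diff_divide_distrib power_one_over)
  qed
  then show "(\<lambda>n. dyadic_round n x $ i) \<longlonglongrightarrow> x $ i"
    unfolding dyadic_round_def
    by (intro LIM_zero_cancel[OF Lim_null_comparison[OF _ LIMSEQ_power_zero[of "1/2::real"]]]) auto
qed

lemma measurable_eval_dyadic_round: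
  fixes f :: "'b \<Rightarrow> real^'d \<Rightarrow> real^'d"
  assumes [measurable]: "\<And>x. (\<lambda>b. f b x) \<in> borel_measurable N"
  shows "(\<lambda>(b, x). f b (dyadic_round n x)) \<in> borel_measurable (N \<Otimes>\<^sub>M borel)"
proof -
  let ?I = "range (dyadic_round n :: real^'d \<Rightarrow> real^'d)"
  have "(\<lambda>z. (\<lambda>i z. f (fst z) i) (dyadic_round n (snd z)) z) \<in> borel_measurable (N \<Otimes>\<^sub>M borel)"
  proof (rule measurable_compose_countable'[where I="?I" and f="\<lambda>i z. f (fst z) i"
        and g="\<lambda>z. dyadic_round n (snd z)"])
    show "(\<lambda>z. dyadic_round n (snd z)) \<in> (N \<Otimes>\<^sub>M borel) \<rightarrow>\<^sub>M count_space ?I"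
    proof (subst measurable_count_space_eq_countable[OF countable_range_dyadic_round], intro conjI ballI)
      fix a :: "real^'d"
      have "(\<lambda>z. dyadic_round n (snd z)) -` {a} \<inter> space (N \<Otimes>\<^sub>M borel)
         = {z \<in> space (N \<Otimes>\<^sub>M borel). dyadic_round n (snd z) = a}" by auto
      also have "\<dots> \<in> sets (N \<Otimes>\<^sub>M borel)" by measurable
      finally show "(\<lambda>z. dyadic_round n (snd z)) -` {a} \<inter> space (N \<Otimes>\<^sub>M borel) \<in> sets (N \<Otimes>\<^sub>M borel)" .
    qed auto
  qed (auto simp: countable_range_dyadic_round)
  then show ?thesis by (simp add: split_beta')
qed

text \<open>Topical operators are continuous, so evaluations at rounded points converge to the true
  value; measurability at each fixed point therefore gives joint measurability.\<close>

lemma measurable_eval_topical: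
  fixes f :: "'b \<Rightarrow> real^'d \<Rightarrow> real^'d"
  assumes "\<And>x. (\<lambda>b. f b x) \<in> borel_measurable N"
    and "\<And>b. b \<in> space N \<Longrightarrow> topical_op (f b)"
  shows "(\<lambda>(b, x). f b x) \<in> borel_measurable (N \<Otimes>\<^sub>M borel)"
proof (rule borel_measurable_LIMSEQ_metric[OF measurable_eval_dyadic_round[OF assms(1)]])
  fix z :: "'b \<times> (real^'d)" assume "z \<in> space (N \<Otimes>\<^sub>M borel)"
  then have "isCont (f (fst z)) (snd z)"
    using topical_op_continuous[OF assms(2)]
    by (auto simp: space_pair_measure continuous_on_eq_continuous_at)
  then show "(\<lambda>n. case z of (b, x) \<Rightarrow> f b (dyadic_round n x)) \<longlonglongrightarrow> (case z of (b, x) \<Rightarrow> f b x)"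
    using isCont_tendsto_compose[OF _ dyadic_round_tendsto] by (auto simp: split_beta')
qed

subsection \<open>A smoothing kernel with compactly supported Fourier transform\<close>

text \<open>The squared cardinal sine, that is \<open>sin (s / 2) / (s / 2)\<close> squared,
  extended by its limit 1 at the origin.\<close>

definition fejer :: "real \<Rightarrow> real" where
  "fejer s = (if s = 0 then 1 else 2 * (1 - cos s) / s\<^sup>2)"

definition tri :: "real \<Rightarrow> real \<Rightarrow> real" where
  "tri l t = max 0 (1 - \<bar>t\<bar> / l)"

text \<open>The de la Vallee Poussin kernel: its Fourier transform is a trapezoid that is
  constant near the origin.\<close>

definition vpk :: "real \<Rightarrow> real" where
  "vpk s = 4 * fejer (2 * s) - fejer s"

text \<open>The slopes of the two triangles cancel for \<open>\<bar>t\<bar> \<le> l\<close>, which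
  leaves the value 1, and both triangles vanish beyond \<open>2 * l\<close>.\<close>

definition trap :: "real \<Rightarrow> real \<Rightarrow> real" where
  "trap l t = 2 * tri (2 * l) t - tri l t"

lemma fejer_nonneg: "0 \<le> fejer s"
  by (simp add: fejer_def)

text \<open>Two bounds are added: \<open>2 * (1 - cos s) \<le> s\<^sup>2\<close> controls the origin
  and \<open>2 * (1 - cos s) \<le> 4\<close> the tail, hence the constant 5 = 1 + 4.\<close>

lemma fejer_le: "fejer s \<le> 5 / (1 + s\<^sup>2)"
proof (cases "s = 0")
  case False
  have "1 - cos s = 2 * (sin (s/2))\<^sup>2"
    using cos_double_sin[of "s/2"] by simp
  also have "\<dots> \<le> 2 * (s/2)\<^sup>2"
    by (intro mult_left_mono abs_le_square_iff[THEN iffD1] abs_sin_x_le_abs_x) auto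
  finally have "2 * (1 - cos s) \<le> s\<^sup>2" by (simp add: power_divide)
  moreover have "2 * (1 - cos s) \<le> 2 * (1 - (- 1))"
    by (intro mult_left_mono diff_left_mono cos_ge_minus_one) auto
  then have "2 * (1 - cos s) \<le> 4" by simp
  then have "s\<^sup>2 * (2 * (1 - cos s)) \<le> s\<^sup>2 * 4" by (rule mult_left_mono) simp
  ultimately have "(1 + s\<^sup>2) * (2 * (1 - cos s)) \<le> 5 * s\<^sup>2"
    by (simp add: distrib_right)
  moreover have "0 < s\<^sup>2" "0 < 1 + s\<^sup>2" using False by (auto intro: add_pos_nonneg)
  ultimately show ?thesis using False by (simp add: fejer_def field_simps)
qed (simp add: fejer_def)

lemma measurable_fejer [measurable]: "fejer \<in> borel_measurable borel"
  unfolding fejer_def by measurable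

lemma measurable_vpk [measurable]: "vpk \<in> borel_measurable borel"
  unfolding vpk_def by measurable

lemma isCont_vpk:
  assumes "s \<noteq> 0" shows "isCont vpk s"
proof -
  have f: "isCont fejer s" if "s \<noteq> 0" for s
  proof -
    have "isCont (\<lambda>s. 2 * (1 - cos s) / s\<^sup>2) s"
      using that by (intro continuous_intros) auto
    moreover have "\<forall>\<^sub>F s in nhds s. 2 * (1 - cos s) / s\<^sup>2 = fejer s"
      using t1_space_nhds[OF that] by eventually_elim (auto simp: fejer_def)
    ultimately show ?thesis by (subst (asm) isCont_cong) auto
  qed
  have "isCont (\<lambda>s. fejer (2 * s)) s"
    by (rule isCont_o2[where f="\<lambda>s. 2 * s" and g=fejer]) (use assms f[of "2 * s"] in auto)
  then show ?thesis unfolding vpk_def using f[OF assms] by (intro continuous_intros)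
qed

text \<open>\<open>fejer (2 * s)\<close> obeys the same bound as \<open>fejer s\<close>, and 25 = 4
  * 5 + 5.\<close>

lemma abs_vpk_le: "\<bar>vpk s\<bar> \<le> 25 / (1 + s\<^sup>2)"
proof -
  have "fejer (2 * s) \<le> 5 / (1 + s\<^sup>2)"
    using fejer_le[of "2 * s"]
    by (rule order_trans) (auto intro!: divide_left_mono simp: add_pos_nonneg)
  then have "\<bar>vpk s\<bar> \<le> 4 * (5 / (1 + s\<^sup>2)) + 5 / (1 + s\<^sup>2)"
    using fejer_le[of s] fejer_nonneg[of s] fejer_nonneg[of "2 * s"]
    unfolding vpk_def abs_le_iff by linarith
  then show ?thesis by (simp add: add_divide_distrib[symmetric])
qed

lemma integrable_inverse_square: "integrable lborel (\<lambda>s::real. c / (1 + s\<^sup>2))"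
proof -
  have "integrable lborel (\<lambda>s::real. c * inverse (1 + s\<^sup>2))"
    using integrable_inverse_1_plus_square by (simp add: set_integrable_def)
  then show ?thesis by (simp add: divide_inverse)
qed

lemma integrable_mult_indicator_Icc: "integrable lborel (\<lambda>t::real. c * indicator {a..b} t :: real)"
  by (intro integrable_mult_right integrable_real_indicator) (auto simp: emeasure_lborel_Icc_eq)

lemma integrable_fejer: "integrable lborel fejer"
  by (rule Bochner_Integration.integrable_bound[OF integrable_inverse_square[of 5]])
    (auto simp: fejer_nonneg fejer_le)

lemma integrable_vpk: "integrable lborel vpk"
  by (rule Bochner_Integration.integrable_bound[OF integrable_inverse_square[of 25]])
    (auto simp: abs_vpk_le)

text \<open>Rescaling gives \<open>vpk\<close> the same integral as \<open>fejer\<close>. The latter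
  is nonnegative and nonzero on a set of positive measure, for which the interval from 1 to 2 is
  taken. Positivity allows division by this integral when the smoothings are compared with
  \<open>G\<close>.\<close>

lemma integral_vpk_pos: "0 < (\<integral>s. vpk s \<partial>lborel)"
proof -
  have 1: "(\<integral>s. fejer s \<partial>lborel) = 2 * (\<integral>s. fejer (2 * s) \<partial>lborel)"
    using lborel_integral_real_affine[of 2 fejer 0] by simp
  have 2: "integrable lborel (\<lambda>s. fejer (2 * s))"
    using lborel_integrable_real_affine[OF integrable_fejer, of 2 0] by simp
  have "(\<integral>s. vpk s \<partial>lborel) = (\<integral>s. fejer s \<partial>lborel)"
    unfolding vpk_def using 1 2 integrable_fejer by simp
  moreover have "(\<integral>s. fejer s \<partial>lborel) \<noteq> 0"
  proof
    assume "(\<integral>s. fejer s \<partial>lborel) = 0"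
    then have "AE s in lborel. fejer s = 0"
      using integral_nonneg_eq_0_iff_AE[OF integrable_fejer] fejer_nonneg by simp
    then have "AE s in lborel. s \<notin> {1..2::real}"
    proof eventually_elim
      case (elim s)
      show ?case
      proof
        assume s: "s \<in> {1..2::real}"
        have "cos s < cos 0"
          using s pi_gt3 by (intro cos_monotone_0_pi) auto
        then show False using elim s by (auto simp: fejer_def split: if_splits)
      qed
    qed
    then have "emeasure lborel {1..2::real} = 0"
      using AE_iff_null_sets[of "{1..2::real}" lborel] by (auto simp: null_sets_def)
    then show False by simp
  qed
  moreover have "0 \<le> (\<integral>s. fejer s \<partial>lborel)" by (simp add: fejer_nonneg)
  ultimately show ?thesis by linarith
qed

text \<open>Integration by parts on the interval from 0 to \<open>l\<close> gives the antiderivative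
  \<open>F\<close>, with a separate formula for \<open>s = 0\<close>; evenness doubles the
  result.\<close>

lemma tri_fourier:
  assumes "l > 0"
  shows "has_bochner_integral lborel (\<lambda>t. tri l t * cos (t * s)) (l * fejer (l * s))"
proof -
  define F where "F t = (if s = 0 then t - t\<^sup>2 / (2 * l)
     else (1 - t / l) * sin (t * s) / s - cos (t * s) / (l * s\<^sup>2))" for t
  have "has_bochner_integral lborel (\<lambda>t. ((1 - t / l) * cos (t * s)) * indicator {0..l} t) (F l - F 0)"
  proof (rule has_bochner_integral_FTC_Icc_real)
    fix t
    show "DERIV F t :> (1 - t / l) * cos (t * s)"
    proof (cases "s = 0")
      case True
      then have F: "F = (\<lambda>t. t - t\<^sup>2 / (2 * l))" by (simp add: F_def fun_eq_iff)
      show ?thesis unfolding F using assms True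
        by (auto intro!: derivative_eq_intros simp: field_simps)
    next
      case False
      then have F: "F = (\<lambda>t. (1 - t / l) * sin (t * s) / s - cos (t * s) / (l * s\<^sup>2))"
        by (simp add: F_def fun_eq_iff)
      have "DERIV F t :> ((- (1 / l)) * sin (t * s) + (1 - t / l) * (cos (t * s) * s)) / s
          - (- sin (t * s) * s) / (l * s\<^sup>2)"
        unfolding F using assms False by (auto intro!: derivative_eq_intros)
      moreover have "((- (1 / l)) * sin (t * s) + (1 - t / l) * (cos (t * s) * s)) / s
          - (- sin (t * s) * s) / (l * s\<^sup>2) = (1 - t / l) * cos (t * s)"
        using assms False by (simp add: add_divide_distrib diff_divide_distrib power2_eq_square)
      ultimately show ?thesis by simp
    qed
    show "isCont (\<lambda>t. (1 - t / l) * cos (t * s)) t" using assms by (intro continuous_intros) auto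
  qed (use assms in auto)
  moreover have "((1 - t / l) * cos (t * s)) * indicator {0..l} t
      = indicator {0..} t *\<^sub>R (tri l t * cos (t * s))" for t
    using assms by (auto simp: tri_def indicator_def)
  ultimately have "has_bochner_integral lborel
     (\<lambda>t. indicator {0..} t *\<^sub>R (tri l t * cos (t * s))) (F l - F 0)" by simp
  then have "has_bochner_integral lborel (\<lambda>t. tri l t * cos (t * s)) (2 *\<^sub>R (F l - F 0))"
    by (rule has_bochner_integral_even_function) (simp add: tri_def)
  moreover have "2 *\<^sub>R (F l - F 0) = l * fejer (l * s)"
    using assms by (auto simp: F_def fejer_def field_simps power2_eq_square)
  ultimately show ?thesis by simp
qed

lemma trap_fourier:
  assumes "l > 0"
  shows "has_bochner_integral lborel (\<lambda>t. trap l t * cos (t * s)) (l * vpk (l * s))"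
proof -
  have "has_bochner_integral lborel (\<lambda>t. 2 * (tri (2 * l) t * cos (t * s)) - tri l t * cos (t * s))
     (2 * (2 * l * fejer (2 * l * s)) - l * fejer (l * s))"
    using assms by (intro has_bochner_integral_diff has_bochner_integral_mult_right tri_fourier) auto
  then show ?thesis by (simp add: trap_def vpk_def algebra_simps)
qed

lemma trap_eq_1: "l > 0 \<Longrightarrow> \<bar>t\<bar> \<le> l \<Longrightarrow> trap l t = 1"
  by (simp add: trap_def tri_def max_def field_simps)

lemma trap_eq_0: "l > 0 \<Longrightarrow> 2 * l \<le> \<bar>t\<bar> \<Longrightarrow> trap l t = 0"
  by (simp add: trap_def tri_def max_def field_simps)

lemma continuous_on_trap: "l > 0 \<Longrightarrow> continuous_on UNIV (trap l)"
  unfolding trap_def tri_def by (intro continuous_intros) auto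

lemma integrable_vpk_scaled: "l > 0 \<Longrightarrow> integrable lborel (\<lambda>s. l * vpk (l * s))"
  using lborel_integrable_real_affine[OF integrable_vpk, of l 0] by simp

lemma integral_vpk_scaled: "l > 0 \<Longrightarrow> (\<integral>s. l * vpk (l * s) \<partial>lborel) = (\<integral>s. vpk s \<partial>lborel)"
  using lborel_integral_real_affine[of l vpk 0] by simp

lemma vpk_tail: "((\<lambda>v. \<integral>s. indicator {s. v < \<bar>s\<bar>} s * \<bar>vpk s\<bar> \<partial>lborel) \<longlongrightarrow> 0) at_top"
proof -
  have "((\<lambda>v. \<integral>s. indicator {s. v < \<bar>s\<bar>} s * \<bar>vpk s\<bar> \<partial>lborel) \<longlongrightarrow> (\<integral>s. 0 \<partial>(lborel :: real measure))) at_top"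
  proof (rule integral_dominated_convergence_at_top[where w="\<lambda>s. \<bar>vpk s\<bar>"])
    show "AE s in lborel. ((\<lambda>v. indicator {s. v < \<bar>s\<bar>} s * \<bar>vpk s\<bar>) \<longlongrightarrow> 0) at_top"
    proof (rule AE_I2)
      fix s :: real
      have "\<forall>\<^sub>F v in at_top. indicator {s. v < \<bar>s\<bar>} s * \<bar>vpk s\<bar> = 0"
        using eventually_ge_at_top[of "\<bar>s\<bar>"] by eventually_elim (simp add: indicator_def)
      then show "((\<lambda>v. indicator {s. v < \<bar>s\<bar>} s * \<bar>vpk s\<bar>) \<longlongrightarrow> 0) at_top"
        by (rule tendsto_eventually)
    qed
  qed (use integrable_vpk in \<open>auto simp: indicator_def intro!: always_eventually\<close>)
  then show ?thesis by simp
qed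

text \<open>The integral is cut at \<open>\<bar>s\<bar> = \<eta>\<close>: near 0 the function is
  within \<open>e\<close> of \<open>g0\<close>, and further out it is merely bounded. Rescaling by
  \<open>l\<close> moves the cut to \<open>l * \<eta>\<close>. The bound serves both regimes,
  \<open>l\<close> large with \<open>\<eta>\<close> small and \<open>l\<close> small with
  \<open>\<eta>\<close> large.\<close>

lemma vpk_approx:
  assumes "l > 0" "0 \<le> \<eta>" and [measurable]: "g \<in> borel_measurable borel"
    and B: "\<And>s. \<bar>g s - g0\<bar> \<le> B" and e: "\<And>s. \<bar>s\<bar> \<le> \<eta> \<Longrightarrow> \<bar>g s - g0\<bar> \<le> e" and "0 \<le> e"
  shows "\<bar>(\<integral>s. g s * (l * vpk (l * s)) \<partial>lborel) - g0 * (\<integral>s. vpk s \<partial>lborel)\<bar>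
     \<le> e * (\<integral>s. \<bar>vpk s\<bar> \<partial>lborel) + B * (\<integral>s. indicator {s. l * \<eta> < \<bar>s\<bar>} s * \<bar>vpk s\<bar> \<partial>lborel)"
proof -
  let ?k = "\<lambda>s. l * vpk (l * s)"
  let ?T = "\<lambda>s. indicator {s. l * \<eta> < \<bar>s\<bar>} s * \<bar>vpk s\<bar> :: real"
  have k: "integrable lborel ?k" by (rule integrable_vpk_scaled[OF assms(1)])
  have ka: "integrable lborel (\<lambda>s. l * \<bar>vpk (l * s)\<bar>)"
    using integrable_abs[OF k] assms(1) by (simp add: abs_mult)
  have ka': "(\<integral>s. l * \<bar>vpk (l * s)\<bar> \<partial>lborel) = (\<integral>s. \<bar>vpk s\<bar> \<partial>lborel)"
    using lborel_integral_real_affine[of l "\<lambda>s. \<bar>vpk s\<bar>" 0] assms(1) by simp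
  have T: "integrable lborel ?T"
    by (rule Bochner_Integration.integrable_bound[OF integrable_vpk]) (auto simp: indicator_def)
  have T': "integrable lborel (\<lambda>s. l * ?T (l * s))"
    using lborel_integrable_real_affine[OF T, of l 0] assms(1) by simp
  have T'': "(\<integral>s. l * ?T (l * s) \<partial>lborel) = (\<integral>s. ?T s \<partial>lborel)"
    using lborel_integral_real_affine[of l ?T 0] assms(1) by simp
  have "0 \<le> B" using B[of 0] by linarith
  have gk: "integrable lborel (\<lambda>s. (g s - g0) * ?k s)"
  proof (rule Bochner_Integration.integrable_bound[where f="\<lambda>s. B * ?k s"])
    show "AE s in lborel. norm ((g s - g0) * ?k s) \<le> norm (B * ?k s)"
      using B \<open>0 \<le> B\<close> by (auto simp: abs_mult intro!: mult_right_mono)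
  qed (use k in auto)
  have eq: "(\<integral>s. g s * ?k s \<partial>lborel) - g0 * (\<integral>s. vpk s \<partial>lborel) = (\<integral>s. (g s - g0) * ?k s \<partial>lborel)"
  proof -
    have "(\<integral>s. g s * ?k s \<partial>lborel) = (\<integral>s. (g s - g0) * ?k s + g0 * ?k s \<partial>lborel)"
      by (simp add: algebra_simps)
    also have "\<dots> = (\<integral>s. (g s - g0) * ?k s \<partial>lborel) + g0 * (\<integral>s. ?k s \<partial>lborel)"
      using gk k by (subst Bochner_Integration.integral_add) auto
    finally show ?thesis by (simp only: integral_vpk_scaled[OF assms(1)])
  qed
  have "\<bar>\<integral>s. (g s - g0) * ?k s \<partial>lborel\<bar> \<le> (\<integral>s. e * (l * \<bar>vpk (l * s)\<bar>) + B * (l * ?T (l * s)) \<partial>lborel)"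
  proof (rule integral_abs_bound[THEN order_trans], rule integral_mono)
    fix s
    have "\<bar>g s - g0\<bar> * \<bar>vpk (l * s)\<bar> \<le> e * \<bar>vpk (l * s)\<bar> + B * ?T (l * s)"
    proof (cases "\<bar>s\<bar> \<le> \<eta>")
      case True
      then show ?thesis using e[OF True] \<open>0 \<le> B\<close>
        by (intro order_trans[OF mult_right_mono[OF e[OF True]]]) auto
    next
      case False
      then have "l * \<eta> < \<bar>l * s\<bar>" using assms(1) by (simp add: abs_mult)
      then have T: "?T (l * s) = \<bar>vpk (l * s)\<bar>" by (simp add: indicator_def)
      have "0 \<le> e * \<bar>vpk (l * s)\<bar>" using \<open>0 \<le> e\<close> by simp
      then show ?thesis unfolding T
        using mult_right_mono[OF B[of s], of "\<bar>vpk (l * s)\<bar>"] by linarith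
    qed
    then have "l * (\<bar>g s - g0\<bar> * \<bar>vpk (l * s)\<bar>) \<le> l * (e * \<bar>vpk (l * s)\<bar> + B * ?T (l * s))"
      using assms(1) by (intro mult_left_mono) auto
    then show "\<bar>(g s - g0) * ?k s\<bar> \<le> e * (l * \<bar>vpk (l * s)\<bar>) + B * (l * ?T (l * s))"
      using assms(1) unfolding abs_mult by (simp add: algebra_simps)
    show "integrable lborel (\<lambda>s. \<bar>(g s - g0) * ?k s\<bar>)" by (rule integrable_abs[OF gk])
    show "integrable lborel (\<lambda>s. e * (l * \<bar>vpk (l * s)\<bar>) + B * (l * ?T (l * s)))"
      by (rule Bochner_Integration.integrable_add[OF integrable_mult_right[OF ka] integrable_mult_right[OF T']])
  qed
  also have "\<dots> = e * (\<integral>s. \<bar>vpk s\<bar> \<partial>lborel) + B * (\<integral>s. ?T s \<partial>lborel)"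
  proof -
    have *: "(\<integral>s. e * f s + B * h s \<partial>lborel) = e * (\<integral>s. f s \<partial>lborel) + B * (\<integral>s. h s \<partial>lborel)"
      if "integrable lborel f" "integrable lborel h" for f h :: "real \<Rightarrow> real"
      using that by simp
    show ?thesis by (simp only: *[OF ka T'] ka' T'')
  qed
  finally show ?thesis unfolding eq .
qed

text \<open>Continuity of translation in the mean, by dominated convergence; pointwise convergence
  is obtained at every \<open>s\<close> other than 0, hence almost everywhere.\<close>

lemma vpk_translation:
  "((\<lambda>b. \<integral>s. \<bar>vpk (s + b) - vpk s\<bar> \<partial>lborel) \<longlongrightarrow> 0) (at 0)"
  unfolding tendsto_at_iff_sequentially
proof (intro allI impI)
  fix X :: "nat \<Rightarrow> real" assume "X \<longlonglongrightarrow> 0"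
  then obtain N where N: "\<And>n. n \<ge> N \<Longrightarrow> \<bar>X n\<bar> \<le> 1"
    using LIMSEQ_D[of X 0 1] by (auto intro: less_imp_le)
  have "(\<lambda>n. \<integral>s. \<bar>vpk (s + X (n + N)) - vpk s\<bar> \<partial>lborel) \<longlonglongrightarrow> (\<integral>s. 0 \<partial>(lborel :: real measure))"
  proof (rule integral_dominated_convergence[where w="\<lambda>s. 100 / (1 + s\<^sup>2)"])
    show "AE s in lborel. (\<lambda>n. \<bar>vpk (s + X (n + N)) - vpk s\<bar>) \<longlonglongrightarrow> 0"
      using AE_lborel_singleton[of "0::real"]
    proof eventually_elim
      case (elim s)
      have "(\<lambda>n. s + X (n + N)) \<longlonglongrightarrow> s + 0"
        by (intro tendsto_intros LIMSEQ_ignore_initial_segment \<open>X \<longlonglongrightarrow> 0\<close>)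
      then have "(\<lambda>n. vpk (s + X (n + N))) \<longlonglongrightarrow> vpk s"
        using isCont_vpk[OF elim] by (auto intro: isCont_tendsto_compose)
      then have "(\<lambda>n. \<bar>vpk (s + X (n + N)) - vpk s\<bar>) \<longlonglongrightarrow> \<bar>vpk s - vpk s\<bar>"
        by (intro tendsto_intros)
      then show ?case by simp
    qed
    show "AE s in lborel. norm \<bar>vpk (s + X (n + N)) - vpk s\<bar> \<le> 100 / (1 + s\<^sup>2)" for n
    proof (rule AE_I2)
      fix s :: real
      let ?b = "X (n + N)"
      have b: "?b\<^sup>2 \<le> 1" using N[of "n + N"] by (simp add: abs_square_le_1)
      \<comment> \<open>Together with \<open>b\<^sup>2 \<le> 1\<close> this square shows that
        \<open>1 + s\<^sup>2\<close> is at most three times \<open>1 + (s + b)\<^sup>2\<close>, so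
        the majorant has the constant 100 = 3 * 25 + 25.\<close>
      have "0 \<le> (2 * s + 3 * ?b)\<^sup>2" by simp
      then have "1 + s\<^sup>2 \<le> 3 * (1 + (s + ?b)\<^sup>2)"
        using b by (auto simp: power2_eq_square algebra_simps)
      moreover have "25 / D + 25 / E \<le> 100 / E" if "E \<le> 3 * D" "0 < E" "0 < D" for D E :: real
        using that by (simp add: field_simps)
      ultimately have le: "25 / (1 + (s + ?b)\<^sup>2) + 25 / (1 + s\<^sup>2) \<le> 100 / (1 + s\<^sup>2)"
        by (simp add: add_pos_nonneg)
      have "\<bar>vpk (s + ?b) - vpk s\<bar> \<le> \<bar>vpk (s + ?b)\<bar> + \<bar>vpk s\<bar>" by (rule abs_triangle_ineq4)
      also have "\<dots> \<le> 25 / (1 + (s + ?b)\<^sup>2) + 25 / (1 + s\<^sup>2)" by (intro add_mono abs_vpk_le)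
      also note le
      finally show "norm \<bar>vpk (s + ?b) - vpk s\<bar> \<le> 100 / (1 + s\<^sup>2)" by simp
    qed
  qed (use integrable_inverse_square in auto)
  then have "(\<lambda>n. \<integral>s. \<bar>vpk (s + X (n + N)) - vpk s\<bar> \<partial>lborel) \<longlonglongrightarrow> 0" by simp
  then have "(\<lambda>n. \<integral>s. \<bar>vpk (s + X n) - vpk s\<bar> \<partial>lborel) \<longlonglongrightarrow> 0"
    by (rule LIMSEQ_offset)
  then show "((\<lambda>b. \<integral>s. \<bar>vpk (s + b) - vpk s\<bar> \<partial>lborel) \<circ> X) \<longlonglongrightarrow> 0"
    by (simp add: o_def)
qed

lemma measurable_cis [measurable]: "cis \<in> borel_measurable borel"
  by (intro borel_measurable_continuous_onI continuous_intros)

text \<open>Shifting \<open>t\<close> by half a period \<open>pi / a\<close> changes the sign of the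
  exponential, so twice the integral is the oscillatory integral of
  \<open>g t - g (t + pi / a)\<close>. By continuity and compact support this difference tends to 0
  in the mean.\<close>

lemma riemann_lebesgue:
  fixes g :: "real \<Rightarrow> complex"
  assumes cont: "continuous_on UNIV g" and B: "\<And>t. B < \<bar>t\<bar> \<Longrightarrow> g t = 0"
  shows "((\<lambda>a. \<integral>t. g t * cis (- (t * a)) \<partial>lborel) \<longlongrightarrow> 0) at_top"
proof -
  have [measurable]: "g \<in> borel_measurable borel"
    by (rule borel_measurable_continuous_onI[OF cont])
  define B' where "B' = \<bar>B\<bar>"
  have B': "g t = 0" if "B' < \<bar>t\<bar>" for t using B that by (simp add: B'_def)
  have "compact (g ` cball 0 B')"
    by (intro compact_continuous_image continuous_on_subset[OF cont]) auto
  then have "bounded (g ` cball 0 B')" by (rule compact_imp_bounded)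
  then obtain C where C: "\<And>t. t \<in> cball 0 B' \<Longrightarrow> norm (g t) \<le> C" "0 < C"
    unfolding bounded_pos by blast
  have gC: "norm (g t) \<le> C" for t
    using C B'[of t] by (cases "B' < \<bar>t\<bar>") auto
  have g: "integrable lborel g"
  proof (rule Bochner_Integration.integrable_bound[where f="\<lambda>t. C * indicator {-B'..B'} t"])
    show "AE t in lborel. norm (g t) \<le> norm (C * indicator {-B'..B'} t)"
      using gC B' C(2) by (intro AE_I2) (auto simp: indicator_def)
  qed (simp_all only: integrable_mult_indicator_Icc, measurable)
  have "((\<lambda>a. \<integral>t. norm (g t - g (t + pi / a)) \<partial>lborel) \<longlongrightarrow> (\<integral>t. 0 \<partial>(lborel :: real measure))) at_top"
  proof (rule integral_dominated_convergence_at_top[where w="\<lambda>t. (2 * C) * indicator {-(B'+pi)..B'} t"])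
    show "AE t in lborel. ((\<lambda>a. norm (g t - g (t + pi / a))) \<longlongrightarrow> 0) at_top"
    proof (rule AE_I2)
      fix t
      have "((\<lambda>a. t + pi / a) \<longlongrightarrow> t + 0) at_top"
        by (intro tendsto_add tendsto_const real_tendsto_divide_at_top[OF tendsto_const filterlim_ident])
      then have "((\<lambda>a. g (t + pi / a)) \<longlongrightarrow> g t) at_top"
        using cont by (intro isCont_tendsto_compose[of t g]) (auto simp: continuous_on_eq_continuous_at)
      then have "((\<lambda>a. norm (g t - g (t + pi / a))) \<longlongrightarrow> norm (g t - g t)) at_top"
        by (intro tendsto_intros)
      then show "((\<lambda>a. norm (g t - g (t + pi / a))) \<longlongrightarrow> 0) at_top" by simp
    qed
    show "\<forall>\<^sub>F a in at_top. AE t in lborel. norm (norm (g t - g (t + pi / a)))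
        \<le> 2 * C * indicator {-(B'+pi)..B'} t"
      using eventually_ge_at_top[of 1]
    proof eventually_elim
      case (elim a)
      show ?case
      proof (rule AE_I2)
        fix t
        have pa: "0 < pi / a" "pi / a \<le> pi" using elim by (auto simp: field_simps)
        show "norm (norm (g t - g (t + pi / a))) \<le> 2 * C * indicator {-(B'+pi)..B'} t"
        proof (cases "t \<in> {-(B'+pi)..B'}")
          case True
          have "norm (g t - g (t + pi / a)) \<le> C + C"
            by (rule norm_triangle_ineq4[THEN order_trans]) (intro add_mono gC)
          then show ?thesis using True by simp
        next
          case False
          have "B' \<ge> 0" by (simp add: B'_def)
          then have "B' < \<bar>t\<bar>" "B' < \<bar>t + pi / a\<bar>" using False pa by (auto simp: abs_if)
          then show ?thesis using False B' by simp
        qed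
      qed
    qed
  qed (simp_all only: integrable_mult_indicator_Icc, measurable)
  then have lim: "((\<lambda>a. \<integral>t. norm (g t - g (t + pi / a)) \<partial>lborel) \<longlongrightarrow> 0) at_top" by simp
  have ev: "\<forall>\<^sub>F a in at_top. norm (\<integral>t. g t * cis (- (t * a)) \<partial>lborel)
      \<le> (\<integral>t. norm (g t - g (t + pi / a)) \<partial>lborel)"
    using eventually_gt_at_top[of 0]
  proof eventually_elim
    case (elim a)
    let ?I = "\<integral>t. g t * cis (- (t * a)) \<partial>lborel"
    have i: "integrable lborel (\<lambda>t. g t * cis (- (t * a)))"
      by (rule Bochner_Integration.integrable_bound[OF g]) (auto simp: norm_mult)
    have g2: "integrable lborel (\<lambda>t. g (t + pi / a))"
      using lborel_integrable_real_affine[OF g, of 1 "pi / a"] by (simp add: add.commute)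
    have i2: "integrable lborel (\<lambda>t. g (t + pi / a) * cis (- (t * a)))"
      by (rule Bochner_Integration.integrable_bound[OF g2]) (auto simp: norm_mult)
    have "cis (- ((t + pi / a) * a)) = - cis (- (t * a))" for t
    proof -
      have "- ((t + pi / a) * a) = - (t * a) - pi" using elim by (simp add: field_simps)
      then show ?thesis by (simp add: complex_eq_iff)
    qed
    then have "?I = - (\<integral>t. g (t + pi / a) * cis (- (t * a)) \<partial>lborel)"
      by (subst lborel_integral_real_affine[of 1 _ "pi / a"]) (auto simp: add.commute)
    then have eq: "2 * ?I = (\<integral>t. (g t - g (t + pi / a)) * cis (- (t * a)) \<partial>lborel)"
      using i i2 by (simp add: left_diff_distrib)
    have "norm (2 * ?I) \<le> (\<integral>t. norm ((g t - g (t + pi / a)) * cis (- (t * a))) \<partial>lborel)"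
      unfolding eq by (rule integral_norm_bound)
    then have "2 * norm ?I \<le> (\<integral>t. norm (g t - g (t + pi / a)) \<partial>lborel)"
      by (simp add: norm_mult)
    then show ?case using norm_ge_zero[of ?I] by linarith
  qed
  show ?thesis by (rule Lim_null_comparison[OF ev lim])
qed

lemma cesaro_mean:
  fixes a :: "nat \<Rightarrow> real"
  assumes "a \<longlonglongrightarrow> l"
  shows "(\<lambda>n. (\<Sum>k<n. a k) / real n) \<longlonglongrightarrow> l"
proof (rule LIMSEQ_I)
  fix e :: real assume "e > 0"
  then obtain N where N: "\<And>k. k \<ge> N \<Longrightarrow> \<bar>a k - l\<bar> < e / 2"
    using LIMSEQ_D[OF assms, of "e/2"] by auto
  define C where "C = (\<Sum>k<N. \<bar>a k - l\<bar>)"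
  have C: "0 \<le> C" by (simp add: C_def sum_nonneg)
  obtain N' :: nat where N': "real N' > 2 * C / e" using reals_Archimedean2 by blast
  show "\<exists>no. \<forall>n\<ge>no. norm ((\<Sum>k<n. a k) / real n - l) < e"
  proof (intro exI allI impI)
    fix n assume n: "n \<ge> Suc (max N N')"
    then have n0: "real n > 0" "n \<ge> N" by auto
    have "(\<Sum>k<n. a k) / real n - l = (\<Sum>k<n. a k - l) / real n"
      using n0 by (simp add: sum_subtractf field_simps)
    moreover have "\<bar>\<Sum>k<n. a k - l\<bar> \<le> C + real n * (e / 2)"
    proof -
      have "\<bar>\<Sum>k<n. a k - l\<bar> \<le> (\<Sum>k<n. \<bar>a k - l\<bar>)" by (rule sum_abs)
      also have "\<dots> = C + (\<Sum>k=N..<n. \<bar>a k - l\<bar>)"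
        using sum.atLeastLessThan_concat[of 0 N n "\<lambda>k. \<bar>a k - l\<bar>"] n0
        by (simp add: C_def atLeast0LessThan)
      also have "(\<Sum>k=N..<n. \<bar>a k - l\<bar>) \<le> (\<Sum>k=N..<n. e / 2)"
        using N by (intro sum_mono less_imp_le) auto
      also have "\<dots> \<le> real n * (e / 2)" using \<open>e > 0\<close> by (simp add: mult_right_mono)
      finally show ?thesis by simp
    qed
    moreover have "C < real n * (e / 2)"
    proof -
      have "2 * C / e < real n" using N' n by (auto intro: less_trans)
      then show ?thesis using \<open>e > 0\<close> by (simp add: field_simps)
    qed
    ultimately have "\<bar>(\<Sum>k<n. a k) / real n - l\<bar> < (real n * e) / real n"
      using n0 by (simp only: abs_divide abs_of_nat) (intro divide_strict_right_mono, linarith, simp)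
    then show "norm ((\<Sum>k<n. a k) / real n - l) < e" using n0 by simp
  qed
qed

section \<open>Iterates of a sequence of maps\<close>

primrec chain :: "('w \<Rightarrow> real^'d \<Rightarrow> real^'d) \<Rightarrow> nat \<Rightarrow> (nat \<Rightarrow> 'w) \<Rightarrow> real^'d \<Rightarrow> real^'d" where
  "chain T 0 \<omega> x = x"
| "chain T (Suc n) \<omega> x = T (\<omega> n) (chain T n \<omega> x)"

lemma chain_add: "chain T (n + k) \<omega> x = chain T k (\<lambda>i. \<omega> (n + i)) (chain T n \<omega> x)"
  by (induction k) auto

lemma chain_cong: "(\<And>i. i < n \<Longrightarrow> \<omega> i = \<omega>' i) \<Longrightarrow> chain T n \<omega> x = chain T n \<omega>' x"
  by (induction n) auto

lemma chain_comb_seq [simp]: "chain T n (comb_seq n \<omega> \<omega>') x = chain T n \<omega> x"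
  by (rule chain_cong) (simp add: comb_seq_def)

lemma comb_seq_add [simp]: "comb_seq n \<omega> \<omega>' (n + i) = \<omega>' i"
  by (simp add: comb_seq_def)

lemma comb_seq_self [simp]: "comb_seq n \<omega> \<omega>' n = \<omega>' 0"
  by (simp add: comb_seq_def)

text \<open>The Markov property in terms of paths: after \<open>n\<close> steps driven by
  \<open>\<omega>\<close>, the walk restarts from its current position with the fresh noises
  \<open>\<omega>'\<close>.\<close>

lemma chain_add_comb_seq [simp]:
  "chain T (n + k) (comb_seq n \<omega> \<omega>') x = chain T k \<omega>' (chain T n \<omega> x)"
  by (simp add: chain_add)

subsection \<open>The walk driven by an independent sequence\<close>

text \<open>The abstract walk: \<open>M\<close> is the law of one noise and an infinite product of
  copies drives the walk. The bound \<open>m\<close> on increments holds at every noise, which keeps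
  null sets out of the estimates. Memory loss is given through a measurable set of paths, since
  measurability of the rank one event is established afterwards in \<open>sets_coal\<close>. The
  drift is stated from the origin and carried to other starts by the Lipschitz property.\<close>

locale topical_walk = prob_space M for M :: "'w measure" +
  fixes T :: "'w \<Rightarrow> real^'d \<Rightarrow> real^'d" and \<phi> :: "real^'d \<Rightarrow> real" and m :: "'w \<Rightarrow> real" and \<gamma> :: real
  assumes T_meas: "\<And>x. (\<lambda>b. T b x) \<in> borel_measurable M"
    and T_top: "\<And>b. b \<in> space M \<Longrightarrow> topical_op (T b)"
    and \<phi>_top: "topical_fun \<phi>"
    and m_meas [measurable]: "m \<in> borel_measurable M"
    and m_nonneg: "\<And>b. 0 \<le> m b"
    and m_sq: "integrable M (\<lambda>b. (m b)\<^sup>2)"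
    and m_bound: "\<And>b x. b \<in> space M \<Longrightarrow> \<bar>\<phi> (T b x) - \<phi> x\<bar> \<le> m b"
    and memory: "\<exists>N. \<exists>E \<in> sets (\<Pi>\<^sub>M i\<in>(UNIV::nat set). M).
        measure (\<Pi>\<^sub>M i\<in>(UNIV::nat set). M) E > 0 \<and> (\<forall>\<omega>\<in>E. rank_one (chain T N \<omega>))"
    and drift: "AE \<omega> in (\<Pi>\<^sub>M i\<in>(UNIV::nat set). M). (\<lambda>n. \<phi> (chain T n \<omega> 0) / real n) \<longlonglongrightarrow> \<gamma>"
    and \<gamma>_pos: "\<gamma> > 0"
begin

sublocale seq: sequence_space M by unfold_locales

abbreviation S :: "(nat \<Rightarrow> 'w) measure" where "S \<equiv> (\<Pi>\<^sub>M i\<in>(UNIV::nat set). M)"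

abbreviation X :: "nat \<Rightarrow> (nat \<Rightarrow> 'w) \<Rightarrow> real^'d \<Rightarrow> real^'d" where "X \<equiv> chain T"

abbreviation shift :: "nat \<Rightarrow> (nat \<Rightarrow> 'w) \<Rightarrow> nat \<Rightarrow> 'w" where "shift n \<omega> \<equiv> (\<lambda>i. \<omega> (n + i))"

lemma measurable_\<phi> [measurable]: "\<phi> \<in> borel_measurable borel"
  by (intro borel_measurable_continuous_onI topical_fun_continuous \<phi>_top)

lemma measurable_T [measurable (raw)]:
  assumes [measurable]: "f \<in> measurable N M" "g \<in> borel_measurable N"
  shows "(\<lambda>z. T (f z) (g z)) \<in> borel_measurable N"
proof -
  have [measurable]: "(\<lambda>(b, x). T b x) \<in> borel_measurable (M \<Otimes>\<^sub>M borel)"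
    by (rule measurable_eval_topical[OF T_meas T_top])
  have "(\<lambda>z. (\<lambda>(b, x). T b x) (f z, g z)) \<in> borel_measurable N" by measurable
  then show ?thesis by simp
qed

lemma measurable_nth: "f \<in> measurable N S \<Longrightarrow> (\<lambda>z. f z n) \<in> measurable N M"
  by (rule measurable_compose[OF _ measurable_component_singleton]) auto

lemma measurable_chain [measurable (raw)]:
  assumes n [measurable]: "n \<in> measurable N (count_space UNIV)"
    and f [measurable]: "f \<in> measurable N S" and g [measurable]: "g \<in> borel_measurable N"
  shows "(\<lambda>z. X (n z) (f z) (g z)) \<in> borel_measurable N"
proof -
  have "(\<lambda>z. X k (f z) (g z)) \<in> borel_measurable N" for k
    by (induction k) (auto intro!: measurable_T measurable_nth[OF f])
  then show ?thesis by (rule measurable_compose_countable[OF _ n])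
qed

lemma measurable_shift [measurable (raw)]:
  assumes f: "f \<in> measurable N S" and n: "n \<in> measurable N (count_space UNIV)"
  shows "(\<lambda>z. shift (n z) (f z)) \<in> measurable N S"
proof -
  have "(\<lambda>z. shift k (f z)) \<in> measurable N S" for k
    by (rule measurable_PiM_single')
      (auto intro!: measurable_nth[OF f] simp: PiE_iff measurable_space[OF measurable_nth[OF f]])
  then show ?thesis by (rule measurable_compose_countable[OF _ n])
qed

lemma space_S_nth: "\<omega> \<in> space S \<Longrightarrow> \<omega> n \<in> space M"
  by (auto simp: space_PiM)

lemma space_S_shift: "\<omega> \<in> space S \<Longrightarrow> shift n \<omega> \<in> space S"
  by (auto simp: space_PiM)

lemma topical_chain: "\<omega> \<in> space S \<Longrightarrow> topical_op (X n \<omega>)"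
proof (induction n)
  case 0
  have "X 0 \<omega> = (\<lambda>x. x)" by (simp add: fun_eq_iff)
  then show ?case by (simp add: topical_op_id)
next
  case (Suc n)
  have "X (Suc n) \<omega> = (\<lambda>x. T (\<omega> n) (X n \<omega> x))" by (simp add: fun_eq_iff)
  then show ?case using Suc by (simp add: topical_op_comp[OF T_top[OF space_S_nth]])
qed

lemma continuous_chain: "\<omega> \<in> space S \<Longrightarrow> continuous_on UNIV (X n \<omega>)"
  by (rule topical_op_continuous[OF topical_chain])

lemma chain_diff_ones: "\<omega> \<in> space S \<Longrightarrow> X n \<omega> (x - a *\<^sub>R ones) = X n \<omega> x - a *\<^sub>R ones"
  by (rule topical_opD_diff[OF topical_chain])

lemma chain_add_ones: "\<omega> \<in> space S \<Longrightarrow> X n \<omega> (x + a *\<^sub>R ones) = X n \<omega> x + a *\<^sub>R ones"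
  by (rule topical_opD_add[OF topical_chain])

lemma \<phi>_chain_bound: "\<omega> \<in> space S \<Longrightarrow> \<bar>\<phi> (X n \<omega> x) - \<phi> x\<bar> \<le> (\<Sum>i<n. m (\<omega> i))"
proof (induction n)
  case (Suc n)
  have "\<bar>\<phi> (X (Suc n) \<omega> x) - \<phi> (X n \<omega> x)\<bar> \<le> m (\<omega> n)"
    using m_bound[OF space_S_nth[OF Suc.prems]] by simp
  then show ?case using Suc by simp
qed simp

text \<open>The product measure is invariant under gluing the first \<open>n\<close> noises of one
  path to a second independent path. Fubini on the two paths then takes the role of conditioning on
  the first \<open>n\<close> steps.\<close>

lemma nn_integral_comb_seq:
  assumes [measurable]: "f \<in> borel_measurable S"
  shows "(\<integral>\<^sup>+\<omega>. f \<omega> \<partial>S) = (\<integral>\<^sup>+\<omega>. \<integral>\<^sup>+\<omega>'. f (comb_seq n \<omega> \<omega>') \<partial>S \<partial>S)"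
proof -
  have "(\<integral>\<^sup>+\<omega>. f \<omega> \<partial>S) = (\<integral>\<^sup>+z. f (case z of (\<omega>, \<omega>') \<Rightarrow> comb_seq n \<omega> \<omega>') \<partial>(S \<Otimes>\<^sub>M S))"
    by (subst seq.PiM_comb_seq[symmetric, of n], subst nn_integral_distr) auto
  also have "\<dots> = (\<integral>\<^sup>+\<omega>. \<integral>\<^sup>+\<omega>'. f (comb_seq n \<omega> \<omega>') \<partial>S \<partial>S)"
    by (subst seq.P.nn_integral_fst[symmetric]) auto
  finally show ?thesis .
qed

lemma integral_comb_seq:
  fixes f :: "_ \<Rightarrow> 'b::{banach, second_countable_topology}"
  assumes f: "integrable S f"
  shows "(\<integral>\<omega>. f \<omega> \<partial>S) = (\<integral>\<omega>. \<integral>\<omega>'. f (comb_seq n \<omega> \<omega>') \<partial>S \<partial>S)"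
    and "integrable S (\<lambda>\<omega>. \<integral>\<omega>'. f (comb_seq n \<omega> \<omega>') \<partial>S)"
proof -
  interpret SS: pair_sigma_finite S S ..
  have [measurable]: "f \<in> borel_measurable S" using f by auto
  have i: "integrable (S \<Otimes>\<^sub>M S) (\<lambda>z. f (case z of (\<omega>, \<omega>') \<Rightarrow> comb_seq n \<omega> \<omega>'))"
    by (subst integrable_distr_eq[symmetric, where N=S]) (auto simp: seq.PiM_comb_seq f)
  have "(\<integral>\<omega>. f \<omega> \<partial>S) = (\<integral>z. f (case z of (\<omega>, \<omega>') \<Rightarrow> comb_seq n \<omega> \<omega>') \<partial>(S \<Otimes>\<^sub>M S))"
    by (subst seq.PiM_comb_seq[symmetric, of n], subst integral_distr) auto
  also have "\<dots> = (\<integral>\<omega>. \<integral>\<omega>'. f (comb_seq n \<omega> \<omega>') \<partial>S \<partial>S)"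
    using SS.integral_fst'[OF i] by simp
  finally show "(\<integral>\<omega>. f \<omega> \<partial>S) = (\<integral>\<omega>. \<integral>\<omega>'. f (comb_seq n \<omega> \<omega>') \<partial>S \<partial>S)" .
  show "integrable S (\<lambda>\<omega>. \<integral>\<omega>'. f (comb_seq n \<omega> \<omega>') \<partial>S)"
    using SS.integrable_fst'[OF i] by simp
qed

subsection \<open>Memory loss\<close>

definition coal :: "nat \<Rightarrow> (nat \<Rightarrow> 'w) set" where
  "coal n = {\<omega> \<in> space S. rank_one (X n \<omega>)}"

lemma coalD: "\<omega> \<in> coal n \<Longrightarrow> pnorm (X n \<omega> x) = pnorm (X n \<omega> y)"
  by (auto simp: coal_def rank_one_def pequiv_iff)

lemma coalI: "\<omega> \<in> space S \<Longrightarrow> (\<And>x. pnorm (X n \<omega> x) = pnorm (X n \<omega> 0)) \<Longrightarrow> \<omega> \<in> coal n"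
  by (auto simp: coal_def rank_one_iff)

lemma sets_coal [measurable]: "coal n \<in> sets S"
proof -
  obtain d :: "nat \<Rightarrow> real^'d" where d: "closure (range d) = UNIV" by (rule obtain_dense_seq)
  have "coal n = {\<omega> \<in> space S. \<forall>i. pnorm (X n \<omega> (d i)) = pnorm (X n \<omega> 0)}"
  proof safe
    fix \<omega> assume w: "\<omega> \<in> space S" "\<forall>i. pnorm (X n \<omega> (d i)) = pnorm (X n \<omega> 0)"
    have "closed {x. pnorm (X n \<omega> x) = pnorm (X n \<omega> 0)}"
      by (intro closed_Collect_eq continuous_on_compose2[OF continuous_on_pnorm continuous_chain] w)
        auto
    then have "pnorm (X n \<omega> x) = pnorm (X n \<omega> 0)" for x
      using Collect_dense_all[OF d, of "\<lambda>x. pnorm (X n \<omega> x) = pnorm (X n \<omega> 0)"] w(2) by blast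
    then show "\<omega> \<in> coal n" using w(1) by (intro coalI)
  next
    fix \<omega> x assume "\<omega> \<in> coal n" then show "pnorm (X n \<omega> x) = pnorm (X n \<omega> 0)" by (rule coalD)
  qed (simp add: coal_def)
  also have "\<dots> \<in> sets S"
    by (intro sets.sets_Collect_countable_All measurable_equality_set) measurable
  finally show ?thesis .
qed

lemma coal_mono: "\<omega> \<in> coal n \<Longrightarrow> \<omega> \<in> coal (n + k)"
proof (rule coalI)
  assume w: "\<omega> \<in> coal n"
  then show s: "\<omega> \<in> space S" by (simp add: coal_def)
  show "pnorm (X (n + k) \<omega> x) = pnorm (X (n + k) \<omega> 0)" for x
    unfolding chain_add
    by (rule topical_op_pnorm_cong[OF topical_chain[OF space_S_shift[OF s]] coalD[OF w]])
qed

definition pfar :: "nat \<Rightarrow> real" where "pfar n = measure S (space S - coal n)"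

lemma pfar_nonneg: "0 \<le> pfar n"
  by (simp add: pfar_def)

lemma pfar_antimono: "pfar (n + k) \<le> pfar n"
  unfolding pfar_def by (rule seq.P.finite_measure_mono) (auto intro: coal_mono)

text \<open>Merging in either of two consecutive blocks is enough: a class common to all starts
  survives the second block, and a second block of rank one merges whatever the first produced.
  Failure requires both blocks to fail, and they are independent.\<close>

lemma pfar_submult: "pfar (n + k) \<le> pfar n * pfar k"
proof -
  let ?F = "\<lambda>n. space S - coal n"
  have imp: "comb_seq n \<omega> \<omega>' \<in> coal (n + k)" if "\<omega> \<in> space S" "\<omega>' \<in> space S" "\<omega> \<in> coal n \<or> \<omega>' \<in> coal k" for \<omega> \<omega>'
  proof (rule coalI)
    show s: "comb_seq n \<omega> \<omega>' \<in> space S"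
      using that(1,2) by (auto simp: space_PiM comb_seq_def PiE_iff)
    show "pnorm (X (n + k) (comb_seq n \<omega> \<omega>') x) = pnorm (X (n + k) (comb_seq n \<omega> \<omega>') 0)" for x
      using that(3) topical_op_pnorm_cong[OF topical_chain[OF that(2), of k]] coalD
      unfolding chain_add_comb_seq by blast
  qed
  have "emeasure S (?F (n + k)) = (\<integral>\<^sup>+\<omega>. indicator (?F (n + k)) \<omega> \<partial>S)" by simp
  also have "\<dots> = (\<integral>\<^sup>+\<omega>. \<integral>\<^sup>+\<omega>'. indicator (?F (n + k)) (comb_seq n \<omega> \<omega>') \<partial>S \<partial>S)"
    by (rule nn_integral_comb_seq) measurable
  also have "\<dots> \<le> (\<integral>\<^sup>+\<omega>. \<integral>\<^sup>+\<omega>'. indicator (?F n) \<omega> * indicator (?F k) \<omega>' \<partial>S \<partial>S)"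
    using imp by (intro nn_integral_mono) (auto simp: indicator_def)
  also have "\<dots> = emeasure S (?F n) * emeasure S (?F k)"
    by (simp add: nn_integral_cmult nn_integral_multc)
  finally show ?thesis
    by (simp add: pfar_def seq.P.emeasure_eq_measure ennreal_mult[symmetric] measure_nonneg)
qed

text \<open>Submultiplicativity gives geometric decay along multiples of the time \<open>N\<close>
  at which merging has positive probability; monotonicity fills the gaps.\<close>

lemma pfar_tendsto: "pfar \<longlonglongrightarrow> 0"
proof -
  obtain N E where E: "E \<in> sets S" "measure S E > 0" "\<And>\<omega>. \<omega> \<in> E \<Longrightarrow> rank_one (X N \<omega>)"
    using memory by blast
  have "E \<subseteq> coal N" using E(3) sets.sets_into_space[OF E(1)] by (auto simp: coal_def)
  then have "measure S E \<le> measure S (coal N)" by (rule seq.P.finite_measure_mono) simp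
  then have "measure S (coal N) > 0" using E(2) by linarith
  then have p1: "pfar N < 1"
    unfolding pfar_def by (subst seq.P.prob_compl) auto
  have pow: "pfar (j * N) \<le> pfar N ^ j" for j
  proof (induction j)
    case 0
    show ?case by (simp add: pfar_def)
  next
    case (Suc j)
    have "pfar (N + j * N) \<le> pfar N * pfar (j * N)" by (rule pfar_submult)
    also have "\<dots> \<le> pfar N * pfar N ^ j" using Suc by (intro mult_left_mono pfar_nonneg)
    finally show ?case by simp
  qed
  show ?thesis
  proof (rule LIMSEQ_I)
    fix e :: real assume "e > 0"
    then obtain j where j: "pfar N ^ j < e"
      using real_arch_pow_inv[OF \<open>e > 0\<close> p1] by blast
    have "pfar n < e" if "n \<ge> j * N" for n
      using pfar_antimono[of "j * N" "n - j * N"] pow[of j] j that by simp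
    then show "\<exists>no. \<forall>n\<ge>no. norm (pfar n - 0) < e"
      using pfar_nonneg by (intro exI[of _ "j * N"]) auto
  qed
qed

lemma AE_coal: "AE \<omega> in S. \<exists>n. \<omega> \<in> coal n"
proof -
  let ?N = "space S - (\<Union>n. coal n)"
  have "measure S ?N \<le> pfar n" for n
    unfolding pfar_def by (rule seq.P.finite_measure_mono) auto
  then have "measure S ?N \<le> 0"
    by (intro LIMSEQ_le_const[OF pfar_tendsto]) auto
  then have "measure S ?N = 0" using measure_nonneg[of S ?N] by linarith
  then have "?N \<in> null_sets S" by (auto simp: null_sets_def seq.P.emeasure_eq_measure)
  then show ?thesis by (rule AE_I') auto
qed

subsection \<open>Transience and the renewal measure\<close>

text \<open>The threshold 3 exceeds 2, the width of a slab of half-width 1: a path that escapes from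
  a point of such a slab is outside it at all times from \<open>k\<close> on.\<close>

definition escape :: "nat \<Rightarrow> (nat \<Rightarrow> 'w) set" where
  "escape k = {\<omega> \<in> space S. \<forall>n\<ge>k. \<forall>x. 3 \<le> \<phi> (X n \<omega> x) - \<phi> x}"

lemma continuous_\<phi>_chain: "\<omega> \<in> space S \<Longrightarrow> continuous_on UNIV (\<lambda>x. \<phi> (X n \<omega> x))"
  by (intro topical_fun_continuous topical_fun_comp[OF \<phi>_top topical_chain])

lemma sets_escape [measurable]: "escape k \<in> sets S"
proof -
  obtain d :: "nat \<Rightarrow> real^'d" where d: "closure (range d) = UNIV" by (rule obtain_dense_seq)
  have "escape k = {\<omega> \<in> space S. \<forall>n. k \<le> n \<longrightarrow> (\<forall>i. 3 \<le> \<phi> (X n \<omega> (d i)) - \<phi> (d i))}"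
  proof safe
    fix \<omega> assume w: "\<omega> \<in> space S" "\<forall>n. k \<le> n \<longrightarrow> (\<forall>i. 3 \<le> \<phi> (X n \<omega> (d i)) - \<phi> (d i))"
    have "closed {x. 3 \<le> \<phi> (X n \<omega> x) - \<phi> x}" for n
      by (intro closed_Collect_le continuous_intros continuous_\<phi>_chain[OF w(1)]
          topical_fun_continuous \<phi>_top)
    then have "3 \<le> \<phi> (X n \<omega> x) - \<phi> x" if "n \<ge> k" for n x
      using Collect_dense_all[OF d, of "\<lambda>x. 3 \<le> \<phi> (X n \<omega> x) - \<phi> x"] w(2) that by auto
    then show "\<omega> \<in> escape k" using w(1) by (auto simp: escape_def)
  qed (auto simp: escape_def)
  also have "\<dots> \<in> sets S"
    by measurable
  finally show ?thesis .
qed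

lemma drift_at_top: "AE \<omega> in S. \<forall>x. filterlim (\<lambda>n. \<phi> (X n \<omega> x)) at_top sequentially"
  using drift AE_space
proof eventually_elim
  case (elim \<omega>)
  have 0: "filterlim (\<lambda>n. \<phi> (X n \<omega> 0)) at_top sequentially"
  proof -
    have "filterlim (\<lambda>n. (\<phi> (X n \<omega> 0) / real n) * real n) at_top sequentially"
      by (rule filterlim_tendsto_pos_mult_at_top[OF elim(1) \<gamma>_pos filterlim_real_sequentially])
    moreover have ev: "\<forall>\<^sub>F n in sequentially. \<phi> (X n \<omega> 0) / real n * real n = \<phi> (X n \<omega> 0)"
      using eventually_gt_at_top[of 0] by eventually_elim simp
    ultimately show ?thesis
      by (simp only: filterlim_cong[OF refl refl ev])
  qed
  show ?case
  proof
    fix x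
    show "filterlim (\<lambda>n. \<phi> (X n \<omega> x)) at_top sequentially"
    proof (rule filterlim_at_top_mono)
      show "filterlim (\<lambda>n. - norm (x - 0) + \<phi> (X n \<omega> 0)) at_top sequentially"
        by (rule filterlim_tendsto_add_at_top[OF tendsto_const 0])
      show "\<forall>\<^sub>F n in sequentially. - norm (x - 0) + \<phi> (X n \<omega> 0) \<le> \<phi> (X n \<omega> x)"
        using topical_fun_dist[OF topical_fun_comp[OF \<phi>_top topical_chain[OF elim(2)]], of _ x 0]
        by (intro always_eventually allI) (smt (verit))
    qed
  qed
qed

text \<open>Uniformity over all starts comes from coalescence. Once all walks lie in one class, at
  time \<open>n0\<close>, their differences are fixed multiples of \<open>ones\<close>, so later
  increments of \<open>\<phi>\<close> agree with those of the walk from 0, which tend to infinity.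
  The increments up to \<open>n0\<close> are bounded by \<open>Z\<close> for every start.\<close>

lemma AE_escape: "AE \<omega> in S. \<exists>k. \<omega> \<in> escape k"
  using AE_coal drift_at_top AE_space
proof eventually_elim
  case (elim \<omega>)
  then obtain n0 where n0: "\<omega> \<in> coal n0" by auto
  define Z where "Z = (\<Sum>i<n0. m (\<omega> i))"
  obtain k where k: "\<And>n. n \<ge> k \<Longrightarrow> \<phi> (X n0 \<omega> 0) + Z + 3 \<le> \<phi> (X n \<omega> 0)"
    using elim(2) unfolding filterlim_at_top eventually_sequentially by blast
  have "3 \<le> \<phi> (X n \<omega> x) - \<phi> x" if n: "n \<ge> max k n0" for n x
  proof -
    obtain c where c: "X n0 \<omega> x = X n0 \<omega> 0 + c *\<^sub>R ones"
      using coalD[OF n0, of x 0] by (auto simp: pnorm_eq_iff)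
    have "X n \<omega> y = X (n - n0) (shift n0 \<omega>) (X n0 \<omega> y)" for y
      using chain_add[of T n0 "n - n0" \<omega> y] n by simp
    then have "X n \<omega> x = X n \<omega> 0 + c *\<^sub>R ones"
      by (simp add: c chain_add_ones[OF space_S_shift[OF elim(3)]])
    then have "\<phi> (X n \<omega> x) - \<phi> (X n0 \<omega> x) = \<phi> (X n \<omega> 0) - \<phi> (X n0 \<omega> 0)"
      by (simp add: c topical_funD_add[OF \<phi>_top])
    moreover have "\<bar>\<phi> (X n0 \<omega> x) - \<phi> x\<bar> \<le> Z"
      unfolding Z_def by (rule \<phi>_chain_bound[OF elim(3)])
    ultimately show ?thesis using k[of n] n by linarith
  qed
  then show ?case using elim(3) unfolding escape_def by blast
qed

lemma ex_escape: "\<exists>k. measure S (escape k) \<ge> 1 / 2"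
proof -
  have inc: "incseq escape" by (auto simp: incseq_def escape_def)
  have "measure S (\<Union>k. escape k) = 1"
    using AE_escape by (subst seq.P.prob_eq_1) auto
  then have "(\<lambda>k. measure S (escape k)) \<longlonglongrightarrow> 1"
    using seq.P.finite_Lim_measure_incseq[OF _ inc] sets_escape by (simp add: image_subset_iff)
  then have "\<forall>\<^sub>F k in sequentially. measure S (escape k) > 1 / 2"
    by (rule order_tendstoD) simp
  then show ?thesis by (auto simp: eventually_sequentially intro: less_imp_le)
qed

text \<open>Time with counting measure times the path space: an expected number of visits becomes
  the measure of a set, and sums over time of expectations become single integrals.\<close>

abbreviation UO :: "(nat \<times> (nat \<Rightarrow> 'w)) measure" where "UO \<equiv> count_space UNIV \<Otimes>\<^sub>M S"

abbreviation visit :: "nat \<times> (nat \<Rightarrow> 'w) \<Rightarrow> real^'d \<Rightarrow> real^'d" where "visit z \<equiv> X (fst z) (snd z)"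

lemma nn_integral_UO:
  assumes [measurable]: "f \<in> borel_measurable UO"
  shows "(\<integral>\<^sup>+z. f z \<partial>UO) = (\<Sum>n. \<integral>\<^sup>+\<omega>. f (n, \<omega>) \<partial>S)"
  by (subst seq.P.nn_integral_fst[symmetric]) (auto simp: nn_integral_count_space_nat)

definition slab :: "real^'d \<Rightarrow> real \<Rightarrow> real \<Rightarrow> (nat \<times> (nat \<Rightarrow> 'w)) set" where
  "slab x c l = {z \<in> space UO. \<bar>\<phi> (visit z x) - c\<bar> \<le> l}"

lemma sets_slab [measurable]: "slab x c l \<in> sets UO"
  unfolding slab_def by measurable

text \<open>By independence of the future, the left side is the expected number of visits whose
  future escapes. All of these lie within \<open>k\<close> time units of the first one, because a
  later one would have \<open>\<phi>\<close> larger by at least 3. On the right, the probability of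
  ever coming down to the slab is kept because it yields the limit at minus infinity.\<close>

lemma visits_bound:
  "emeasure UO (slab x c 1) * emeasure S (escape k)
     \<le> ennreal k * emeasure S {\<omega> \<in> space S. \<exists>n. \<phi> (X n \<omega> x) \<le> c + 1}"
proof -
  let ?A = "\<lambda>n. {\<omega> \<in> space S. \<bar>\<phi> (X n \<omega> x) - c\<bar> \<le> 1}"
  let ?B = "{\<omega> \<in> space S. \<exists>n. \<phi> (X n \<omega> x) \<le> c + 1}"
  have B [measurable]: "?B \<in> sets S" by measurable
  have A [measurable]: "?A n \<in> sets S" for n by measurable
  have "emeasure UO (slab x c 1) = (\<integral>\<^sup>+z. indicator (slab x c 1) z \<partial>UO)" by simp
  also have "\<dots> = (\<Sum>n. \<integral>\<^sup>+\<omega>. indicator (slab x c 1) (n, \<omega>) \<partial>S)"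
    by (rule nn_integral_UO) measurable
  also have "\<dots> = (\<Sum>n. \<integral>\<^sup>+\<omega>. indicator (?A n) \<omega> \<partial>S)"
    by (intro suminf_cong nn_integral_cong) (auto simp: slab_def indicator_def space_pair_measure)
  finally have "emeasure UO (slab x c 1) * emeasure S (escape k)
      = (\<Sum>n. (\<integral>\<^sup>+\<omega>. indicator (?A n) \<omega> \<partial>S) * emeasure S (escape k))"
    by (simp add: ennreal_suminf_multc)
  also have "\<dots> = (\<Sum>n. \<integral>\<^sup>+\<omega>. indicator (?A n) \<omega> * indicator (escape k) (shift n \<omega>) \<partial>S)"
  proof (rule suminf_cong)
    fix n
    have "(\<integral>\<^sup>+\<omega>. indicator (?A n) \<omega> * indicator (escape k) (shift n \<omega>) \<partial>S)
      = (\<integral>\<^sup>+\<omega>. \<integral>\<^sup>+\<omega>'. indicator (?A n) (comb_seq n \<omega> \<omega>') *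
            indicator (escape k) (shift n (comb_seq n \<omega> \<omega>')) \<partial>S \<partial>S)"
      by (rule nn_integral_comb_seq) measurable
    also have "\<dots> = (\<integral>\<^sup>+\<omega>. \<integral>\<^sup>+\<omega>'. indicator (?A n) \<omega> * indicator (escape k) \<omega>' \<partial>S \<partial>S)"
      by (intro nn_integral_cong) (auto simp: indicator_def space_PiM comb_seq_def PiE_iff)
    also have "\<dots> = (\<integral>\<^sup>+\<omega>. indicator (?A n) \<omega> \<partial>S) * emeasure S (escape k)"
      by (simp add: nn_integral_cmult nn_integral_multc)
    finally show "(\<integral>\<^sup>+\<omega>. indicator (?A n) \<omega> \<partial>S) * emeasure S (escape k)
      = (\<integral>\<^sup>+\<omega>. indicator (?A n) \<omega> * indicator (escape k) (shift n \<omega>) \<partial>S)" by simp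
  qed
  also have "\<dots> = (\<integral>\<^sup>+\<omega>. (\<Sum>n. indicator (?A n) \<omega> * indicator (escape k) (shift n \<omega>)) \<partial>S)"
    by (rule nn_integral_suminf[symmetric]) measurable
  also have "\<dots> \<le> (\<integral>\<^sup>+\<omega>. ennreal k * indicator ?B \<omega> \<partial>S)"
  proof (rule nn_integral_mono)
    fix \<omega> assume w: "\<omega> \<in> space S"
    define J where "J = {n. \<omega> \<in> ?A n \<and> shift n \<omega> \<in> escape k}"
    have eq: "indicator (?A n) \<omega> * indicator (escape k) (shift n \<omega>) = (indicator J n :: ennreal)" for n
      by (auto simp: J_def indicator_def)
    have "(\<Sum>n. indicator J n :: ennreal) = emeasure (count_space UNIV) J"
      by (subst nn_integral_count_space_nat[symmetric]) simp
    also have "\<dots> \<le> ennreal k * indicator ?B \<omega>"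
    proof (cases "J = {}")
      case False
      define n0 where "n0 = (LEAST n. n \<in> J)"
      have n0: "n0 \<in> J" unfolding n0_def using False by (auto intro: LeastI)
      have le: "n0 \<le> n" if "n \<in> J" for n unfolding n0_def using that by (rule Least_le)
      have "J \<subseteq> {n0..<n0 + k}"
      proof
        fix n assume n: "n \<in> J"
        show "n \<in> {n0..<n0 + k}"
        proof (rule ccontr)
          assume "n \<notin> {n0..<n0 + k}"
          then have nk: "n - n0 \<ge> k" "n0 + (n - n0) = n" using le[OF n] by auto
          have "3 \<le> \<phi> (X (n - n0) (shift n0 \<omega>) (X n0 \<omega> x)) - \<phi> (X n0 \<omega> x)"
            using n0 nk(1) by (auto simp: J_def escape_def)
          then have "3 \<le> \<phi> (X n \<omega> x) - \<phi> (X n0 \<omega> x)"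
            by (subst (asm) chain_add[symmetric]) (simp add: nk(2))
          moreover have "\<bar>\<phi> (X n \<omega> x) - c\<bar> \<le> 1" "\<bar>\<phi> (X n0 \<omega> x) - c\<bar> \<le> 1"
            using n n0 by (auto simp: J_def)
          ultimately show False by linarith
        qed
      qed
      then have "emeasure (count_space UNIV) J \<le> emeasure (count_space UNIV) {n0..<n0 + k}"
        by (intro emeasure_mono) auto
      moreover have "\<omega> \<in> ?B" using n0 w by (auto simp: J_def intro!: exI[of _ n0])
      ultimately show ?thesis by (simp add: ennreal_of_nat_eq_real_of_nat)
    qed simp
    finally show "(\<Sum>n. indicator (?A n) \<omega> * indicator (escape k) (shift n \<omega>)) \<le> ennreal k * indicator ?B \<omega>"
      by (simp add: eq)
  qed
  also have "\<dots> = ennreal k * emeasure S ?B" by (simp add: nn_integral_cmult)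
  finally show ?thesis .
qed

definition esc :: nat where "esc = (SOME k. measure S (escape k) \<ge> 1 / 2)"

text \<open>A slab of half-width 1 receives at most \<open>2 * esc\<close> expected visits, and
  \<open>3 * (l + 1)\<close> bounds the number of such slabs that cover one of half-width
  \<open>l\<close>.\<close>

definition Cr :: real where "Cr = 6 * real esc"

lemma Cr_nonneg: "0 \<le> Cr"
  by (simp add: Cr_def)

lemma slab_1_le:
  "emeasure UO (slab x c 1) \<le> ennreal (2 * real esc) * emeasure S {\<omega> \<in> space S. \<exists>n. \<phi> (X n \<omega> x) \<le> c + 1}"
proof -
  have "measure S (escape esc) \<ge> 1 / 2"
    unfolding esc_def using ex_escape by (rule someI_ex)
  then have "1 \<le> ennreal 2 * emeasure S (escape esc)"
    by (simp add: seq.P.emeasure_eq_measure ennreal_mult[symmetric] del: ennreal_numeral)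
  then have "emeasure UO (slab x c 1) * 1 \<le> emeasure UO (slab x c 1) * (ennreal 2 * emeasure S (escape esc))"
    by (rule mult_left_mono) simp
  also have "\<dots> = ennreal 2 * (emeasure UO (slab x c 1) * emeasure S (escape esc))"
    by (simp add: ac_simps del: ennreal_numeral)
  also have "\<dots> \<le> ennreal 2 * (ennreal esc * emeasure S {\<omega> \<in> space S. \<exists>n. \<phi> (X n \<omega> x) \<le> c + 1})"
    by (intro mult_left_mono visits_bound) simp
  finally show ?thesis by (simp add: ennreal_mult mult.assoc)
qed

text \<open>A slab is covered by unit slabs centred at integer offsets of modulus at most
  \<open>l + 1\<close>, so none of them reaches above \<open>c + l + 2\<close>.\<close>

lemma slab_le_low:
  assumes "0 \<le> l"
  shows "emeasure UO (slab x c l)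
    \<le> ennreal (Cr * (l + 1)) * emeasure S {\<omega> \<in> space S. \<exists>n. \<phi> (X n \<omega> x) \<le> c + l + 2}"
proof -
  define J where "J = {-\<lceil>l\<rceil>..\<lceil>l\<rceil>}"
  define p where "p = emeasure S {\<omega> \<in> space S. \<exists>n. \<phi> (X n \<omega> x) \<le> c + l + 2}"
  have one: "emeasure UO (slab x (c + of_int j) 1) \<le> ennreal (2 * real esc) * p" if "j \<in> J" for j
  proof -
    have "real_of_int j \<le> real_of_int \<lceil>l\<rceil>" using that by (simp add: J_def)
    then have "real_of_int j \<le> l + 1" using of_int_ceiling_le_add_one[of l] by (rule order_trans)
    then have le: "c + of_int j + 1 \<le> c + l + 2" by simp
    have "emeasure S {\<omega> \<in> space S. \<exists>n. \<phi> (X n \<omega> x) \<le> c + of_int j + 1} \<le> p"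
      unfolding p_def by (intro emeasure_mono) (auto intro: order_trans[OF _ le])
    then show ?thesis by (rule order_trans[OF slab_1_le mult_left_mono]) simp
  qed
  have "slab x c l \<subseteq> (\<Union>j\<in>J. slab x (c + of_int j) 1)"
  proof
    fix z assume z: "z \<in> slab x c l"
    define u where "u = \<phi> (visit z x) - c"
    have "\<bar>u\<bar> \<le> l" "z \<in> space UO" using z by (auto simp: slab_def u_def)
    then have "\<lfloor>u\<rfloor> \<in> J" unfolding J_def by (auto; linarith)
    moreover have "z \<in> slab x (c + of_int \<lfloor>u\<rfloor>) 1"
      using \<open>z \<in> space UO\<close> unfolding slab_def u_def by (auto; linarith)
    ultimately show "z \<in> (\<Union>j\<in>J. slab x (c + of_int j) 1)" by blast
  qed
  then have "emeasure UO (slab x c l) \<le> emeasure UO (\<Union>j\<in>J. slab x (c + of_int j) 1)"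
    by (intro emeasure_mono) (auto simp: J_def)
  also have "\<dots> \<le> (\<Sum>j\<in>J. emeasure UO (slab x (c + of_int j) 1))"
    by (rule emeasure_subadditive_finite) (auto simp: J_def)
  also have "\<dots> \<le> (\<Sum>j\<in>J. ennreal (2 * real esc) * p)" by (intro sum_mono one)
  also have "\<dots> = ennreal (real (card J) * (2 * real esc)) * p"
    by (simp add: ennreal_mult ennreal_of_nat_eq_real_of_nat mult.assoc)
  also have "\<dots> \<le> ennreal (Cr * (l + 1)) * p"
  proof (intro mult_right_mono ennreal_leI)
    have "real (card J) = 2 * of_int \<lceil>l\<rceil> + 1" using assms by (simp add: J_def)
    also have "\<dots> \<le> 3 * (l + 1)"
    proof -
      have "2 * c + 1 \<le> 3 * (l + 1)" if "c \<le> l + 1" for c :: real using that assms by simp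
      then show ?thesis using of_int_ceiling_le_add_one[of l] by blast
    qed
    finally have "real (card J) * (2 * real esc) \<le> 3 * (l + 1) * (2 * real esc)"
      by (rule mult_right_mono) simp
    then show "real (card J) * (2 * real esc) \<le> Cr * (l + 1)" by (simp add: Cr_def algebra_simps)
  qed simp
  finally show ?thesis by (simp only: p_def)
qed

lemma slab_le:
  assumes "0 \<le> l"
  shows "emeasure UO (slab x c l) \<le> ennreal (Cr * (l + 1))"
proof -
  have "emeasure UO (slab x c l) \<le> ennreal (Cr * (l + 1)) * 1"
    by (rule order_trans[OF slab_le_low[OF assms] mult_left_mono[OF seq.P.emeasure_le_1]]) simp
  then show ?thesis by simp
qed

lemma slab_finite: "0 \<le> l \<Longrightarrow> emeasure UO (slab x c l) < \<infinity>"
  by (rule le_less_trans[OF slab_le]) auto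

lemma measure_slab_le: "0 \<le> l \<Longrightarrow> measure UO (slab x c l) \<le> Cr * (l + 1)"
  using slab_le[of l x c] Cr_nonneg unfolding measure_def
  by (intro enn2real_leI) auto

lemma slab_dominated:
  fixes f :: "nat \<times> (nat \<Rightarrow> 'w) \<Rightarrow> real"
  assumes [measurable]: "f \<in> borel_measurable UO" and "0 \<le> l" "0 \<le> B"
    and B: "\<And>z. z \<in> space UO \<Longrightarrow> \<bar>f z\<bar> \<le> B * indicator (slab x c l) z"
  shows "integrable UO f" "\<bar>\<integral>z. f z \<partial>UO\<bar> \<le> B * (Cr * (l + 1))"
proof -
  have i: "integrable UO (\<lambda>z. B * indicator (slab x c l) z)"
    using slab_finite[OF \<open>0 \<le> l\<close>] by (intro integrable_mult_right integrable_real_indicator) auto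
  show f: "integrable UO f"
    by (rule Bochner_Integration.integrable_bound[OF i]) (use B \<open>0 \<le> B\<close> in auto)
  have "\<bar>\<integral>z. f z \<partial>UO\<bar> \<le> (\<integral>z. B * indicator (slab x c l) z \<partial>UO)"
    by (rule order_trans[OF integral_abs_bound integral_mono]) (use f i B in auto)
  also have "\<dots> = B * measure UO (slab x c l)" by simp
  also have "\<dots> \<le> B * (Cr * (l + 1))" by (intro mult_left_mono measure_slab_le assms)
  finally show "\<bar>\<integral>z. f z \<partial>UO\<bar> \<le> B * (Cr * (l + 1))" .
qed

lemma UO_sums:
  fixes f :: "nat \<times> (nat \<Rightarrow> 'w) \<Rightarrow> real"
  assumes f: "integrable UO f"
  shows "(\<lambda>n. \<integral>\<omega>. f (n, \<omega>) \<partial>S) sums (\<integral>z. f z \<partial>UO)" "integrable S (\<lambda>\<omega>. f (n, \<omega>))"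
proof -
  interpret CS: pair_sigma_finite "count_space (UNIV :: nat set)" S
    by (intro pair_sigma_finite.intro sigma_finite_measure_count_space seq.P.sigma_finite_measure_axioms)
  show "(\<lambda>n. \<integral>\<omega>. f (n, \<omega>) \<partial>S) sums (\<integral>z. f z \<partial>UO)"
    using sums_integral_count_space_nat[OF CS.integrable_fst'[OF f]] CS.integral_fst'[OF f] by simp
  show "integrable S (\<lambda>\<omega>. f (n, \<omega>))"
    using CS.AE_integrable_fst'[OF f] by (simp add: AE_count_space)
qed

lemma UO_eqI:
  fixes f g :: "nat \<times> (nat \<Rightarrow> 'w) \<Rightarrow> real"
  assumes "integrable UO f" "integrable UO g" "\<And>n. (\<integral>\<omega>. f (n, \<omega>) \<partial>S) = (\<integral>\<omega>. g (n, \<omega>) \<partial>S)"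
  shows "(\<integral>z. f z \<partial>UO) = (\<integral>z. g z \<partial>UO)"
  using UO_sums(1)[OF assms(1)] UO_sums(1)[OF assms(2)] assms(3) by (simp add: sums_iff)

text \<open>The width \<open>k\<close> and the weight \<open>v\<close> are read off the noises after
  the visit, hence are independent of the position at the visit. For a frozen future the slab bound
  applies and gives \<open>v * Cr * (k + 1)\<close>; then the future is integrated. With both equal
  to the bound \<open>m\<close> on the next step this is where the second moment is spent.\<close>

lemma boundary:
  fixes x :: "real^'d" and c :: real
  assumes [measurable]: "v \<in> borel_measurable S" "k \<in> borel_measurable S"
    and nn: "\<And>\<omega>. 0 \<le> v \<omega>" "\<And>\<omega>. 0 \<le> k \<omega>"
    and int: "integrable S (\<lambda>\<omega>. v \<omega> * (k \<omega> + 1))"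
  defines "b \<equiv> \<lambda>z. if \<bar>\<phi> (visit z x) - c\<bar> \<le> k (shift (fst z) (snd z))
      then v (shift (fst z) (snd z)) else 0"
  shows "integrable UO b" "(\<integral>z. b z \<partial>UO) \<le> Cr * (\<integral>\<omega>. v \<omega> * (k \<omega> + 1) \<partial>S)"
proof -
  interpret SS: pair_sigma_finite S S ..
  have b [measurable]: "b \<in> borel_measurable UO" unfolding b_def by measurable
  have b0: "0 \<le> b z" for z using nn by (simp add: b_def)
  define ind where "ind = (\<lambda>n \<omega> \<omega>'. if \<bar>\<phi> (X n \<omega> x) - c\<bar> \<le> k \<omega>' then ennreal (v \<omega>') else 0)"
  have ind [measurable]: "(\<lambda>z. ind n (fst z) (snd z)) \<in> borel_measurable (S \<Otimes>\<^sub>M S)" for n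
    unfolding ind_def by measurable
  have "(\<integral>\<^sup>+z. ennreal (b z) \<partial>UO) = (\<Sum>n. \<integral>\<^sup>+\<omega>. ennreal (b (n, \<omega>)) \<partial>S)"
    by (rule nn_integral_UO) measurable
  also have "\<dots> = (\<Sum>n. \<integral>\<^sup>+\<omega>'. \<integral>\<^sup>+\<omega>. ind n \<omega> \<omega>' \<partial>S \<partial>S)"
  proof (rule suminf_cong)
    fix n
    have "(\<integral>\<^sup>+\<omega>. ennreal (b (n, \<omega>)) \<partial>S) = (\<integral>\<^sup>+\<omega>. \<integral>\<^sup>+\<omega>'. ennreal (b (n, comb_seq n \<omega> \<omega>')) \<partial>S \<partial>S)"
      by (rule nn_integral_comb_seq) measurable
    also have "\<dots> = (\<integral>\<^sup>+\<omega>. \<integral>\<^sup>+\<omega>'. ind n \<omega> \<omega>' \<partial>S \<partial>S)"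
      by (intro nn_integral_cong) (simp add: b_def ind_def)
    also have "\<dots> = (\<integral>\<^sup>+\<omega>'. \<integral>\<^sup>+\<omega>. ind n \<omega> \<omega>' \<partial>S \<partial>S)"
      using SS.Fubini'[of "\<lambda>\<omega> \<omega>'. ind n \<omega> \<omega>'"] ind[of n] by (simp add: split_beta')
    finally show "(\<integral>\<^sup>+\<omega>. ennreal (b (n, \<omega>)) \<partial>S) = (\<integral>\<^sup>+\<omega>'. \<integral>\<^sup>+\<omega>. ind n \<omega> \<omega>' \<partial>S \<partial>S)" .
  qed
  also have "\<dots> = (\<integral>\<^sup>+\<omega>'. (\<Sum>n. \<integral>\<^sup>+\<omega>. ind n \<omega> \<omega>' \<partial>S) \<partial>S)"
    unfolding ind_def by (rule nn_integral_suminf[symmetric]) measurable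
  also have "\<dots> \<le> (\<integral>\<^sup>+\<omega>'. ennreal (v \<omega>' * (Cr * (k \<omega>' + 1))) \<partial>S)"
  proof (rule nn_integral_mono)
    fix \<omega>'
    have "(\<integral>\<^sup>+\<omega>. ind n \<omega> \<omega>' \<partial>S) = ennreal (v \<omega>') * (\<integral>\<^sup>+\<omega>. indicator (slab x c (k \<omega>')) (n, \<omega>) \<partial>S)" for n
      by (subst nn_integral_cmult[symmetric])
        (auto intro!: nn_integral_cong simp: ind_def slab_def indicator_def space_pair_measure)
    then have "(\<Sum>n. \<integral>\<^sup>+\<omega>. ind n \<omega> \<omega>' \<partial>S)
        = ennreal (v \<omega>') * (\<Sum>n. \<integral>\<^sup>+\<omega>. indicator (slab x c (k \<omega>')) (n, \<omega>) \<partial>S)"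
      by (simp only: ennreal_suminf_cmult)
    also have "(\<Sum>n. \<integral>\<^sup>+\<omega>. indicator (slab x c (k \<omega>')) (n, \<omega>) \<partial>S) = emeasure UO (slab x c (k \<omega>'))"
      by (subst nn_integral_UO[symmetric]) auto
    also have "ennreal (v \<omega>') * \<dots> \<le> ennreal (v \<omega>') * ennreal (Cr * (k \<omega>' + 1))"
      by (intro mult_left_mono slab_le nn) simp
    finally show "(\<Sum>n. \<integral>\<^sup>+\<omega>. ind n \<omega> \<omega>' \<partial>S) \<le> ennreal (v \<omega>' * (Cr * (k \<omega>' + 1)))"
      using nn by (simp add: ennreal_mult')
  qed
  also have "\<dots> = ennreal (\<integral>\<omega>'. v \<omega>' * (Cr * (k \<omega>' + 1)) \<partial>S)"
    using integrable_mult_right[OF int, of Cr] Cr_nonneg nn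
    by (intro nn_integral_eq_integral) (auto simp: algebra_simps intro!: mult_nonneg_nonneg add_nonneg_nonneg)
  also have "(\<integral>\<omega>'. v \<omega>' * (Cr * (k \<omega>' + 1)) \<partial>S) = Cr * (\<integral>\<omega>. v \<omega> * (k \<omega> + 1) \<partial>S)"
    by (subst integral_mult_right_zero[symmetric]) (simp add: algebra_simps)
  finally have le: "(\<integral>\<^sup>+z. ennreal (b z) \<partial>UO) \<le> ennreal (Cr * (\<integral>\<omega>. v \<omega> * (k \<omega> + 1) \<partial>S))" .
  then show bi: "integrable UO b"
    using b0 by (intro integrableI_nonneg) (auto intro: le_less_trans)
  have "0 \<le> (\<integral>\<omega>. v \<omega> * (k \<omega> + 1) \<partial>S)"
    using nn by (intro integral_nonneg_AE) (auto intro!: mult_nonneg_nonneg add_nonneg_nonneg)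
  then show "(\<integral>z. b z \<partial>UO) \<le> Cr * (\<integral>\<omega>. v \<omega> * (k \<omega> + 1) \<partial>S)"
    using le b0 Cr_nonneg nn_integral_eq_integral[OF bi] by simp
qed

section \<open>Marginals of the noise and transition averages\<close>

lemma distr_nth: "distr S M (\<lambda>\<omega>. \<omega> i) = M"
  using seq.PiM_component[of i] by simp

lemma measurable_nth_S [measurable]: "(\<lambda>\<omega>. \<omega> i) \<in> measurable S M"
  by (rule measurable_component_singleton) simp

lemma integral_nth:
  fixes f :: "'w \<Rightarrow> 'b::{banach, second_countable_topology}"
  assumes [measurable]: "f \<in> borel_measurable M"
  shows "(\<integral>\<omega>. f (\<omega> i) \<partial>S) = (\<integral>b. f b \<partial>M)" "integrable S (\<lambda>\<omega>. f (\<omega> i)) \<longleftrightarrow> integrable M f"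
  using integral_distr[OF measurable_nth_S assms, of i] integrable_distr_eq[OF measurable_nth_S assms, of i]
  by (simp_all add: distr_nth)

lemma integrable_m: "integrable M m"
  by (rule square_integrable_imp_integrable[OF m_meas m_sq])

definition msum :: "nat \<Rightarrow> (nat \<Rightarrow> 'w) \<Rightarrow> real" where
  "msum j \<omega> = (\<Sum>i<j. m (\<omega> i))"

lemma measurable_msum [measurable]: "msum j \<in> borel_measurable S"
  unfolding msum_def by measurable

lemma msum_nonneg: "0 \<le> msum j \<omega>"
  by (simp add: msum_def m_nonneg sum_nonneg)

lemma integrable_msum: "integrable S (msum j)"
  unfolding msum_def using integrable_m by (intro Bochner_Integration.integrable_sum) (simp add: integral_nth)

text \<open>Short for bounded, measurable, invariant: a Borel function of the projective class
  together with an explicit bound.\<close>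

definition bmi :: "(real^'d \<Rightarrow> real) \<Rightarrow> real \<Rightarrow> bool" where
  "bmi q B \<longleftrightarrow> q \<in> borel_measurable borel \<and> proj_inv q \<and> (\<forall>x. \<bar>q x\<bar> \<le> B)"

lemma bmiD:
  assumes "bmi q B"
  shows "q \<in> borel_measurable borel" "proj_inv q" "\<bar>q x\<bar> \<le> B" "0 \<le> B"
  using assms order_trans[OF abs_ge_zero, of "q 0" B] by (auto simp: bmi_def)

definition mean :: "nat \<Rightarrow> (real^'d \<Rightarrow> real) \<Rightarrow> real^'d \<Rightarrow> real" where
  "mean j q y = (\<integral>\<omega>. q (X j \<omega> y) \<partial>S)"

lemma integrable_bmi_S:
  assumes "bmi q B" and [measurable]: "f \<in> borel_measurable S"
  shows "integrable S (\<lambda>\<omega>. q (f \<omega>))"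
proof (rule seq.P.integrable_const_bound[of _ B])
  note bmiD(1)[OF assms(1), measurable]
  show "(\<lambda>\<omega>. q (f \<omega>)) \<in> borel_measurable S" by measurable
qed (use bmiD(3)[OF assms(1)] in auto)

lemma bmi_mean:
  assumes q: "bmi q B" shows "bmi (mean j q) B"
  unfolding bmi_def
proof (intro conjI allI)
  note bmiD(1)[OF q, measurable]
  show "mean j q \<in> borel_measurable borel"
    unfolding mean_def by measurable
  show "proj_inv (mean j q)"
    unfolding proj_inv_def mean_def
    by (intro allI Bochner_Integration.integral_cong refl)
      (simp add: chain_add_ones proj_invD[OF bmiD(2)[OF q]])
  fix y
  have "\<bar>mean j q y\<bar> \<le> (\<integral>\<omega>. B \<partial>S)"
    unfolding mean_def
    by (rule order_trans[OF integral_abs_bound integral_mono])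
      (use integrable_bmi_S[OF q, of "\<lambda>\<omega>. X j \<omega> y"] bmiD(3)[OF q] in auto)
  then show "\<bar>mean j q y\<bar> \<le> B" by (simp add: seq.P.prob_space)
qed

definition step :: "(real^'d \<Rightarrow> real) \<Rightarrow> real^'d \<Rightarrow> real" where
  "step q y = (\<integral>b. q (T b y) \<partial>M)"

lemma mean_1: "bmi q B \<Longrightarrow> mean 1 q = step q"
proof
  fix y assume q: "bmi q B"
  note bmiD(1)[OF q, measurable]
  show "mean 1 q y = step q y"
    using integral_nth(1)[of "\<lambda>b. q (T b y)" 0] by (simp add: mean_def step_def)
qed

lemma mean_add: "bmi q B \<Longrightarrow> mean (n + j) q = mean n (mean j q)"
proof
  fix y assume q: "bmi q B"
  note bmiD(1)[OF q, measurable]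
  show "mean (n + j) q y = mean n (mean j q) y"
    unfolding mean_def
    by (subst integral_comb_seq(1)[of _ n]) (auto intro!: integrable_bmi_S[OF q])
qed

text \<open>A coupling: both starts are driven by the same noises, so the values of \<open>q\<close>
  can differ only on the event that the classes have not merged by time \<open>j\<close>.\<close>

lemma mean_close:
  assumes q: "bmi q B"
  shows "\<bar>mean j q y - mean j q y'\<bar> \<le> 2 * B * pfar j"
proof -
  note bmiD(1)[OF q, measurable]
  note i = integrable_bmi_S[OF q, of "\<lambda>\<omega>. X j \<omega> _"]
  have "mean j q y - mean j q y' = (\<integral>\<omega>. q (X j \<omega> y) - q (X j \<omega> y') \<partial>S)"
    unfolding mean_def by (rule Bochner_Integration.integral_diff[symmetric]) (auto intro!: i)
  also have "\<bar>\<dots>\<bar> \<le> (\<integral>\<omega>. 2 * B * indicator (space S - coal j) \<omega> \<partial>S)"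
  proof (rule order_trans[OF integral_abs_bound integral_mono])
    fix \<omega> assume w: "\<omega> \<in> space S"
    show "\<bar>q (X j \<omega> y) - q (X j \<omega> y')\<bar> \<le> 2 * B * indicator (space S - coal j) \<omega>"
    proof (cases "\<omega> \<in> coal j")
      case True
      then have "q (X j \<omega> y) = q (X j \<omega> y')"
        by (intro proj_inv_cong[OF bmiD(2)[OF q]] coalD)
      then show ?thesis using True by simp
    next
      case False
      then show ?thesis using w bmiD(3)[OF q, of "X j \<omega> y"] bmiD(3)[OF q, of "X j \<omega> y'"] by simp
    qed
  next
    show "integrable S (\<lambda>\<omega>. 2 * B * indicator (space S - coal j) \<omega>)"
      by (intro integrable_mult_right integrable_real_indicator) (auto simp: seq.P.emeasure_eq_measure)
  next
    show "integrable S (\<lambda>\<omega>. \<bar>q (X j \<omega> y) - q (X j \<omega> y')\<bar>)"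
      by (intro integrable_abs Bochner_Integration.integrable_diff i) measurable
  qed
  also have "\<dots> = 2 * B * pfar j" by (simp add: pfar_def)
  finally show ?thesis .
qed

end

lemma abs_le_bounded_integral:
  fixes f :: "'b \<Rightarrow> real"
  assumes "prob_space N" "integrable N f" "\<And>x. x \<in> space N \<Longrightarrow> \<bar>f x\<bar> \<le> B"
  shows "\<bar>\<integral>x. f x \<partial>N\<bar> \<le> B"
proof -
  interpret prob_space N by fact
  have "\<bar>\<integral>x. f x \<partial>N\<bar> \<le> (\<integral>x. B \<partial>N)"
    by (rule order_trans[OF integral_abs_bound integral_mono]) (use assms in auto)
  then show ?thesis by (simp add: prob_space)
qed

subsection \<open>The stationary law on classes\<close>

locale topical_stationary = topical_walk M T \<phi> m \<gamma>
  for M :: "'w measure" and T :: "'w \<Rightarrow> real^'d \<Rightarrow> real^'d" and \<phi> m \<gamma> +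
  fixes \<nu>0 :: "(real^'d) measure"
  assumes \<nu>0_prob: "prob_space \<nu>0" and \<nu>0_sets [measurable_cong]: "sets \<nu>0 = sets borel"
    and \<nu>0_inv: "\<And>B. B \<in> sets borel \<Longrightarrow>
       emeasure \<nu>0 B = (\<integral>\<^sup>+x. emeasure M {b \<in> space M. pnorm (T b x) \<in> B} \<partial>\<nu>0)"
begin

sublocale nu: prob_space \<nu>0 by (rule \<nu>0_prob)

lemma \<nu>0_eq_distr: "\<nu>0 = distr (\<nu>0 \<Otimes>\<^sub>M M) borel (\<lambda>z. pnorm (T (snd z) (fst z)))"
proof (rule measure_eqI)
  fix A assume "A \<in> sets \<nu>0"
  then have A [measurable]: "A \<in> sets borel" by (simp add: \<nu>0_sets)
  have "emeasure (distr (\<nu>0 \<Otimes>\<^sub>M M) borel (\<lambda>z. pnorm (T (snd z) (fst z)))) A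
     = emeasure (\<nu>0 \<Otimes>\<^sub>M M) ((\<lambda>z. pnorm (T (snd z) (fst z))) -` A \<inter> space (\<nu>0 \<Otimes>\<^sub>M M))"
    by (rule emeasure_distr) auto
  also have "\<dots> = (\<integral>\<^sup>+x. emeasure M (Pair x -` ((\<lambda>z. pnorm (T (snd z) (fst z))) -` A \<inter> space (\<nu>0 \<Otimes>\<^sub>M M))) \<partial>\<nu>0)"
    by (rule emeasure_pair_measure_alt) measurable
  also have "\<dots> = (\<integral>\<^sup>+x. emeasure M {b \<in> space M. pnorm (T b x) \<in> A} \<partial>\<nu>0)"
    by (intro nn_integral_cong arg_cong[where f="emeasure M"]) (auto simp: space_pair_measure)
  also have "\<dots> = emeasure \<nu>0 A" by (rule \<nu>0_inv[OF A, symmetric])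
  finally show "emeasure \<nu>0 A = emeasure (distr (\<nu>0 \<Otimes>\<^sub>M M) borel (\<lambda>z. pnorm (T (snd z) (fst z)))) A" ..
qed (simp add: \<nu>0_sets)

lemma integrable_bmi_\<nu>0: "bmi q B \<Longrightarrow> integrable \<nu>0 q"
  using bmiD[of q B] by (intro nu.integrable_const_bound[of _ B]) auto

lemma integral_\<nu>0_step:
  assumes q: "bmi q B"
  shows "(\<integral>x. step q x \<partial>\<nu>0) = (\<integral>x. q x \<partial>\<nu>0)"
proof -
  note bmiD(1)[OF q, measurable]
  interpret NM: pair_prob_space \<nu>0 M ..
  have i: "integrable (\<nu>0 \<Otimes>\<^sub>M M) (\<lambda>z. q (T (snd z) (fst z)))"
    by (rule NM.P.integrable_const_bound[of _ B]) (use bmiD(3)[OF q] in auto)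
  have "(\<integral>x. q x \<partial>\<nu>0) = (\<integral>z. q (pnorm (T (snd z) (fst z))) \<partial>(\<nu>0 \<Otimes>\<^sub>M M))"
    by (subst \<nu>0_eq_distr, subst integral_distr) auto
  also have "\<dots> = (\<integral>z. q (T (snd z) (fst z)) \<partial>(\<nu>0 \<Otimes>\<^sub>M M))"
    by (simp add: proj_inv_pnorm[OF bmiD(2)[OF q]])
  also have "\<dots> = (\<integral>x. step q x \<partial>\<nu>0)"
    using NM.integral_fst'[OF i] by (simp add: step_def)
  finally show ?thesis ..
qed

lemma integral_\<nu>0_mean:
  assumes "bmi q B"
  shows "(\<integral>x. mean j q x \<partial>\<nu>0) = (\<integral>x. q x \<partial>\<nu>0)"
  using assms
proof (induction j arbitrary: q)
  case 0
  then show ?case by (simp add: mean_def seq.P.prob_space)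
next
  case (Suc j)
  have "mean (Suc j) q = mean 1 (mean j q)" using mean_add[OF Suc.prems, of 1 j] by simp
  then show ?case
    using integral_\<nu>0_step[OF bmi_mean[OF Suc.prems, of j]] Suc mean_1[OF bmi_mean[OF Suc.prems, of j]]
    by simp
qed

text \<open>By stationarity the integral of \<open>q\<close> is also that of
  \<open>mean j q\<close>; it remains to average \<open>mean_close\<close> over a second start
  distributed according to \<open>\<nu>0\<close>.\<close>

lemma mean_\<nu>0:
  assumes q: "bmi q B"
  shows "\<bar>mean j q y - (\<integral>x. q x \<partial>\<nu>0)\<bar> \<le> 2 * B * pfar j"
proof -
  have i: "integrable \<nu>0 (mean j q)" by (rule integrable_bmi_\<nu>0[OF bmi_mean[OF q]])
  have "mean j q y - (\<integral>x. q x \<partial>\<nu>0) = (\<integral>x. mean j q y - mean j q x \<partial>\<nu>0)"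
    using i integral_\<nu>0_mean[OF q] by (simp add: nu.prob_space)
  also have "\<bar>\<dots>\<bar> \<le> 2 * B * pfar j"
    using i by (intro abs_le_bounded_integral \<nu>0_prob mean_close q) auto
  finally show ?thesis .
qed

lemma mean_tendsto_\<nu>0:
  assumes q: "bmi q B"
  shows "(\<lambda>j. mean j q y) \<longlonglongrightarrow> (\<integral>x. q x \<partial>\<nu>0)"
proof (rule LIM_zero_cancel, rule Lim_null_comparison)
  show "\<forall>\<^sub>F j in sequentially. norm (mean j q y - (\<integral>x. q x \<partial>\<nu>0)) \<le> 2 * B * pfar j"
    using mean_\<nu>0[OF q] by simp
  show "(\<lambda>j. 2 * B * pfar j) \<longlonglongrightarrow> 0"
    using tendsto_mult_right_zero[OF pfar_tendsto] by simp
qed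

end

subsection \<open>Renewal functional over long windows\<close>

definition window :: "real \<Rightarrow> real \<Rightarrow> real" where
  "window L s = indicator {0..L} s"

text \<open>Equal to 1 below level 0 and to 0 above level \<open>L\<close>. A path rising through
  the window loses 1 in total, and a step inside the window loses its increment divided by
  \<open>L\<close>.\<close>

definition ramp :: "real \<Rightarrow> real \<Rightarrow> real" where
  "ramp L s = max 0 (min 1 (1 - s / L))"

lemma measurable_window [measurable]: "window L \<in> borel_measurable borel"
  unfolding window_def by measurable

lemma measurable_ramp [measurable]: "ramp L \<in> borel_measurable borel"
  unfolding ramp_def by measurable

lemma window_cases: "window L s = 0 \<or> window L s = 1"
  by (auto simp: window_def indicator_def)

lemma window_diff_le:
  "\<bar>s' - s\<bar> \<le> d \<Longrightarrow> \<bar>window L s' - window L s\<bar>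
     \<le> (if \<bar>s - 0\<bar> \<le> d then 1 else 0) + (if \<bar>s - L\<bar> \<le> d then 1 else 0)"
  by (auto simp: window_def indicator_def abs_le_iff)

lemma ramp_diff_le: "L > 0 \<Longrightarrow> \<bar>ramp L s - ramp L s'\<bar> \<le> \<bar>s' - s\<bar> / L"
proof -
  assume "L > 0"
  then have "\<bar>s' - s\<bar> / L = \<bar>(1 - s / L) - (1 - s' / L)\<bar>"
    by (simp add: diff_divide_distrib[symmetric])
  then show ?thesis unfolding ramp_def by (simp add: max_def min_def abs_if)
qed

text \<open>The ramp is affine on each of the three intervals cut out by 0 and \<open>L\<close>, so
  a step that stays away from these two points produces no error. Otherwise both compared terms are
  at most \<open>d / L\<close>.\<close>

lemma ramp_window_err:
  assumes "L > 0" and d: "\<bar>s' - s\<bar> \<le> d"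
  shows "\<bar>ramp L s - ramp L s' - (s' - s) / L * window L s\<bar>
     \<le> 2 / L * ((if \<bar>s - 0\<bar> \<le> d then d else 0) + (if \<bar>s - L\<bar> \<le> d then d else 0))"
proof (cases "\<bar>s - 0\<bar> \<le> d \<or> \<bar>s - L\<bar> \<le> d")
  case True
  have "0 \<le> d" using d by linarith
  have dL: "\<bar>s' - s\<bar> / L \<le> d / L" using d assms(1) by (intro divide_right_mono) auto
  have "\<bar>(s' - s) / L * window L s\<bar> \<le> \<bar>s' - s\<bar> / L"
    using window_cases[of L s] assms(1) by auto
  then have "\<bar>ramp L s - ramp L s' - (s' - s) / L * window L s\<bar> \<le> d / L + d / L"
    by (intro order_trans[OF abs_triangle_ineq4 add_mono] order_trans[OF _ dL] ramp_diff_le assms(1))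
  also have "\<dots> = 2 / L * d" by simp
  also have "\<dots> \<le> 2 / L * ((if \<bar>s - 0\<bar> \<le> d then d else 0) + (if \<bar>s - L\<bar> \<le> d then d else 0))"
    using True \<open>0 \<le> d\<close> assms(1) by (intro mult_left_mono) auto
  finally show ?thesis .
next
  case False
  then consider "s < -d" | "s > L + d" | "d < s" "s < L - d" by linarith
  then have "ramp L s - ramp L s' - (s' - s) / L * window L s = 0"
  proof cases
    case 1
    then have "s \<le> 0" "s' \<le> 0" "s < 0" using d by linarith+
    then show ?thesis using assms(1)
      by (simp add: ramp_def window_def min_def max_def field_simps)
  next
    case 2
    then have "L \<le> s" "L \<le> s'" "L < s" using d by linarith+
    then show ?thesis using assms(1)
      by (simp add: ramp_def window_def min_def max_def field_simps)
  next
    case 3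
    then have "0 \<le> s" "0 \<le> s'" "s \<le> L" "s' \<le> L" using d by linarith+
    then have "ramp L s = 1 - s / L" "ramp L s' = 1 - s' / L" "window L s = 1"
      using assms(1) by (simp_all add: ramp_def window_def min_def max_def field_simps)
    then show ?thesis by (simp add: diff_divide_distrib)
  qed
  then show ?thesis using False by auto
qed

text \<open>A bounded second moment gives uniform integrability: \<open>\<bar>y\<bar>\<close> is at
  most its truncation at \<open>K\<close> plus \<open>y\<^sup>2 / K\<close>, and the truncated part
  is covered by dominated convergence.\<close>

lemma tendsto_integral_L2_bounded:
  fixes Y :: "nat \<Rightarrow> 'b \<Rightarrow> real"
  assumes "prob_space N" and [measurable]: "\<And>n. Y n \<in> borel_measurable N"
    and int: "\<And>n. integrable N (\<lambda>x. (Y n x)\<^sup>2)" and C: "\<And>n. (\<integral>x. (Y n x)\<^sup>2 \<partial>N) \<le> C"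
    and lim: "AE x in N. (\<lambda>n. Y n x) \<longlonglongrightarrow> 0"
  shows "(\<lambda>n. \<integral>x. Y n x \<partial>N) \<longlonglongrightarrow> 0"
proof (rule LIMSEQ_I)
  interpret prob_space N by fact
  fix e :: real assume e: "e > 0"
  have C0: "0 \<le> C" using C[of 0] by (rule order_trans[rotated]) simp
  \<comment> \<open>Large enough that the excess over the truncation, at most \<open>C / K\<close>
    in the mean, stays below \<open>e / 2\<close>.\<close>
  define K where "K = 2 * C / e + 1"
  have K: "K > 0" using C0 e by (simp add: K_def add_nonneg_pos)
  have CK: "C / K < e / 2"
  proof -
    have "C < e / 2 * K" using e C0 by (simp add: K_def field_simps)
    then show ?thesis using K by (simp add: divide_less_eq)
  qed
  have i: "integrable N (Y n)" for n by (rule square_integrable_imp_integrable[OF _ int]) simp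
  have mi: "integrable N (\<lambda>x. min \<bar>Y n x\<bar> K)" for n
    using K by (intro integrable_const_bound[of _ K]) auto
  have "(\<lambda>n. \<integral>x. min \<bar>Y n x\<bar> K \<partial>N) \<longlonglongrightarrow> (\<integral>x. 0 \<partial>N)"
  proof (rule integral_dominated_convergence[where w="\<lambda>x. K"])
    show "AE x in N. (\<lambda>n. min \<bar>Y n x\<bar> K) \<longlonglongrightarrow> 0"
      using lim
    proof eventually_elim
      case (elim x)
      then have "(\<lambda>n. min \<bar>Y n x\<bar> K) \<longlonglongrightarrow> min \<bar>0\<bar> K" by (intro tendsto_intros)
      then show ?case using K by simp
    qed
  qed (use K in auto)
  then have min0: "(\<lambda>n. \<integral>x. min \<bar>Y n x\<bar> K \<partial>N) \<longlonglongrightarrow> 0" by simp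
  obtain n0 where n0: "\<And>n. n \<ge> n0 \<Longrightarrow> \<bar>\<integral>x. min \<bar>Y n x\<bar> K \<partial>N\<bar> < e / 2"
    using LIMSEQ_D[OF min0, of "e / 2"] e by auto
  have "\<bar>\<integral>x. Y n x \<partial>N\<bar> < e" if "n \<ge> n0" for n
  proof -
    have "\<bar>\<integral>x. Y n x \<partial>N\<bar> \<le> (\<integral>x. min \<bar>Y n x\<bar> K + (Y n x)\<^sup>2 / K \<partial>N)"
    proof (rule order_trans[OF integral_abs_bound integral_mono])
      fix x
      show "\<bar>Y n x\<bar> \<le> min \<bar>Y n x\<bar> K + (Y n x)\<^sup>2 / K"
      proof (cases "\<bar>Y n x\<bar> \<le> K")
        case True then show ?thesis using K by simp
      next
        case False
        then have "K * \<bar>Y n x\<bar> \<le> \<bar>Y n x\<bar> * \<bar>Y n x\<bar>" by (intro mult_right_mono) auto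
        then have "\<bar>Y n x\<bar> \<le> (Y n x)\<^sup>2 / K"
          using K by (simp add: power2_eq_square field_simps)
        then show ?thesis using K by linarith
      qed
    qed (use i mi int in auto)
    also have "\<dots> = (\<integral>x. min \<bar>Y n x\<bar> K \<partial>N) + (\<integral>x. (Y n x)\<^sup>2 \<partial>N) / K"
      using mi int by simp
    also have "(\<integral>x. (Y n x)\<^sup>2 \<partial>N) / K \<le> C / K" using C[of n] K by (intro divide_right_mono) auto
    finally show ?thesis using n0[OF that] CK by linarith
  qed
  then show "\<exists>no. \<forall>n\<ge>no. norm ((\<integral>x. Y n x \<partial>N) - 0) < e" by auto
qed

context topical_stationary
begin

lemma window_eq_slab:
  "z \<in> space UO \<Longrightarrow> window L (\<phi> (visit z x)) = indicator (slab x (L / 2) (L / 2)) z"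
  by (auto simp: window_def slab_def indicator_def abs_le_iff field_simps)

lemma bmi_window:
  fixes q :: "real^'d \<Rightarrow> real"
  assumes q: "bmi q B" and "0 \<le> L"
  shows "integrable UO (\<lambda>z. q (X (fst z + j) (snd z) x) * window L (\<phi> (visit z x)))"
    and "\<bar>\<integral>z. q (X (fst z + j) (snd z) x) * window L (\<phi> (visit z x)) \<partial>UO\<bar> \<le> B * (Cr * (L + 1))"
proof -
  note bmiD(1)[OF q, measurable]
  have *: "\<bar>q (X (fst z + j) (snd z) x) * window L (\<phi> (visit z x))\<bar>
      \<le> B * indicator (slab x (L / 2) (L / 2)) z" if "z \<in> space UO" for z
    using bmiD(3)[OF q, of "X (fst z + j) (snd z) x"] window_eq_slab[OF that, of L x]
    by (auto simp: abs_mult indicator_def)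
  show "integrable UO (\<lambda>z. q (X (fst z + j) (snd z) x) * window L (\<phi> (visit z x)))"
    by (rule slab_dominated(1)[OF _ _ bmiD(4)[OF q] *]) (use \<open>0 \<le> L\<close> in auto)
  have "\<bar>\<integral>z. q (X (fst z + j) (snd z) x) * window L (\<phi> (visit z x)) \<partial>UO\<bar> \<le> B * (Cr * (L / 2 + 1))"
    by (rule slab_dominated(2)[OF _ _ bmiD(4)[OF q] *]) (use \<open>0 \<le> L\<close> in auto)
  also have "\<dots> \<le> B * (Cr * (L + 1))"
    using \<open>0 \<le> L\<close> Cr_nonneg bmiD(4)[OF q] by (intro mult_left_mono) auto
  finally show "\<bar>\<integral>z. q (X (fst z + j) (snd z) x) * window L (\<phi> (visit z x)) \<partial>UO\<bar> \<le> B * (Cr * (L + 1))" .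
qed

lemma \<phi>_increment: "\<omega> \<in> space S \<Longrightarrow> \<bar>\<phi> (X (n + j) \<omega> x) - \<phi> (X n \<omega> x)\<bar> \<le> msum j (shift n \<omega>)"
  using \<phi>_chain_bound[OF space_S_shift[of \<omega> n], where n=j and x="X n \<omega> x"] by (simp add: chain_add msum_def)

lemma space_UO: "z \<in> space UO \<Longrightarrow> snd z \<in> space S"
  by (auto simp: space_pair_measure)

text \<open>Shifting the time of \<open>q\<close> by \<open>j\<close> only matters when the walk crosses the boundary of the window.\<close>

lemma avg_shift:
  assumes q: "bmi q B"
  shows "\<exists>K. \<forall>L\<ge>0. \<forall>x. \<bar>(\<integral>z. q (visit z x) * window L (\<phi> (visit z x)) \<partial>UO)
     - (\<integral>z. mean j q (visit z x) * window L (\<phi> (visit z x)) \<partial>UO)\<bar> \<le> K"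
proof -
  note bmiD(1)[OF q, measurable]
  note bmiD(1)[OF bmi_mean[OF q], measurable]
  have B0: "0 \<le> B" by (rule bmiD(4)[OF q])
  have int1: "integrable S (\<lambda>\<omega>. 1 * (msum j \<omega> + 1))"
    using integrable_msum[of j] by simp
  define Q where "Q = Cr * (\<integral>\<omega>. 1 * (msum j \<omega> + 1) \<partial>S)"
  have "\<bar>(\<integral>z. q (visit z x) * window L (\<phi> (visit z x)) \<partial>UO)
     - (\<integral>z. mean j q (visit z x) * window L (\<phi> (visit z x)) \<partial>UO)\<bar> \<le> real j * B + B * (2 * Q)"
    if L: "L \<ge> 0" for L x
  proof -
    define th where "th = (\<lambda>n \<omega>. window L (\<phi> (X n \<omega> x)))"
    \<comment> \<open>The comparison has three stages. From \<open>f1\<close> to \<open>f2\<close>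
      the first \<open>j\<close> terms of the time sum are dropped; from \<open>f2\<close> to
      \<open>f3\<close> the window is tested \<open>j\<close> steps earlier, which matters only near
      its two ends; from \<open>f3\<close> to \<open>f4\<close> the noises of these \<open>j\<close>
      steps are integrated out.\<close>
    define f1 where "f1 = (\<lambda>z. q (visit z x) * th (fst z) (snd z))"
    define f2 where "f2 = (\<lambda>z. q (X (fst z + j) (snd z) x) * th (fst z + j) (snd z))"
    define f3 where "f3 = (\<lambda>z. q (X (fst z + j) (snd z) x) * th (fst z) (snd z))"
    define f4 where "f4 = (\<lambda>z. mean j q (visit z x) * th (fst z) (snd z))"
    define bd where "bd = (\<lambda>c z. if \<bar>\<phi> (visit z x) - c\<bar> \<le> msum j (shift (fst z) (snd z))
        then 1 else 0 :: real)"
    have bd: "integrable UO (bd c)" "(\<integral>z. bd c z \<partial>UO) \<le> Q" for c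
      using boundary[OF _ measurable_msum _ msum_nonneg int1, where x=x and c=c] by (auto simp: bd_def Q_def)
    have f1: "integrable UO f1" and f3: "integrable UO f3" and f4: "integrable UO f4"
      unfolding f1_def f3_def f4_def th_def
      using bmi_window(1)[OF q L, of 0 x] bmi_window(1)[OF q L, of j x]
        bmi_window(1)[OF bmi_mean[OF q, of j] L, of 0 x] by simp_all
    have diff: "\<bar>f2 z - f3 z\<bar> \<le> B * (bd 0 z + bd L z)" if "z \<in> space UO" for z
    proof -
      have "\<bar>f2 z - f3 z\<bar> = \<bar>q (X (fst z + j) (snd z) x)\<bar> * \<bar>th (fst z + j) (snd z) - th (fst z) (snd z)\<bar>"
        unfolding f2_def f3_def by (simp add: abs_mult[symmetric] right_diff_distrib)
      also have "\<dots> \<le> B * (bd 0 z + bd L z)"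
        unfolding th_def bd_def
        by (intro mult_mono window_diff_le \<phi>_increment space_UO that bmiD(3)[OF q]) (use B0 in auto)
      finally show ?thesis .
    qed
    have bdi: "integrable UO (\<lambda>z. B * (bd 0 z + bd L z))" using bd(1) by simp
    have [measurable]: "f2 \<in> borel_measurable UO" "f3 \<in> borel_measurable UO"
      unfolding f2_def f3_def th_def by measurable
    have f23: "integrable UO (\<lambda>z. f2 z - f3 z)"
    proof (rule Bochner_Integration.integrable_bound[OF bdi])
      show "AE z in UO. norm (f2 z - f3 z) \<le> norm (B * (bd 0 z + bd L z))"
      proof (rule AE_I2)
        fix z assume "z \<in> space UO"
        then show "norm (f2 z - f3 z) \<le> norm (B * (bd 0 z + bd L z))"
          using diff[of z] by (simp add: le_trans order_trans[OF _ abs_ge_self])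
      qed
    qed simp
    have f2: "integrable UO f2"
      using Bochner_Integration.integrable_add[OF f23 f3] by simp
    have "\<bar>(\<integral>z. f2 z \<partial>UO) - (\<integral>z. f3 z \<partial>UO)\<bar> = \<bar>\<integral>z. f2 z - f3 z \<partial>UO\<bar>" using f2 f3 by simp
    also have "\<dots> \<le> (\<integral>z. B * (bd 0 z + bd L z) \<partial>UO)"
      by (rule order_trans[OF integral_abs_bound integral_mono[OF integrable_abs[OF f23] bdi diff]])
    also have "\<dots> = B * ((\<integral>z. bd 0 z \<partial>UO) + (\<integral>z. bd L z \<partial>UO))" using bd(1) by simp
    also have "\<dots> \<le> B * (2 * Q)"
      using add_mono[OF bd(2)[of 0] bd(2)[of L]] B0 by (intro mult_left_mono) auto
    finally have d23: "\<bar>(\<integral>z. f2 z \<partial>UO) - (\<integral>z. f3 z \<partial>UO)\<bar> \<le> B * (2 * Q)" .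
    have d34: "(\<integral>z. f3 z \<partial>UO) = (\<integral>z. f4 z \<partial>UO)"
    proof (rule UO_eqI[OF f3 f4])
      fix n
      show "(\<integral>\<omega>. f3 (n, \<omega>) \<partial>S) = (\<integral>\<omega>. f4 (n, \<omega>) \<partial>S)"
        by (subst integral_comb_seq(1)[OF UO_sums(2)[OF f3], where n=n])
          (simp add: f3_def f4_def th_def mean_def)
    qed
    define a where "a = (\<lambda>n. \<integral>\<omega>. f1 (n, \<omega>) \<partial>S)"
    have a1: "a sums (\<integral>z. f1 z \<partial>UO)" unfolding a_def by (rule UO_sums(1)[OF f1])
    have "(\<lambda>n. \<integral>\<omega>. f2 (n, \<omega>) \<partial>S) = (\<lambda>n. a (n + j))" by (simp add: a_def f1_def f2_def)
    then have a2: "(\<lambda>n. a (n + j)) sums (\<integral>z. f2 z \<partial>UO)" using UO_sums(1)[OF f2] by simp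
    have d12: "(\<integral>z. f1 z \<partial>UO) - (\<integral>z. f2 z \<partial>UO) = (\<Sum>n<j. a n)"
      using sums_unique2[OF a1 sums_iff_shift[THEN iffD1, OF a2]] by simp
    have "\<bar>a n\<bar> \<le> B" for n
      unfolding a_def
    proof (rule abs_le_bounded_integral[OF seq.P.prob_space_axioms UO_sums(2)[OF f1]])
      fix \<omega> show "\<bar>f1 (n, \<omega>)\<bar> \<le> B"
        using bmiD(3)[OF q, of "X n \<omega> x"] B0 window_cases[of L "\<phi> (X n \<omega> x)"]
        by (auto simp: f1_def th_def)
    qed
    then have "\<bar>\<Sum>n<j. a n\<bar> \<le> real j * B"
      using order_trans[OF sum_abs sum_mono[of "{..<j}" "\<lambda>n. \<bar>a n\<bar>" "\<lambda>n. B"]] by simp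
    then have "\<bar>(\<integral>z. f1 z \<partial>UO) - (\<integral>z. f4 z \<partial>UO)\<bar> \<le> real j * B + B * (2 * Q)"
      using d12 d23 d34 by linarith
    then show ?thesis by (simp add: f1_def f4_def th_def)
  qed
  then show ?thesis by blast
qed

text \<open>For \<open>j\<close> large, \<open>mean j q\<close> is uniformly close to the constant
  given by \<open>\<nu>0\<close>, and the window receives at most \<open>Cr * (L + 1)\<close> visits
  on average. Replacing \<open>q\<close> by \<open>mean j q\<close> costs a constant
  \<open>K\<close> that depends on \<open>e\<close> through \<open>j\<close> but not on
  \<open>L\<close> or the start, hence is negligible for long windows.\<close>

lemma avg_window:
  assumes q: "bmi q B" and "e > 0"
  shows "\<exists>K. \<forall>L\<ge>0. \<forall>x. \<bar>(\<integral>z. q (visit z x) * window L (\<phi> (visit z x)) \<partial>UO)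
     - (\<integral>y. q y \<partial>\<nu>0) * (\<integral>z. window L (\<phi> (visit z x)) \<partial>UO)\<bar> \<le> e * (L + 1) + K"
proof -
  let ?D = "\<integral>y. q y \<partial>\<nu>0"
  have "(\<lambda>j. 2 * B * Cr * pfar j) \<longlonglongrightarrow> 0"
    using tendsto_mult_right_zero[OF pfar_tendsto] by simp
  then have "\<forall>\<^sub>F j in sequentially. 2 * B * Cr * pfar j < e"
    using \<open>e > 0\<close> by (rule order_tendstoD)
  then obtain j where j: "2 * B * Cr * pfar j < e" by (auto simp: eventually_sequentially)
  obtain K where K: "\<And>L x. L \<ge> 0 \<Longrightarrow> \<bar>(\<integral>z. q (visit z x) * window L (\<phi> (visit z x)) \<partial>UO)
     - (\<integral>z. mean j q (visit z x) * window L (\<phi> (visit z x)) \<partial>UO)\<bar> \<le> K"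
    using avg_shift[OF q, of j] by blast
  have H: "\<bar>(\<integral>z. mean j q (visit z x) * window L (\<phi> (visit z x)) \<partial>UO)
      - ?D * (\<integral>z. window L (\<phi> (visit z x)) \<partial>UO)\<bar> \<le> e * (L + 1)" if L: "L \<ge> 0" for L x
  proof -
    have d: "bmi (\<lambda>y. mean j q y - ?D) (2 * B * pfar j)"
      using bmi_mean[OF q, of j] mean_\<nu>0[OF q, of j] by (auto simp: bmi_def proj_inv_def)
    have one: "bmi (\<lambda>_. 1) 1" by (auto simp: bmi_def proj_inv_def)
    have i1: "integrable UO (\<lambda>z. mean j q (visit z x) * window L (\<phi> (visit z x)))"
      using bmi_window(1)[OF bmi_mean[OF q, of j] L, of 0 x] by simp
    have i2: "integrable UO (\<lambda>z. window L (\<phi> (visit z x)))"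
      using bmi_window(1)[OF one L, where x=x] by simp
    have "(\<integral>z. mean j q (visit z x) * window L (\<phi> (visit z x)) \<partial>UO)
        - ?D * (\<integral>z. window L (\<phi> (visit z x)) \<partial>UO)
      = (\<integral>z. (mean j q (X (fst z + 0) (snd z) x) - ?D) * window L (\<phi> (visit z x)) \<partial>UO)"
      using i1 i2 by (simp add: left_diff_distrib)
    also have "\<bar>\<dots>\<bar> \<le> 2 * B * pfar j * (Cr * (L + 1))"
      by (rule bmi_window(2)[OF d L])
    also have "\<dots> = 2 * B * Cr * pfar j * (L + 1)" by simp
    also have "\<dots> \<le> e * (L + 1)" using j L by (intro mult_right_mono) auto
    finally show ?thesis .
  qed
  have tri: "\<bar>a - c\<bar> \<le> s + t" if "\<bar>b - c\<bar> \<le> s" "\<bar>a - b\<bar> \<le> t" for a b c s t :: real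
    using that by linarith
  show ?thesis by (intro exI[of _ K] allI impI tri[OF H K])
qed

text \<open>The mean increment of \<open>\<phi>\<close> in one step from \<open>y\<close>. By
  homogeneity it depends on the class alone, so the equidistribution results apply to it.\<close>

definition drift_fun :: "real^'d \<Rightarrow> real" where
  "drift_fun y = (\<integral>b. \<phi> (T b y) - \<phi> y \<partial>M)"

lemma integrable_increment_M: "integrable M (\<lambda>b. \<phi> (T b y) - \<phi> y)"
proof (rule Bochner_Integration.integrable_bound[OF integrable_m])
  show "AE b in M. norm (\<phi> (T b y) - \<phi> y) \<le> norm (m b)"
    using m_bound m_nonneg by (intro AE_I2) simp
qed measurable

lemma bmi_drift_fun: "bmi drift_fun (\<integral>b. m b \<partial>M)"
  unfolding bmi_def
proof (intro conjI allI)
  show "drift_fun \<in> borel_measurable borel" unfolding drift_fun_def by measurable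
  show "proj_inv drift_fun" unfolding proj_inv_def drift_fun_def
    by (intro allI Bochner_Integration.integral_cong refl)
      (simp add: topical_opD_add[OF T_top] topical_funD_add[OF \<phi>_top])
  show "\<bar>drift_fun x\<bar> \<le> (\<integral>b. m b \<partial>M)" for x
    unfolding drift_fun_def
    by (rule order_trans[OF integral_abs_bound integral_mono])
      (use integrable_increment_M integrable_m m_bound in auto)
qed

lemma increment_integral:
  assumes [measurable]: "g \<in> borel_measurable borel" and g: "\<And>y. \<bar>g y\<bar> \<le> 1"
  shows "integrable S (\<lambda>\<omega>. (\<phi> (X (Suc n) \<omega> x) - \<phi> (X n \<omega> x)) * g (X n \<omega> x))"
    and "(\<integral>\<omega>. (\<phi> (X (Suc n) \<omega> x) - \<phi> (X n \<omega> x)) * g (X n \<omega> x) \<partial>S)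
       = (\<integral>\<omega>. drift_fun (X n \<omega> x) * g (X n \<omega> x) \<partial>S)"
proof -
  have im: "integrable S (\<lambda>\<omega>. m (\<omega> n))" using integrable_m by (simp add: integral_nth)
  show i: "integrable S (\<lambda>\<omega>. (\<phi> (X (Suc n) \<omega> x) - \<phi> (X n \<omega> x)) * g (X n \<omega> x))"
  proof (rule Bochner_Integration.integrable_bound[OF im])
    show "AE \<omega> in S. norm ((\<phi> (X (Suc n) \<omega> x) - \<phi> (X n \<omega> x)) * g (X n \<omega> x)) \<le> norm (m (\<omega> n))"
    proof (rule AE_I2)
      fix \<omega> assume w: "\<omega> \<in> space S"
      have "\<bar>\<phi> (X (Suc n) \<omega> x) - \<phi> (X n \<omega> x)\<bar> * \<bar>g (X n \<omega> x)\<bar> \<le> m (\<omega> n) * 1"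
        using m_bound[OF space_S_nth[OF w]] by (intro mult_mono g m_nonneg) auto
      then show "norm ((\<phi> (X (Suc n) \<omega> x) - \<phi> (X n \<omega> x)) * g (X n \<omega> x)) \<le> norm (m (\<omega> n))"
        using m_nonneg[of "\<omega> n"] by (simp add: abs_mult)
    qed
  qed measurable
  have inner: "(\<integral>\<omega>'. \<phi> (T (\<omega>' 0) y) - \<phi> y \<partial>S) = drift_fun y" for y
    unfolding drift_fun_def by (rule integral_nth(1)) measurable
  have "(\<integral>\<omega>. (\<phi> (X (Suc n) \<omega> x) - \<phi> (X n \<omega> x)) * g (X n \<omega> x) \<partial>S)
     = (\<integral>\<omega>. \<integral>\<omega>'. (\<phi> (T (\<omega>' 0) (X n \<omega> x)) - \<phi> (X n \<omega> x)) * g (X n \<omega> x) \<partial>S \<partial>S)"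
    by (subst integral_comb_seq(1)[OF i, where n=n]) simp
  also have "\<dots> = (\<integral>\<omega>. drift_fun (X n \<omega> x) * g (X n \<omega> x) \<partial>S)"
    by (simp add: inner)
  finally show "(\<integral>\<omega>. (\<phi> (X (Suc n) \<omega> x) - \<phi> (X n \<omega> x)) * g (X n \<omega> x) \<partial>S)
       = (\<integral>\<omega>. drift_fun (X n \<omega> x) * g (X n \<omega> x) \<partial>S)" .
qed

text \<open>Telescoping the ramp expresses it through the renewal functional of the drift.\<close>

lemma ramp_sum:
  "\<exists>K. \<forall>L>0. \<forall>x. \<bar>ramp L (\<phi> x)
     - (\<integral>z. drift_fun (visit z x) * window L (\<phi> (visit z x)) \<partial>UO) / L\<bar> \<le> K / L"
proof -
  define m0 where "m0 = (\<lambda>\<omega>::nat \<Rightarrow> 'w. m (\<omega> 0))"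
  have [measurable]: "m0 \<in> borel_measurable S" unfolding m0_def by measurable
  have m0: "0 \<le> m0 \<omega>" for \<omega> by (simp add: m0_def m_nonneg)
  have "integrable M (\<lambda>b. m b * (m b + 1))"
    using Bochner_Integration.integrable_add[OF m_sq integrable_m]
    by (simp add: power2_eq_square algebra_simps)
  then have int1: "integrable S (\<lambda>\<omega>. m0 \<omega> * (m0 \<omega> + 1))"
    unfolding m0_def by (subst integral_nth(2)) auto
  have int2: "integrable S (\<lambda>\<omega>. m0 \<omega> * (l + 1))" for l :: real
    unfolding m0_def using integrable_m by (intro integrable_mult_left) (simp add: integral_nth)
  define Q where "Q = Cr * (\<integral>\<omega>. m0 \<omega> * (m0 \<omega> + 1) \<partial>S)"
  have "\<bar>ramp L (\<phi> x)
     - (\<integral>z. drift_fun (visit z x) * window L (\<phi> (visit z x)) \<partial>UO) / L\<bar> \<le> 4 * Q / L"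
    if L: "L > 0" for L x
  proof -
    define f1 where "f1 = (\<lambda>z. ramp L (\<phi> (visit z x)) - ramp L (\<phi> (X (Suc (fst z)) (snd z) x)))"
    define f2 where "f2 = (\<lambda>z. (\<phi> (X (Suc (fst z)) (snd z) x) - \<phi> (visit z x))
        * window L (\<phi> (visit z x)))"
    define f3 where "f3 = (\<lambda>z. drift_fun (visit z x) * window L (\<phi> (visit z x)))"
    define bd where "bd = (\<lambda>c z. if \<bar>\<phi> (visit z x) - c\<bar> \<le> m0 (shift (fst z) (snd z))
        then m0 (shift (fst z) (snd z)) else 0)"
    define bw where "bw = (\<lambda>z. if \<bar>\<phi> (visit z x) - L / 2\<bar> \<le> L / 2
        then m0 (shift (fst z) (snd z)) else 0)"
    have [measurable]: "f1 \<in> borel_measurable UO" "f2 \<in> borel_measurable UO"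
      unfolding f1_def f2_def by measurable
    have bd: "integrable UO (bd c)" "(\<integral>z. bd c z \<partial>UO) \<le> Q" for c
      using boundary[OF _ _ m0 m0 int1, where x=x and c=c] by (auto simp: bd_def Q_def)
    have bw: "integrable UO bw"
      unfolding bw_def using L by (intro boundary(1)[OF _ _ m0 _ int2]) auto
    have inc: "\<bar>\<phi> (X (Suc (fst z)) (snd z) x) - \<phi> (visit z x)\<bar> \<le> m0 (shift (fst z) (snd z))"
      if "z \<in> space UO" for z
      using \<phi>_increment[OF space_UO[OF that], of "fst z" 1 x] by (simp add: msum_def m0_def)
    have f2: "integrable UO f2"
    proof (rule Bochner_Integration.integrable_bound[OF bw])
      show "AE z in UO. norm (f2 z) \<le> norm (bw z)"
      proof (rule AE_I2)
        fix z assume z: "z \<in> space UO"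
        show "norm (f2 z) \<le> norm (bw z)"
          using inc[OF z] m0[of "shift (fst z) (snd z)"] window_eq_slab[OF z, of L x] z
          by (auto simp: f2_def bw_def slab_def indicator_def)
      qed
    qed measurable
    have err: "\<bar>f1 z - f2 z / L\<bar> \<le> 2 / L * (bd 0 z + bd L z)" if "z \<in> space UO" for z
      using ramp_window_err[OF L inc[OF that]] unfolding f1_def f2_def bd_def by simp
    have bdi: "integrable UO (\<lambda>z. 2 / L * (bd 0 z + bd L z))"
      by (intro integrable_mult_right Bochner_Integration.integrable_add bd)
    have f12: "integrable UO (\<lambda>z. f1 z - f2 z / L)"
    proof (rule Bochner_Integration.integrable_bound[OF bdi])
      show "AE z in UO. norm (f1 z - f2 z / L) \<le> norm (2 / L * (bd 0 z + bd L z))"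
        using err by (intro AE_I2) (metis abs_ge_self order_trans real_norm_def)
    qed measurable
    have f2L: "integrable UO (\<lambda>z. f2 z / L)" using f2 by simp
    have f1: "integrable UO f1" using Bochner_Integration.integrable_add[OF f12 f2L] by simp
    have f3: "integrable UO f3"
      unfolding f3_def using bmi_window(1)[OF bmi_drift_fun, of L 0 x] L by simp
    have "(\<integral>z. f2 z \<partial>UO) = (\<integral>z. f3 z \<partial>UO)"
    proof (rule UO_eqI[OF f2 f3])
      fix n
      show "(\<integral>\<omega>. f2 (n, \<omega>) \<partial>S) = (\<integral>\<omega>. f3 (n, \<omega>) \<partial>S)"
        unfolding f2_def f3_def fst_conv snd_conv
        by (rule increment_integral(2)[of "\<lambda>y. window L (\<phi> y)"]) (auto simp: window_def indicator_def)
    qed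
    \<comment> \<open>The time sum telescopes. Its far end vanishes because \<open>\<phi>\<close>
      tends to infinity along the walk, which eventually puts the ramp at 0.\<close>
    moreover have "(\<integral>z. f1 z \<partial>UO) = ramp L (\<phi> x)"
    proof -
      define a where "a = (\<lambda>n. \<integral>\<omega>. ramp L (\<phi> (X n \<omega> x)) \<partial>S)"
      have ri: "integrable S (\<lambda>\<omega>. ramp L (\<phi> (X n \<omega> x)))" for n
        by (rule seq.P.integrable_const_bound[of _ 1]) (auto simp: ramp_def)
      have "(\<Sum>n<N. \<integral>\<omega>. f1 (n, \<omega>) \<partial>S) = a 0 - a N" for N
        using ri by (induction N) (simp_all add: a_def f1_def del: chain.simps(2))
      then have "(\<lambda>N. a 0 - a N) \<longlonglongrightarrow> (\<integral>z. f1 z \<partial>UO)"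
        using UO_sums(1)[OF f1] by (simp add: sums_def)
      moreover have "a \<longlonglongrightarrow> (\<integral>\<omega>. 0 \<partial>S)"
        unfolding a_def
      proof (rule integral_dominated_convergence[where w="\<lambda>_. 1"])
        show "AE \<omega> in S. (\<lambda>n. ramp L (\<phi> (X n \<omega> x))) \<longlonglongrightarrow> 0"
          using drift_at_top
        proof eventually_elim
          case (elim \<omega>)
          then have "\<forall>\<^sub>F n in sequentially. L \<le> \<phi> (X n \<omega> x)" by (auto simp: filterlim_at_top)
          then have "\<forall>\<^sub>F n in sequentially. ramp L (\<phi> (X n \<omega> x)) = 0"
            by eventually_elim (use L in \<open>simp add: ramp_def min_def max_def field_simps\<close>)
          then show ?case by (rule tendsto_eventually)
        qed
      qed (auto simp: ramp_def)
      then have "(\<lambda>N. a 0 - a N) \<longlonglongrightarrow> a 0 - 0" by (intro tendsto_intros) simp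
      ultimately have "(\<integral>z. f1 z \<partial>UO) = a 0 - 0" by (rule LIMSEQ_unique)
      then show ?thesis by (simp add: a_def seq.P.prob_space)
    qed
    moreover have "\<bar>(\<integral>z. f1 z \<partial>UO) - (\<integral>z. f2 z \<partial>UO) / L\<bar> \<le> 4 * Q / L"
    proof -
      have "\<bar>(\<integral>z. f1 z \<partial>UO) - (\<integral>z. f2 z \<partial>UO) / L\<bar> = \<bar>\<integral>z. f1 z - f2 z / L \<partial>UO\<bar>"
        using f1 f2L by simp
      also have "\<dots> \<le> (\<integral>z. 2 / L * (bd 0 z + bd L z) \<partial>UO)"
        by (rule order_trans[OF integral_abs_bound integral_mono[OF integrable_abs[OF f12] bdi err]])
      also have "\<dots> = 2 / L * ((\<integral>z. bd 0 z \<partial>UO) + (\<integral>z. bd L z \<partial>UO))"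
        using Bochner_Integration.integral_add[OF bd(1) bd(1), of 0 L] by (simp only: integral_mult_right_zero)
      also have "\<dots> \<le> 2 / L * (Q + Q)" using L by (intro mult_left_mono add_mono bd) auto
      finally show ?thesis by simp
    qed
    ultimately show ?thesis by (simp add: f3_def)
  qed
  then show ?thesis by blast
qed

text \<open>The mean of \<open>\<phi> (X n \<omega> 0) / n\<close> is computed twice. It tends to
  \<open>\<gamma>\<close> by the almost sure drift and a uniform second moment bound. Up to the
  vanishing term \<open>\<phi> 0 / n\<close>, it is also a Cesaro mean of
  \<open>mean k drift_fun 0\<close>, which tends to the stationary integral.\<close>

lemma \<nu>0_drift: "(\<integral>y. drift_fun y \<partial>\<nu>0) = \<gamma>"
proof -
  have incr: "integrable S (\<lambda>\<omega>. \<phi> (X (Suc n) \<omega> 0) - \<phi> (X n \<omega> 0))"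
    "(\<integral>\<omega>. \<phi> (X (Suc n) \<omega> 0) - \<phi> (X n \<omega> 0) \<partial>S) = mean n drift_fun 0" for n
    using increment_integral[of "\<lambda>_. 1" n 0] by (simp_all add: mean_def)
  have tot: "integrable S (\<lambda>\<omega>. \<phi> (X n \<omega> 0) - \<phi> 0)"
    "(\<integral>\<omega>. \<phi> (X n \<omega> 0) - \<phi> 0 \<partial>S) = (\<Sum>k<n. mean k drift_fun 0)" for n
  proof (induction n)
    case (Suc n)
    have eq: "\<phi> (X (Suc n) \<omega> 0) - \<phi> 0 = (\<phi> (X n \<omega> 0) - \<phi> 0) + (\<phi> (X (Suc n) \<omega> 0) - \<phi> (X n \<omega> 0))" for \<omega>
      by simp
    { case 1 show ?case unfolding eq by (intro Bochner_Integration.integrable_add Suc incr) }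
    { case 2 show ?case unfolding eq
        by (subst Bochner_Integration.integral_add[OF Suc(1) incr(1)]) (simp only: Suc(2) incr(2) sum.lessThan_Suc) }
  qed simp_all
  define Y where "Y = (\<lambda>n \<omega>. (\<phi> (X n \<omega> 0) - \<phi> 0) / real n - \<gamma>)"
  have [measurable]: "Y n \<in> borel_measurable S" for n unfolding Y_def by measurable
  define V where "V = (\<integral>b. (m b)\<^sup>2 \<partial>M)"
  have V0: "0 \<le> V" by (simp add: V_def)
  have mi: "integrable S (\<lambda>\<omega>. (m (\<omega> i))\<^sup>2)" and mV: "(\<integral>\<omega>. (m (\<omega> i))\<^sup>2 \<partial>S) = V" for i
    using m_sq integral_nth(1)[of "\<lambda>b. (m b)\<^sup>2" i] integral_nth(2)[of "\<lambda>b. (m b)\<^sup>2" i] by (auto simp: V_def)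
  \<comment> \<open>A majorant of the square of \<open>Y n\<close>, from the Cauchy-Schwarz
    inequality for the sum of the bounds \<open>m\<close> and from the inequality \<open>(u -
    \<gamma>)\<^sup>2 \<le> 2 * u\<^sup>2 + 2 * \<gamma>\<^sup>2\<close>. Its mean is bounded
    uniformly in \<open>n\<close>; at \<open>n = 0\<close> the quotients are 0 by
    convention.\<close>
  define Z where "Z = (\<lambda>n \<omega>. 2 * ((\<Sum>i<n. (m (\<omega> i))\<^sup>2) / real n) + 2 * \<gamma>\<^sup>2)"
  have Zi: "integrable S (Z n)" and ZV: "(\<integral>\<omega>. Z n \<omega> \<partial>S) \<le> 2 * V + 2 * \<gamma>\<^sup>2" for n
    using mi V0 unfolding Z_def by (auto simp: mV seq.P.prob_space)
  have YZ: "(Y n \<omega>)\<^sup>2 \<le> Z n \<omega>" if w: "\<omega> \<in> space S" for n \<omega>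
  proof -
    let ?u = "(\<phi> (X n \<omega> 0) - \<phi> 0) / real n"
    have "?u\<^sup>2 \<le> (\<Sum>i<n. (m (\<omega> i))\<^sup>2) / real n"
    proof (cases "n = 0")
      case False
      have "(\<phi> (X n \<omega> 0) - \<phi> 0)\<^sup>2 \<le> (\<Sum>i<n. m (\<omega> i))\<^sup>2"
        using \<phi>_chain_bound[OF w, of n 0] by (rule abs_le_square_iff[THEN iffD1, OF order_trans[OF _ abs_ge_self]])
      also have "\<dots> \<le> (\<Sum>i<n. (m (\<omega> i))\<^sup>2) * real n"
        using sum_squared_le_sum_of_squares[of "\<lambda>i. m (\<omega> i)" "{..<n}"] by simp
      finally have "?u\<^sup>2 \<le> (\<Sum>i<n. (m (\<omega> i))\<^sup>2) * real n / (real n)\<^sup>2"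
        by (simp add: power_divide divide_right_mono)
      then show ?thesis using False by (simp add: power2_eq_square)
    qed simp
    moreover have "(?u - \<gamma>)\<^sup>2 \<le> 2 * ?u\<^sup>2 + 2 * \<gamma>\<^sup>2"
    proof -
      have "0 \<le> (?u + \<gamma>)\<^sup>2" by simp
      then show ?thesis by (simp add: power2_sum power2_diff)
    qed
    ultimately show ?thesis unfolding Y_def Z_def by linarith
  qed
  have Yi: "integrable S (\<lambda>\<omega>. (Y n \<omega>)\<^sup>2)" for n
  proof (rule Bochner_Integration.integrable_bound[OF Zi[of n]])
    show "AE \<omega> in S. norm ((Y n \<omega>)\<^sup>2) \<le> norm (Z n \<omega>)"
      using YZ by (intro AE_I2) (auto intro: order_trans[OF _ abs_ge_self])
  qed measurable
  have YV: "(\<integral>\<omega>. (Y n \<omega>)\<^sup>2 \<partial>S) \<le> 2 * V + 2 * \<gamma>\<^sup>2" for n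
    by (rule order_trans[OF integral_mono[OF Yi Zi YZ] ZV])
  have "(\<lambda>n. \<integral>\<omega>. Y n \<omega> \<partial>S) \<longlonglongrightarrow> 0"
  proof (rule tendsto_integral_L2_bounded[OF seq.P.prob_space_axioms _ Yi YV])
    show "AE \<omega> in S. (\<lambda>n. Y n \<omega>) \<longlonglongrightarrow> 0"
      using drift
    proof eventually_elim
      case (elim \<omega>)
      have "(\<lambda>n. \<phi> (X n \<omega> 0) / real n - \<phi> 0 / real n - \<gamma>) \<longlonglongrightarrow> \<gamma> - 0 - \<gamma>"
        by (intro tendsto_diff elim tendsto_const lim_const_over_n)
      then show ?case by (simp add: Y_def diff_divide_distrib)
    qed
  qed measurable
  moreover have "(\<integral>\<omega>. Y n \<omega> \<partial>S) = (\<Sum>k<n. mean k drift_fun 0) / real n - \<gamma>" for n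
    using tot[of n] unfolding Y_def by (simp add: seq.P.prob_space)
  ultimately have "(\<lambda>n. (\<Sum>k<n. mean k drift_fun 0) / real n - \<gamma>) \<longlonglongrightarrow> 0" by simp
  then have "(\<lambda>n. (\<Sum>k<n. mean k drift_fun 0) / real n) \<longlonglongrightarrow> \<gamma>" by (rule LIM_zero_cancel)
  then show ?thesis
    using LIMSEQ_unique cesaro_mean[OF mean_tendsto_\<nu>0[OF bmi_drift_fun, of 0]] by blast
qed

text \<open>Below level 0 the ramp starts at 1, so the drift summed over the visits to the window is
  about \<open>L\<close>. It is also about \<open>\<gamma>\<close> times the expected number of
  visits, so that number is about \<open>L / \<gamma>\<close>, and \<open>q\<close> contributes its
  stationary mean at each visit.\<close>

lemma avg_limit:
  assumes q: "bmi q B" and "e > 0"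
  shows "\<exists>L0\<ge>1. \<forall>L\<ge>L0. \<forall>x. \<phi> x \<le> 0 \<longrightarrow>
    \<bar>(\<integral>z. q (visit z x) * window L (\<phi> (visit z x)) \<partial>UO) / L - (\<integral>y. q y \<partial>\<nu>0) / \<gamma>\<bar> \<le> e"
proof -
  define D where "D = (\<integral>y. q y \<partial>\<nu>0)"
  \<comment> \<open>Collects the weights of two errors: 1 for replacing \<open>q\<close> by its
    mean, and \<open>\<bar>D\<bar> / \<gamma>\<close> for replacing \<open>\<gamma>\<close> times
    the number of visits by \<open>L\<close>. The choice of \<open>e1\<close> makes the part growing
    with \<open>L\<close> at most \<open>e / 2 * L\<close>, using \<open>L + 1 \<le> 2 * L\<close>;
    the second entry of \<open>L0\<close> does the same for the constants.\<close>
  define c where "c = 1 + \<bar>D\<bar> / \<gamma>"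
  have c: "c \<ge> 1" using \<gamma>_pos by (simp add: c_def)
  define e1 where "e1 = e / (4 * c)"
  have e1: "e1 > 0" using \<open>e > 0\<close> c by (simp add: e1_def)
  obtain K1 where K1: "\<And>L x. L \<ge> 0 \<Longrightarrow> \<bar>(\<integral>z. q (visit z x) * window L (\<phi> (visit z x)) \<partial>UO)
     - D * (\<integral>z. window L (\<phi> (visit z x)) \<partial>UO)\<bar> \<le> e1 * (L + 1) + K1"
    using avg_window[OF q e1] unfolding D_def by blast
  obtain K2 where K2: "\<And>L x. L \<ge> 0 \<Longrightarrow> \<bar>(\<integral>z. drift_fun (visit z x) * window L (\<phi> (visit z x)) \<partial>UO)
     - \<gamma> * (\<integral>z. window L (\<phi> (visit z x)) \<partial>UO)\<bar> \<le> e1 * (L + 1) + K2"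
    using avg_window[OF bmi_drift_fun e1] unfolding \<nu>0_drift by blast
  obtain K3 where K3: "\<And>L x. L > 0 \<Longrightarrow> \<bar>ramp L (\<phi> x)
     - (\<integral>z. drift_fun (visit z x) * window L (\<phi> (visit z x)) \<partial>UO) / L\<bar> \<le> K3 / L"
    using ramp_sum by blast
  define K where "K = \<bar>K1\<bar> + \<bar>K2\<bar> + \<bar>K3\<bar>"
  define L0 where "L0 = max 1 (2 * c * K / e)"
  show ?thesis
  proof (intro exI[of _ L0] conjI allI impI)
    show "1 \<le> L0" by (simp add: L0_def)
    fix L x assume "L0 \<le> L" and x: "\<phi> x \<le> 0"
    then have L: "L \<ge> 1" "2 * c * K / e \<le> L" by (auto simp: L0_def)
    let ?Q = "\<integral>z. q (visit z x) * window L (\<phi> (visit z x)) \<partial>UO"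
    let ?R = "\<integral>z. drift_fun (visit z x) * window L (\<phi> (visit z x)) \<partial>UO"
    let ?I = "\<integral>z. window L (\<phi> (visit z x)) \<partial>UO"
    have "ramp L (\<phi> x) = 1" using x L by (simp add: ramp_def min_def max_def divide_nonpos_pos)
    then have R: "\<bar>L - ?R\<bar> \<le> \<bar>K3\<bar>"
    proof -
      have "\<bar>1 - ?R / L\<bar> * L \<le> K3 / L * L"
        using K3[of L x] \<open>ramp L (\<phi> x) = 1\<close> L by (intro mult_right_mono) auto
      moreover have "\<bar>1 - ?R / L\<bar> * L = \<bar>(1 - ?R / L) * L\<bar>" using L by (simp add: abs_mult)
      moreover have "(1 - ?R / L) * L = L - ?R" using L by (simp add: left_diff_distrib)
      ultimately have "\<bar>L - ?R\<bar> \<le> K3" using L by simp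
      then show ?thesis by (rule order_trans[OF _ abs_ge_self])
    qed
    then have "\<bar>\<gamma> * ?I - L\<bar> \<le> e1 * (L + 1) + K" using K2[of L x] L unfolding K_def by linarith
    then have *: "\<bar>D\<bar> / \<gamma> * \<bar>\<gamma> * ?I - L\<bar> \<le> \<bar>D\<bar> / \<gamma> * (e1 * (L + 1) + K)"
      using \<gamma>_pos by (intro mult_left_mono) auto
    have "?Q - D / \<gamma> * L = (?Q - D * ?I) + D / \<gamma> * (\<gamma> * ?I - L)"
      using \<gamma>_pos by (simp add: algebra_simps)
    then have "\<bar>?Q - D / \<gamma> * L\<bar> \<le> \<bar>?Q - D * ?I\<bar> + \<bar>D / \<gamma> * (\<gamma> * ?I - L)\<bar>" by linarith
    also have "\<bar>D / \<gamma> * (\<gamma> * ?I - L)\<bar> = \<bar>D\<bar> / \<gamma> * \<bar>\<gamma> * ?I - L\<bar>" using \<gamma>_pos by (simp add: abs_mult)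
    also have "\<bar>?Q - D * ?I\<bar> + \<bar>D\<bar> / \<gamma> * \<bar>\<gamma> * ?I - L\<bar> \<le> c * (e1 * (L + 1) + K)"
    proof -
      have "\<bar>?Q - D * ?I\<bar> \<le> e1 * (L + 1) + K"
        using K1[of L x] L unfolding K_def by linarith
      then have "\<bar>?Q - D * ?I\<bar> + \<bar>D\<bar> / \<gamma> * \<bar>\<gamma> * ?I - L\<bar>
          \<le> (e1 * (L + 1) + K) + \<bar>D\<bar> / \<gamma> * (e1 * (L + 1) + K)"
        using * by (rule add_mono)
      then show ?thesis by (simp only: c_def distrib_right mult_1)
    qed
    also have "\<dots> \<le> e * L"
    proof -
      have "c * (e1 * (L + 1)) \<le> c * (e1 * (2 * L))" using c e1 L by (intro mult_left_mono) auto
      also have "\<dots> = e / 2 * L" using c by (simp add: e1_def)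
      finally have "c * (e1 * (L + 1)) \<le> e / 2 * L" .
      moreover have "c * K \<le> e / 2 * L" using L(2) \<open>e > 0\<close> by (simp add: field_simps)
      ultimately show ?thesis by (simp add: distrib_left)
    qed
    finally have "\<bar>?Q - D / \<gamma> * L\<bar> / L \<le> e" using L by (simp add: field_simps)
    moreover have "\<bar>?Q / L - D / \<gamma>\<bar> = \<bar>?Q - D / \<gamma> * L\<bar> / L"
    proof -
      have "?Q / L - D / \<gamma> = (?Q - D / \<gamma> * L) / L" using L by (simp add: diff_divide_distrib)
      then show ?thesis using L by simp
    qed
    ultimately show "\<bar>?Q / L - (\<integral>y. q y \<partial>\<nu>0) / \<gamma>\<bar> \<le> e" by (simp add: D_def)
  qed
qed

end

subsection \<open>Smoothings of the renewal functional\<close>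

text \<open>The test function enters through three consequences of continuity and compact support:
  its support lies in a slab of \<open>\<phi>\<close>, it is bounded, and it is uniformly continuous
  in the direction \<open>ones\<close>.\<close>

locale renewal_test = topical_stationary M T \<phi> m \<gamma> \<nu>0
  for M :: "'w measure" and T :: "'w \<Rightarrow> real^'d \<Rightarrow> real^'d" and \<phi> m \<gamma> and \<nu>0 :: "(real^'d) measure" +
  fixes h :: "real^'d \<Rightarrow> real" and K H :: real
  assumes h_cont: "continuous_on UNIV h"
    and h_supp: "\<And>x. h x \<noteq> 0 \<Longrightarrow> \<bar>\<phi> x\<bar> \<le> K"
    and h_bound: "\<And>x. \<bar>h x\<bar> \<le> H"
    and h_unif: "\<And>e. e > 0 \<Longrightarrow> \<exists>d>0. \<forall>x b. \<bar>b\<bar> < d \<longrightarrow> \<bar>h (x + b *\<^sub>R ones) - h x\<bar> \<le> e"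
    and K_nonneg: "0 \<le> K"
begin

lemma measurable_h [measurable]: "h \<in> borel_measurable borel"
  by (rule borel_measurable_continuous_onI[OF h_cont])

lemma H_nonneg: "0 \<le> H"
  using h_bound[of 0] by linarith

sublocale UO: sigma_finite_measure UO
  by (intro sigma_finite_pair_measure sigma_finite_measure_count_space seq.P.sigma_finite_measure_axioms)

text \<open>The time sum starts at \<open>n = 0\<close>, whereas the theorem sums from 1; the extra
  term \<open>h x\<close> is subtracted in \<open>renewal_limits\<close>.\<close>

definition G :: "real^'d \<Rightarrow> real" where
  "G x = (\<integral>z. h (visit z x) \<partial>UO)"

definition CG :: real where "CG = H * (Cr * (K + 1))"

lemma CG_nonneg: "0 \<le> CG"
  using H_nonneg Cr_nonneg K_nonneg by (simp add: CG_def)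

lemma h_slab: "z \<in> space UO \<Longrightarrow> \<bar>h (visit z x)\<bar> \<le> H * indicator (slab x 0 K) z"
  using h_supp[of "visit z x"] h_bound[of "visit z x"]
  by (auto simp: slab_def indicator_def)

lemma integrable_h_UO: "integrable UO (\<lambda>z. h (visit z x))"
  by (rule slab_dominated(1)[OF _ K_nonneg H_nonneg h_slab]) measurable

lemma integral_abs_h_UO: "(\<integral>z. \<bar>h (visit z x)\<bar> \<partial>UO) \<le> CG"
proof -
  have "\<bar>\<integral>z. \<bar>h (visit z x)\<bar> \<partial>UO\<bar> \<le> CG"
    unfolding CG_def
    by (rule slab_dominated(2)[OF _ K_nonneg H_nonneg]) (use h_slab in auto)
  then show ?thesis by linarith
qed

lemma G_bound: "\<bar>G x\<bar> \<le> CG"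
  unfolding G_def by (rule order_trans[OF integral_abs_bound integral_abs_h_UO])

lemma measurable_G [measurable]: "G \<in> borel_measurable borel"
  unfolding G_def by (rule UO.borel_measurable_lebesgue_integral) measurable

text \<open>The modulus does not depend on \<open>x\<close>: all visits that matter lie in one slab,
  whose expected number of visits has a universal bound. The slab has half-width
  \<open>K + 1\<close> to leave room for shifts of size at most 1.\<close>

lemma G_ones_continuous:
  assumes "e > 0"
  shows "\<exists>d>0. \<forall>b x. \<bar>b\<bar> \<le> d \<longrightarrow> \<bar>G (x + b *\<^sub>R ones) - G x\<bar> \<le> e"
proof -
  define c where "c = Cr * (K + 1 + 1) + 1"
  have c: "c > 0" using Cr_nonneg K_nonneg by (simp add: c_def add_nonneg_pos)
  obtain d where d: "d > 0" "\<And>x b. \<bar>b\<bar> < d \<Longrightarrow> \<bar>h (x + b *\<^sub>R ones) - h x\<bar> \<le> e / c"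
    using h_unif[of "e / c"] assms c by auto
  have "\<bar>G (x + b *\<^sub>R ones) - G x\<bar> \<le> e" if b: "\<bar>b\<bar> \<le> min (d / 2) 1" for b x
  proof -
    have "G (x + b *\<^sub>R ones) - G x
        = (\<integral>z. h (visit z (x + b *\<^sub>R ones)) - h (visit z x) \<partial>UO)"
      unfolding G_def by (rule Bochner_Integration.integral_diff[OF integrable_h_UO integrable_h_UO, symmetric])
    also have "\<bar>\<dots>\<bar> \<le> (e / c) * (Cr * (K + 1 + 1))"
    proof (rule slab_dominated(2))
      fix z assume z: "z \<in> space UO"
      let ?y = "visit z x"
      have eq: "visit z (x + b *\<^sub>R ones) = ?y + b *\<^sub>R ones"
        by (rule chain_add_ones[OF space_UO[OF z]])
      show "\<bar>h (visit z (x + b *\<^sub>R ones)) - h ?y\<bar> \<le> e / c * indicator (slab x 0 (K + 1)) z"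
      proof (cases "\<bar>\<phi> ?y\<bar> \<le> K + 1")
        case True
        then show ?thesis using d(2)[of b ?y] b d(1) z by (simp add: eq slab_def)
      next
        case False
        then have "\<not> \<bar>\<phi> ?y\<bar> \<le> K" "\<not> \<bar>\<phi> (?y + b *\<^sub>R ones)\<bar> \<le> K"
          using b unfolding topical_funD_add[OF \<phi>_top] by linarith+
        then have "h ?y = 0" "h (?y + b *\<^sub>R ones) = 0" using h_supp by blast+
        then show ?thesis using assms c by (simp add: eq)
      qed
    qed (use K_nonneg assms c in auto)
    also have "\<dots> = e * (Cr * (K + 1 + 1) / c)" by simp
    also have "\<dots> \<le> e * 1"
      using assms c by (intro mult_left_mono) (auto simp: c_def)
    finally show ?thesis by simp
  qed
  then show ?thesis using d(1) by (intro exI[of _ "min (d / 2) 1"]) auto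
qed

text \<open>The integral of \<open>h\<close> over the fibre of the class of \<open>x\<close>.
  Integrated against \<open>\<nu>0\<close> it gives the integral of \<open>h\<close> against
  \<open>\<alpha>\<close>.\<close>

definition htil :: "real^'d \<Rightarrow> real" where
  "htil x = (\<integral>s. h (x + s *\<^sub>R ones) \<partial>lborel)"

lemma h_line: "\<bar>h (x + s *\<^sub>R ones)\<bar> \<le> H * indicator {- K - \<phi> x..K - \<phi> x} s"
proof (cases "h (x + s *\<^sub>R ones) = 0")
  case False
  then have "s \<in> {- K - \<phi> x..K - \<phi> x}"
    using h_supp[OF False] by (auto simp: topical_funD_add[OF \<phi>_top])
  then show ?thesis using h_bound[of "x + s *\<^sub>R ones"] by simp
qed (simp add: H_nonneg)

lemma integrable_h_line: "integrable lborel (\<lambda>s. h (x + s *\<^sub>R ones))"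
proof (rule Bochner_Integration.integrable_bound[OF integrable_mult_indicator_Icc])
  show "AE s in lborel. norm (h (x + s *\<^sub>R ones)) \<le> norm (H * indicator {- K - \<phi> x..K - \<phi> x} s)"
    using h_line H_nonneg by (intro AE_I2) simp
qed measurable

lemma integral_abs_h_line: "(\<integral>s. \<bar>h (x + s *\<^sub>R ones)\<bar> \<partial>lborel) \<le> H * (2 * K)"
proof -
  have "(\<integral>s. \<bar>h (x + s *\<^sub>R ones)\<bar> \<partial>lborel) \<le> (\<integral>s. H * indicator {- K - \<phi> x..K - \<phi> x} s \<partial>lborel)"
    by (intro integral_mono integrable_abs integrable_h_line integrable_mult_indicator_Icc h_line)
  also have "\<dots> = H * (2 * K)" using K_nonneg by simp
  finally show ?thesis .
qed

lemma bmi_htil: "bmi htil (H * (2 * K))"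
  unfolding bmi_def
proof (intro conjI allI)
  show "htil \<in> borel_measurable borel" unfolding htil_def by measurable
  show "proj_inv htil" unfolding proj_inv_def htil_def
  proof (intro allI)
    fix x :: "real^'d" and a :: real
    have "(\<integral>s. h (x + s *\<^sub>R ones) \<partial>lborel) = (\<integral>s. h (x + (a + s) *\<^sub>R ones) \<partial>lborel)"
      using lborel_integral_real_affine[of 1 "\<lambda>s. h (x + s *\<^sub>R ones)" a] by simp
    then show "(\<integral>s. h (x + a *\<^sub>R ones + s *\<^sub>R ones) \<partial>lborel) = (\<integral>s. h (x + s *\<^sub>R ones) \<partial>lborel)"
      by (simp add: scaleR_add_left add.assoc)
  qed
  show "\<bar>htil x\<bar> \<le> H * (2 * K)" for x
    unfolding htil_def by (rule order_trans[OF integral_abs_bound integral_abs_h_line])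
qed

definition lim_val :: real where "lim_val = (\<integral>y. htil y \<partial>\<nu>0) / \<gamma>"

definition Gavg :: "real \<Rightarrow> real^'d \<Rightarrow> real" where
  "Gavg L x = (\<integral>b. window L b * G (x - b *\<^sub>R ones) \<partial>lborel) / L"

lemma measurable_Gavg [measurable]: "Gavg L \<in> borel_measurable borel"
  unfolding Gavg_def by measurable

lemma integrable_window: "integrable lborel (window L)"
  using integrable_mult_indicator_Icc[of 1 0 L] by (simp add: window_def[abs_def])

lemma integral_window: "0 \<le> L \<Longrightarrow> (\<integral>b. window L b \<partial>lborel) = L"
  by (simp add: window_def)

lemma integrable_window_mult:
  assumes [measurable]: "f \<in> borel_measurable borel" and "\<And>b. \<bar>f b\<bar> \<le> B"
  shows "integrable lborel (\<lambda>b. window L b * f b)"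
proof (rule Bochner_Integration.integrable_bound[OF integrable_mult_right[OF integrable_window, of B]])
  have "0 \<le> B" using assms(2)[of 0] by linarith
  then show "AE b in lborel. norm (window L b * f b) \<le> norm (B * window L b)"
    using assms(2) by (intro AE_I2) (auto simp: window_def indicator_def)
qed measurable

lemma window_average_le:
  assumes [measurable]: "f \<in> borel_measurable borel" and B: "\<And>b. \<bar>f b\<bar> \<le> B" and L: "L > 0"
    and c: "\<And>b. 0 \<le> b \<Longrightarrow> b \<le> L \<Longrightarrow> \<bar>f b\<bar> \<le> c"
  shows "\<bar>(\<integral>b. window L b * f b \<partial>lborel) / L\<bar> \<le> c"
proof -
  have i: "integrable lborel (\<lambda>b. window L b * f b)" by (rule integrable_window_mult[OF _ B]) simp
  have "\<bar>\<integral>b. window L b * f b \<partial>lborel\<bar> \<le> (\<integral>b. c * window L b \<partial>lborel)"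
  proof (rule order_trans[OF integral_abs_bound integral_mono])
    show "integrable lborel (\<lambda>b. \<bar>window L b * f b\<bar>)" using i by simp
    show "integrable lborel (\<lambda>b. c * window L b)" using integrable_window by simp
    show "\<bar>window L b * f b\<bar> \<le> c * window L b" for b
      using c[of b] by (auto simp: window_def indicator_def)
  qed
  also have "\<dots> = c * L" using integral_window[of L] L by simp
  finally show ?thesis using L by (simp add: divide_le_eq)
qed

lemma Gavg_bound: "L > 0 \<Longrightarrow> \<bar>Gavg L x\<bar> \<le> CG"
  unfolding Gavg_def by (rule window_average_le[OF _ G_bound]) (auto intro: G_bound)

text \<open>After exchanging the integrals over levels and visits, each visit contributes the part
  of its fibre integral seen through the window. This equals all of \<open>htil\<close> or nothing,
  according to the level of the visit, unless that level is within \<open>K\<close> of an end of the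
  window. Such visits cost a constant, and \<open>avg_limit\<close> handles the remaining
  sum.\<close>

lemma Gavg_limit:
  assumes "e > 0"
  shows "\<exists>L\<ge>1. \<forall>x. \<phi> x \<le> 0 \<longrightarrow> \<bar>Gavg L x - lim_val\<bar> \<le> e"
proof -
  obtain L0 where L0: "L0 \<ge> 1" "\<And>L x. L \<ge> L0 \<Longrightarrow> \<phi> x \<le> 0 \<Longrightarrow>
    \<bar>(\<integral>z. htil (visit z x) * window L (\<phi> (visit z x)) \<partial>UO) / L - lim_val\<bar> \<le> e / 2"
    using avg_limit[OF bmi_htil, of "e / 2"] assms unfolding lim_val_def by auto
  define Q where "Q = H * (2 * K) * (Cr * (K + 1))"
  \<comment> \<open>The two ends of the window cost \<open>Q\<close> each, and the second entry
    makes \<open>2 * Q\<close> at most \<open>e / 2 * L\<close>.\<close>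
  define L where "L = max L0 (4 * Q / e)"
  have L: "L \<ge> L0" "L \<ge> 1" "4 * Q / e \<le> L" using L0(1) by (auto simp: L_def)
  have "\<bar>Gavg L x - lim_val\<bar> \<le> e" if x: "\<phi> x \<le> 0" for x
  proof -
    interpret LU: pair_sigma_finite lborel UO ..
    define W where "W = (\<lambda>b z. window L b * h (visit z (x - b *\<^sub>R ones)))"
    have W [measurable]: "(\<lambda>p. W (fst p) (snd p)) \<in> borel_measurable (lborel \<Otimes>\<^sub>M UO)"
      unfolding W_def by measurable
    have Wi: "integrable (lborel \<Otimes>\<^sub>M UO) (\<lambda>(b, z). W b z)"
    proof (rule LU.Fubini_integrable)
      have "(\<integral>z. norm (W b z) \<partial>UO) = window L b * (\<integral>z. \<bar>h (visit z (x - b *\<^sub>R ones))\<bar> \<partial>UO)" for b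
        using window_cases[of L b] by (auto simp: W_def abs_mult)
      moreover have "integrable lborel (\<lambda>b. window L b * (\<integral>z. \<bar>h (visit z (x - b *\<^sub>R ones))\<bar> \<partial>UO))"
      proof (rule integrable_window_mult)
        show "(\<lambda>b. \<integral>z. \<bar>h (visit z (x - b *\<^sub>R ones))\<bar> \<partial>UO) \<in> borel_measurable borel"
          by measurable
        show "\<bar>\<integral>z. \<bar>h (visit z (x - b *\<^sub>R ones))\<bar> \<partial>UO\<bar> \<le> CG" for b
          using integral_abs_h_UO[of "x - b *\<^sub>R ones"] by simp
      qed
      ultimately show "integrable lborel (\<lambda>b. \<integral>z. norm (case (b, z) of (b, z) \<Rightarrow> W b z) \<partial>UO)" by simp
      show "AE b in lborel. integrable UO (\<lambda>z. case (b, z) of (b, z) \<Rightarrow> W b z)"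
        unfolding W_def prod.case by (intro AE_I2 integrable_mult_right integrable_h_UO)
    qed (use W in \<open>simp add: split_beta'\<close>)
    have "Gavg L x * L = (\<integral>b. \<integral>z. W b z \<partial>UO \<partial>lborel)"
      using L by (simp add: Gavg_def G_def W_def)
    also have "\<dots> = (\<integral>z. \<integral>b. W b z \<partial>lborel \<partial>UO)"
      by (rule LU.Fubini_integral[OF Wi, symmetric])
    finally have GL: "Gavg L x * L = (\<integral>z. \<integral>b. W b z \<partial>lborel \<partial>UO)" .
    have i1: "integrable UO (\<lambda>z. \<integral>b. W b z \<partial>lborel)" using LU.integrable_snd[OF Wi] .
    have i2: "integrable UO (\<lambda>z. htil (visit z x) * window L (\<phi> (visit z x)))"
      using bmi_window(1)[OF bmi_htil, of L 0 x] L by simp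
    have pt: "\<bar>(\<integral>b. W b z \<partial>lborel) - htil (visit z x) * window L (\<phi> (visit z x))\<bar>
        \<le> H * (2 * K) * indicator (slab x 0 K) z + H * (2 * K) * indicator (slab x L K) z"
      if z: "z \<in> space UO" for z
    proof -
      define y where "y = visit z x"
      have hy: "htil y = (\<integral>b. h (y - b *\<^sub>R ones) \<partial>lborel)"
        unfolding htil_def using lborel_integral_real_affine[of "-1" "\<lambda>s. h (y + s *\<^sub>R ones)" 0] by simp
      have hi: "integrable lborel (\<lambda>b. h (y - b *\<^sub>R ones))"
        using lborel_integrable_real_affine[OF integrable_h_line[of y], of "-1" 0] by simp
      have ha: "(\<integral>b. \<bar>h (y - b *\<^sub>R ones)\<bar> \<partial>lborel) \<le> H * (2 * K)"
        using lborel_integral_real_affine[of "-1" "\<lambda>s. \<bar>h (y + s *\<^sub>R ones)\<bar>" 0] integral_abs_h_line[of y] by simp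
      have Wz: "W b z = window L b * h (y - b *\<^sub>R ones)" for b
        by (simp add: W_def y_def chain_diff_ones[OF space_UO[OF z]])
      have hw: "integrable lborel (\<lambda>b. window L b * h (y - b *\<^sub>R ones))"
        by (rule integrable_window_mult[OF _ h_bound]) measurable
      have hc: "integrable lborel (\<lambda>b. h (y - b *\<^sub>R ones) * c)" for c :: real using hi by simp
      have "(\<integral>b. W b z \<partial>lborel) - htil y * window L (\<phi> y)
          = (\<integral>b. window L b * h (y - b *\<^sub>R ones) - h (y - b *\<^sub>R ones) * window L (\<phi> y) \<partial>lborel)"
        using hw hc by (simp add: Wz hy)
      also have "\<bar>\<dots>\<bar> \<le> (\<integral>b. \<bar>h (y - b *\<^sub>R ones)\<bar> * (indicator (slab x 0 K) z + indicator (slab x L K) z) \<partial>lborel)"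
      proof (rule order_trans[OF integral_abs_bound integral_mono])
        fix b
        have e: "window L b * h (y - b *\<^sub>R ones) - h (y - b *\<^sub>R ones) * window L (\<phi> y)
          = h (y - b *\<^sub>R ones) * (window L b - window L (\<phi> y))" by (simp add: algebra_simps)
        have "\<bar>window L b - window L (\<phi> y)\<bar> \<le> indicator (slab x 0 K) z + indicator (slab x L K) z"
          if "h (y - b *\<^sub>R ones) \<noteq> 0"
        proof -
          have "\<bar>b - \<phi> y\<bar> \<le> K" using h_supp[OF that] by (simp add: topical_funD_diff[OF \<phi>_top])
          moreover have "indicator (slab x c K) z = (if \<bar>\<phi> y - c\<bar> \<le> K then 1 else 0 :: real)" for c
            using z by (simp add: slab_def y_def indicator_def)
          ultimately show ?thesis using window_diff_le[of b "\<phi> y" K L] by (simp only:)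
        qed
        then show "\<bar>window L b * h (y - b *\<^sub>R ones) - h (y - b *\<^sub>R ones) * window L (\<phi> y)\<bar>
           \<le> \<bar>h (y - b *\<^sub>R ones)\<bar> * (indicator (slab x 0 K) z + indicator (slab x L K) z)"
          unfolding e abs_mult by (cases "h (y - b *\<^sub>R ones) = 0") (auto intro: mult_left_mono)
      next
        show "integrable lborel (\<lambda>b. \<bar>h (y - b *\<^sub>R ones)\<bar> * (indicator (slab x 0 K) z + indicator (slab x L K) z))"
          using hi by (intro integrable_mult_left integrable_abs)
        show "integrable lborel (\<lambda>b. \<bar>window L b * h (y - b *\<^sub>R ones) - h (y - b *\<^sub>R ones) * window L (\<phi> y)\<bar>)"
          using hw hc by (intro integrable_abs Bochner_Integration.integrable_diff)
      qed
      also have "\<dots> = (\<integral>b. \<bar>h (y - b *\<^sub>R ones)\<bar> \<partial>lborel) * (indicator (slab x 0 K) z + indicator (slab x L K) z)"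
        by simp
      also have "\<dots> \<le> H * (2 * K) * (indicator (slab x 0 K) z + indicator (slab x L K) z)"
        by (intro mult_right_mono ha) auto
      finally show ?thesis by (simp add: y_def distrib_left)
    qed
    have si: "integrable UO (\<lambda>z. H * (2 * K) * indicator (slab x c K) z)" for c
      by (intro integrable_mult_right integrable_real_indicator sets_slab slab_finite K_nonneg)
    have sl: "(\<integral>z. H * (2 * K) * indicator (slab x c K) z \<partial>UO) \<le> Q" for c
      using measure_slab_le[OF K_nonneg, of x c] H_nonneg K_nonneg by (simp add: Q_def mult_left_mono)
    let ?I = "\<integral>z. htil (visit z x) * window L (\<phi> (visit z x)) \<partial>UO"
    have "\<bar>Gavg L x * L - ?I\<bar> = \<bar>\<integral>z. (\<integral>b. W b z \<partial>lborel) - htil (visit z x) * window L (\<phi> (visit z x)) \<partial>UO\<bar>"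
      unfolding GL using i1 i2 by simp
    also have "\<dots> \<le> (\<integral>z. H * (2 * K) * indicator (slab x 0 K) z + H * (2 * K) * indicator (slab x L K) z \<partial>UO)"
      by (rule order_trans[OF integral_abs_bound integral_mono])
        (intro integrable_abs Bochner_Integration.integrable_diff i1 i2 Bochner_Integration.integrable_add si pt | assumption)+
    also have "\<dots> = (\<integral>z. H * (2 * K) * indicator (slab x 0 K) z \<partial>UO) + (\<integral>z. H * (2 * K) * indicator (slab x L K) z \<partial>UO)"
      by (rule Bochner_Integration.integral_add[OF si si])
    also have "\<dots> \<le> Q + Q" by (intro add_mono sl)
    also have "\<dots> \<le> e / 2 * L" using L(3) assms by (simp add: field_simps)
    finally have *: "\<bar>Gavg L x * L - ?I\<bar> \<le> e / 2 * L" .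
    have "\<bar>Gavg L x - ?I / L\<bar> = \<bar>Gavg L x * L - ?I\<bar> / L"
    proof -
      have "Gavg L x - ?I / L = (Gavg L x * L - ?I) / L" using L by (simp add: diff_divide_distrib)
      then show ?thesis using L by simp
    qed
    also have "\<dots> \<le> e / 2" using * L by (simp add: divide_le_eq)
    finally show ?thesis using L0(2)[OF L(1) x] by linarith
  qed
  then show ?thesis using L(2) by blast
qed

section \<open>Smoothing with narrow and wide kernels\<close>

definition Gker :: "real \<Rightarrow> real^'d \<Rightarrow> real" where
  "Gker l x = (\<integral>s. G (x + s *\<^sub>R ones) * (l * vpk (l * s)) \<partial>lborel)"

abbreviation c0 :: real where "c0 \<equiv> (\<integral>s. vpk s \<partial>lborel)"
abbreviation c1 :: real where "c1 \<equiv> (\<integral>s. \<bar>vpk s\<bar> \<partial>lborel)"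
abbreviation tail :: "real \<Rightarrow> real" where
  "tail v \<equiv> (\<integral>s. indicator {s. v < \<bar>s\<bar>} s * \<bar>vpk s\<bar> \<partial>lborel)"

lemma c1_nonneg: "0 \<le> c1"
  by simp

lemma mult_half: "0 < y \<Longrightarrow> e / (2 * y) * y = e / (2::real)"
  and mult_third: "0 < y \<Longrightarrow> e / (3 * y) * y = e / (3::real)"
  by simp_all

text \<open>For \<open>R\<close> large the kernel concentrates at shifts of size at most
  \<open>d\<close>, over which \<open>G\<close> hardly varies, uniformly in \<open>x\<close>; the
  remaining mass of the kernel meets only the bound on \<open>G\<close>.\<close>

lemma Gker_high:
  assumes "e > 0"
  shows "\<exists>R>0. \<forall>x. \<bar>Gker R x - G x * c0\<bar> \<le> e"
proof -
  define e1 where "e1 = e / (2 * (c1 + 1))"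
  have e1: "e1 > 0" using assms c1_nonneg by (simp add: e1_def add_nonneg_pos)
  obtain d where d: "d > 0" "\<And>b x. \<bar>b\<bar> \<le> d \<Longrightarrow> \<bar>G (x + b *\<^sub>R ones) - G x\<bar> \<le> e1"
    using G_ones_continuous[OF e1] by blast
  have "((\<lambda>v. 2 * CG * tail v) \<longlongrightarrow> 0) at_top"
    using tendsto_mult_right_zero[OF vpk_tail] by simp
  then have "\<forall>\<^sub>F v in at_top. 2 * CG * tail v < e / 2"
    using assms by (intro order_tendstoD) auto
  then obtain v where v: "v > 0" "2 * CG * tail v < e / 2"
    using eventually_happens[OF eventually_conj[OF eventually_gt_at_top[of 0]]] by auto
  define R where "R = v / d"
  have R: "R > 0" "R * d = v" using v d by (auto simp: R_def)
  have "\<bar>Gker R x - G x * c0\<bar> \<le> e" for x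
  proof -
    have "\<bar>Gker R x - G x * c0\<bar> \<le> e1 * c1 + (2 * CG) * tail (R * d)"
      unfolding Gker_def
    proof (rule vpk_approx[OF R(1) less_imp_le[OF d(1)]])
      show "\<bar>G (x + s *\<^sub>R ones) - G x\<bar> \<le> 2 * CG" for s
        using G_bound[of "x + s *\<^sub>R ones"] G_bound[of x] by linarith
    qed (use d(2) e1 in auto)
    also have "e1 * c1 \<le> e / 2"
    proof -
      have "e1 * c1 \<le> e1 * (c1 + 1)" using e1 by (intro mult_left_mono) auto
      also have "\<dots> = e / 2" unfolding e1_def by (rule mult_half) (use c1_nonneg in linarith)
      finally show ?thesis .
    qed
    finally show ?thesis using v(2) by (simp add: R(2))
  qed
  then show ?thesis using R(1) by blast
qed

text \<open>A wide kernel is almost unchanged by translations of length up to \<open>L\<close>, so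
  smoothing \<open>G\<close> and smoothing its window average \<open>Gavg L\<close> nearly agree. As
  \<open>a\<close> grows, most of the kernel's mass sits at points with \<open>\<phi>\<close> at
  most 0, where \<open>Gavg L\<close> is close to its limit.\<close>

lemma Gker_low:
  assumes "e > 0"
  shows "\<exists>d0>0. \<forall>d. 0 < d \<and> d \<le> d0 \<longrightarrow>
    (\<forall>x. \<forall>\<^sub>F a in at_top. \<bar>Gker d (x - a *\<^sub>R ones) - lim_val * c0\<bar> \<le> e)"
proof -
  define e1 where "e1 = e / (3 * (c1 + 1))"
  have e1: "e1 > 0" using assms c1_nonneg by (simp add: e1_def add_nonneg_pos)
  have e1c: "e1 * c1 \<le> e / 3"
  proof -
    have "e1 * c1 \<le> e1 * (c1 + 1)" using e1 by (intro mult_left_mono) auto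
    also have "\<dots> = e / 3" unfolding e1_def by (rule mult_third) (use c1_nonneg in linarith)
    finally show ?thesis .
  qed
  obtain L where L: "L \<ge> 1" "\<And>x. \<phi> x \<le> 0 \<Longrightarrow> \<bar>Gavg L x - lim_val\<bar> \<le> e1"
    using Gavg_limit[OF e1] by blast
  have L0: "L > 0" using L by simp
  define e2 where "e2 = e / (3 * (CG + 1))"
  have e2: "e2 > 0" using assms CG_nonneg by (simp add: e2_def add_nonneg_pos)
  obtain d1 where d1: "d1 > 0" "\<And>b. \<bar>b\<bar> < d1 \<Longrightarrow> (\<integral>s. \<bar>vpk (s + b) - vpk s\<bar> \<partial>lborel) \<le> e2"
  proof -
    obtain d where "d > 0" "\<And>b. b \<noteq> 0 \<Longrightarrow> \<bar>b\<bar> < d \<Longrightarrow> (\<integral>s. \<bar>vpk (s + b) - vpk s\<bar> \<partial>lborel) < e2"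
      using LIM_D[OF vpk_translation e2] by auto
    then have "(\<integral>s. \<bar>vpk (s + b) - vpk s\<bar> \<partial>lborel) \<le> e2" if "\<bar>b\<bar> < d" for b
      using that e2 by (cases "b = 0") (auto intro: less_imp_le)
    then show thesis using that \<open>d > 0\<close> by blast
  qed
  \<comment> \<open>Ensures that \<open>d * b\<close> stays below \<open>d1\<close> for every
    translation \<open>b\<close> between 0 and \<open>L\<close>.\<close>
  define d0 where "d0 = d1 / (2 * L)"
  have d0: "d0 > 0" using d1 L by (simp add: d0_def)
  have main: "\<forall>\<^sub>F a in at_top. \<bar>Gker d (x - a *\<^sub>R ones) - lim_val * c0\<bar> \<le> e"
    if d: "0 < d" "d \<le> d0" for d x
  proof -
    let ?k = "\<lambda>s. d * vpk (d * s)"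
    have ki: "integrable lborel ?k" by (rule integrable_vpk_scaled[OF d(1)])
    have kb: "integrable lborel (\<lambda>s. ?k (s + b))" for b
      using lborel_integrable_real_affine[OF ki, of 1 b] by (simp add: add.commute)
    have ktr: "(\<integral>s. \<bar>?k (s + b) - ?k s\<bar> \<partial>lborel) \<le> e2" if "0 \<le> b" "b \<le> L" for b
    proof -
      have "d * b \<le> d0 * L" using d that by (intro mult_mono) auto
      also have "\<dots> < d1" using d1 L by (simp add: d0_def)
      finally have "\<bar>d * b\<bar> < d1" using d that by simp
      have "(\<integral>s. \<bar>?k (s + b) - ?k s\<bar> \<partial>lborel) = (\<integral>s. d * \<bar>vpk (d * s + d * b) - vpk (d * s)\<bar> \<partial>lborel)"
      proof -
        have "\<bar>d * u - d * v\<bar> = d * \<bar>u - v\<bar>" for u v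
          using abs_mult[of d "u - v"] d by (simp add: right_diff_distrib)
        then show ?thesis by (simp only: distrib_left)
      qed
      also have "\<dots> = (\<integral>s. \<bar>vpk (s + d * b) - vpk s\<bar> \<partial>lborel)"
        using lborel_integral_real_affine[of d "\<lambda>s. \<bar>vpk (s + d * b) - vpk s\<bar>" 0] d by simp
      also have "\<dots> \<le> e2" by (rule d1(2)) fact
      finally show ?thesis .
    qed
    \<comment> \<open>The smoothing of \<open>Gavg L\<close>. Exchanging the integrals moves the
      window average onto the kernel, as an average of its translates by lengths up to
      \<open>L\<close>.\<close>
    define JA where "JA = (\<lambda>x. \<integral>s. Gavg L (x + s *\<^sub>R ones) * ?k s \<partial>lborel)"
    have JG: "\<bar>JA x - Gker d x\<bar> \<le> e / 3" for x
    proof -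
      define W where "W = (\<lambda>s b. window L b * G (x + s *\<^sub>R ones - b *\<^sub>R ones) * ?k s)"
      have W [measurable]: "(\<lambda>p. W (fst p) (snd p)) \<in> borel_measurable (lborel \<Otimes>\<^sub>M lborel)"
        unfolding W_def by measurable
      have wi: "integrable lborel (\<lambda>b. window L b * G (x + s *\<^sub>R ones - b *\<^sub>R ones))" for s
        by (rule integrable_window_mult[OF _ G_bound]) measurable
      have Wi: "integrable (lborel \<Otimes>\<^sub>M lborel) (\<lambda>(s, b). W s b)"
      proof (rule lborel_pair.Fubini_integrable)
        have mes: "(\<lambda>s. \<integral>b. norm (W s b) \<partial>lborel) \<in> borel_measurable borel" by measurable
        have bd: "(\<integral>b. norm (W s b) \<partial>lborel) \<le> CG * L * \<bar>?k s\<bar>" for s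
        proof -
          have "(\<integral>b. norm (W s b) \<partial>lborel) \<le> (\<integral>b. (CG * \<bar>?k s\<bar>) * window L b \<partial>lborel)"
          proof (rule integral_mono)
            show "integrable lborel (\<lambda>b. norm (W s b))"
              unfolding W_def by (intro integrable_norm integrable_mult_left wi)
            show "integrable lborel (\<lambda>b. (CG * \<bar>?k s\<bar>) * window L b)"
              by (intro integrable_mult_right integrable_window)
            show "norm (W s b) \<le> (CG * \<bar>?k s\<bar>) * window L b" for b
              using window_cases[of L b] G_bound[of "x + s *\<^sub>R ones - b *\<^sub>R ones"]
              by (auto simp: W_def abs_mult intro!: mult_right_mono)
          qed
          also have "\<dots> = CG * L * \<bar>?k s\<bar>" using integral_window[of L] L by simp
          finally show ?thesis .
        qed
        have "integrable lborel (\<lambda>s. \<integral>b. norm (W s b) \<partial>lborel)"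
        proof (rule Bochner_Integration.integrable_bound[OF integrable_mult_right[OF integrable_abs[OF ki], of "CG * L"]])
          show "AE s in lborel. norm (\<integral>b. norm (W s b) \<partial>lborel) \<le> norm (CG * L * \<bar>?k s\<bar>)"
            using bd CG_nonneg L by (intro AE_I2) (simp add: abs_mult)
        qed (use mes in simp)
        then show "integrable lborel (\<lambda>s. \<integral>b. norm (case (s, b) of (s, b) \<Rightarrow> W s b) \<partial>lborel)" by simp
        show "AE s in lborel. integrable lborel (\<lambda>b. case (s, b) of (s, b) \<Rightarrow> W s b)"
          unfolding W_def prod.case by (intro AE_I2 integrable_mult_left wi)
      qed (use W in \<open>simp add: split_beta'\<close>)
      have gk: "integrable lborel (\<lambda>s. G (x + s *\<^sub>R ones) * k s)" if k: "integrable lborel k" for k :: "real \<Rightarrow> real"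
      proof (rule Bochner_Integration.integrable_bound[OF integrable_mult_right[OF k, of CG]])
        show "AE s in lborel. norm (G (x + s *\<^sub>R ones) * k s) \<le> norm (CG * k s)"
          using G_bound CG_nonneg by (intro AE_I2) (auto simp: abs_mult intro!: mult_right_mono)
      qed (use k in measurable)
      have "JA x * L = (\<integral>s. \<integral>b. W s b \<partial>lborel \<partial>lborel)"
        using L by (simp add: JA_def Gavg_def W_def)
      also have "\<dots> = (\<integral>b. \<integral>s. W s b \<partial>lborel \<partial>lborel)"
        by (rule lborel_pair.Fubini_integral[OF Wi, symmetric])
      also have "\<dots> = (\<integral>b. window L b * (\<integral>s. G (x + s *\<^sub>R ones) * ?k (s + b) \<partial>lborel) \<partial>lborel)"
      proof (rule Bochner_Integration.integral_cong[OF refl])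
        fix b
        have "(\<integral>s. W s b \<partial>lborel) = window L b * (\<integral>s. G (x + s *\<^sub>R ones - b *\<^sub>R ones) * ?k s \<partial>lborel)"
          by (simp add: W_def mult.assoc)
        also have "(\<integral>s. G (x + s *\<^sub>R ones - b *\<^sub>R ones) * ?k s \<partial>lborel) = (\<integral>s. G (x + s *\<^sub>R ones) * ?k (s + b) \<partial>lborel)"
          using lborel_integral_real_affine[of 1 "\<lambda>s. G (x + s *\<^sub>R ones - b *\<^sub>R ones) * ?k s" b]
          by (simp add: algebra_simps)
        finally show "(\<integral>s. W s b \<partial>lborel) = window L b * (\<integral>s. G (x + s *\<^sub>R ones) * ?k (s + b) \<partial>lborel)" .
      qed
      finally have JAL: "JA x * L = (\<integral>b. window L b * (\<integral>s. G (x + s *\<^sub>R ones) * ?k (s + b) \<partial>lborel) \<partial>lborel)" .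
      define D where "D = (\<lambda>b. (\<integral>s. G (x + s *\<^sub>R ones) * ?k (s + b) \<partial>lborel) - Gker d x)"
      have Dm [measurable]: "D \<in> borel_measurable borel" unfolding D_def by measurable
      have Deq: "D b = (\<integral>s. G (x + s *\<^sub>R ones) * (?k (s + b) - ?k s) \<partial>lborel)" for b
        unfolding D_def Gker_def right_diff_distrib
        by (rule Bochner_Integration.integral_diff[OF gk[OF kb] gk[OF ki], symmetric])
      have Db: "\<bar>D b\<bar> \<le> CG * (\<integral>s. \<bar>?k (s + b) - ?k s\<bar> \<partial>lborel)" for b
      proof -
        have kd: "integrable lborel (\<lambda>s. ?k (s + b) - ?k s)" by (intro Bochner_Integration.integrable_diff kb ki)
        have "\<bar>D b\<bar> \<le> (\<integral>s. CG * \<bar>?k (s + b) - ?k s\<bar> \<partial>lborel)"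
          unfolding Deq
        proof (rule order_trans[OF integral_abs_bound integral_mono])
          show "integrable lborel (\<lambda>s. \<bar>G (x + s *\<^sub>R ones) * (?k (s + b) - ?k s)\<bar>)"
            by (intro integrable_abs gk kd)
          show "integrable lborel (\<lambda>s. CG * \<bar>?k (s + b) - ?k s\<bar>)"
            by (intro integrable_mult_right integrable_abs kd)
          show "\<bar>G (x + s *\<^sub>R ones) * (?k (s + b) - ?k s)\<bar> \<le> CG * \<bar>?k (s + b) - ?k s\<bar>" for s
            unfolding abs_mult by (intro mult_right_mono G_bound) auto
        qed
        then show ?thesis by simp
      qed
      have kall: "(\<integral>s. \<bar>?k (s + b) - ?k s\<bar> \<partial>lborel) \<le> 2 * (\<integral>s. \<bar>?k s\<bar> \<partial>lborel)" for b
      proof -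
        have "(\<integral>s. \<bar>?k (s + b) - ?k s\<bar> \<partial>lborel) \<le> (\<integral>s. \<bar>?k (s + b)\<bar> + \<bar>?k s\<bar> \<partial>lborel)"
          by (intro integral_mono integrable_abs Bochner_Integration.integrable_diff
              Bochner_Integration.integrable_add kb ki abs_triangle_ineq4)
        also have "\<dots> = (\<integral>s. \<bar>?k (s + b)\<bar> \<partial>lborel) + (\<integral>s. \<bar>?k s\<bar> \<partial>lborel)"
          by (rule Bochner_Integration.integral_add[OF integrable_abs[OF kb] integrable_abs[OF ki]])
        also have "(\<integral>s. \<bar>?k (s + b)\<bar> \<partial>lborel) = (\<integral>s. \<bar>?k s\<bar> \<partial>lborel)"
          using lborel_integral_real_affine[of 1 "\<lambda>s. \<bar>?k s\<bar>" b] by (simp add: add.commute)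
        finally show ?thesis by simp
      qed
      have "JA x - Gker d x = (\<integral>b. window L b * D b \<partial>lborel) / L"
      proof -
        have D': "\<bar>(\<integral>s. G (x + s *\<^sub>R ones) * ?k (s + b) \<partial>lborel)\<bar> \<le> CG * (2 * (\<integral>s. \<bar>?k s\<bar> \<partial>lborel)) + \<bar>Gker d x\<bar>" for b
          using order_trans[OF Db[of b] mult_left_mono[OF kall[of b] CG_nonneg]] unfolding D_def by linarith
        have wi1: "integrable lborel (\<lambda>b. window L b * (\<integral>s. G (x + s *\<^sub>R ones) * ?k (s + b) \<partial>lborel))"
          by (rule integrable_window_mult[OF _ D']) measurable
        have wi2: "integrable lborel (\<lambda>b. window L b * Gker d x)"
          by (intro integrable_mult_left integrable_window)
        have "(\<integral>b. window L b * D b \<partial>lborel) = JA x * L - Gker d x * L"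
          unfolding D_def right_diff_distrib JAL
          using Bochner_Integration.integral_diff[OF wi1 wi2] integral_window[of L] L by simp
        then show ?thesis using L by (simp add: field_simps)
      qed
      also have "\<bar>\<dots>\<bar> \<le> CG * e2"
      proof (rule window_average_le[OF Dm _ L0])
        show "\<bar>D b\<bar> \<le> CG * (2 * (\<integral>s. \<bar>?k s\<bar> \<partial>lborel))" for b
          by (rule order_trans[OF Db mult_left_mono[OF kall CG_nonneg]])
        show "\<bar>D b\<bar> \<le> CG * e2" if "0 \<le> b" "b \<le> L" for b
          by (rule order_trans[OF Db mult_left_mono[OF ktr[OF that] CG_nonneg]])
      qed
      also have "\<dots> \<le> (CG + 1) * e2" using e2 by (intro mult_right_mono) auto
      also have "\<dots> = e / 3"
        unfolding e2_def mult.commute[of "CG + 1"] by (rule mult_third) (use CG_nonneg in linarith)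
      finally show ?thesis .
    qed
    \<comment> \<open>For \<open>\<bar>s\<bar> \<le> a - \<phi> x\<close> the shifted point has
      \<open>\<phi>\<close> at most 0, where \<open>Gavg L\<close> is within \<open>e1\<close> of
      the limit. Beyond that range the crude bound \<open>B\<close> meets a tail of the kernel that
      vanishes as \<open>a\<close> grows.\<close>
    define B where "B = CG + \<bar>lim_val\<bar>"
    have "((\<lambda>a. B * tail (d * (a - \<phi> x))) \<longlongrightarrow> B * 0) at_top"
    proof (intro tendsto_mult tendsto_const filterlim_compose[OF vpk_tail])
      have "filterlim (\<lambda>a. - \<phi> x + a) at_top at_top"
        by (rule filterlim_tendsto_add_at_top[OF tendsto_const filterlim_ident])
      then show "filterlim (\<lambda>a. d * (a - \<phi> x)) at_top at_top"
        using filterlim_tendsto_pos_mult_at_top[OF tendsto_const d(1)] by (simp add: add.commute)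
    qed
    then have "\<forall>\<^sub>F a in at_top. B * tail (d * (a - \<phi> x)) < e / 3"
      using assms by (intro order_tendstoD) auto
    then show ?thesis
      using eventually_ge_at_top[of "\<phi> x"]
    proof eventually_elim
      case (elim a)
      have "\<bar>JA (x - a *\<^sub>R ones) - lim_val * c0\<bar> \<le> e1 * c1 + B * tail (d * (a - \<phi> x))"
        unfolding JA_def
      proof (rule vpk_approx[OF d(1)])
        show "0 \<le> a - \<phi> x" using elim by simp
        show "\<bar>Gavg L (x - a *\<^sub>R ones + s *\<^sub>R ones) - lim_val\<bar> \<le> B" for s
          using Gavg_bound[OF L0, of "x - a *\<^sub>R ones + s *\<^sub>R ones"] unfolding B_def by linarith
        show "\<bar>Gavg L (x - a *\<^sub>R ones + s *\<^sub>R ones) - lim_val\<bar> \<le> e1" if "\<bar>s\<bar> \<le> a - \<phi> x" for s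
          using that by (intro L(2)) (simp add: topical_funD_add[OF \<phi>_top] topical_funD_diff[OF \<phi>_top])
      qed (use e1 in auto)
      then show ?case using JG[of "x - a *\<^sub>R ones"] elim e1c by linarith
    qed
  qed
  show ?thesis using d0 main by blast
qed

end

subsection \<open>Fourier analysis under weak non arithmeticity\<close>

lemma norm_cis_diff_le: "cmod (cis a - cis b) \<le> \<bar>a - b\<bar>"
proof -
  have "cis a - cis b = cis b * (cis (a - b) - 1)"
    by (simp add: right_diff_distrib cis_mult)
  then have "cmod (cis a - cis b) = cmod (cis (a - b) - 1)" by (simp add: norm_mult)
  also have "\<dots> = 2 * \<bar>sin ((a - b) / 2)\<bar>"
    using dist_exp_i_1[of "a - b"] by (simp add: cis_conv_exp)
  also have "\<dots> \<le> 2 * \<bar>(a - b) / 2\<bar>" by (intro mult_left_mono abs_sin_x_le_abs_x) auto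
  finally show ?thesis by simp
qed

text \<open>The step is applied with \<open>N\<close> the supremum of \<open>f\<close>, finite by
  the a priori bound, and half of that supremum is absorbed on the left.\<close>

lemma bounded_absorb_half:
  fixes f :: "'b \<Rightarrow> real"
  assumes bdd: "\<And>x. f x \<le> N0" and step: "\<And>N x. (\<And>y. f y \<le> N) \<Longrightarrow> f x \<le> a + N / 2"
  shows "f x \<le> 2 * a"
proof -
  have b: "bdd_above (range f)" by (rule bdd_aboveI2[of _ f N0]) (rule bdd)
  have le: "f x \<le> (SUP y. f y)" for x by (rule cSUP_upper[OF _ b]) simp
  have "(SUP y. f y) \<le> a + (SUP y. f y) / 2"
    by (rule cSUP_least) (auto intro: step le)
  then show ?thesis using le[of x] by linarith
qed

text \<open>Exchanges the frequency integral with the integral over \<open>N\<close>. As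
  \<open>W\<close> and \<open>u\<close> are real, the real part turns the exponential into a
  cosine.\<close>

lemma fourier_fubini:
  fixes W :: "'b \<Rightarrow> real" and u :: "real \<Rightarrow> real"
  assumes N: "sigma_finite_measure N" and W: "integrable N W" and u: "integrable lborel u"
    and s [measurable]: "s \<in> borel_measurable N"
  shows "integrable lborel (\<lambda>t. of_real (u t) * (\<integral>z. of_real (W z) * cis (- (t * s z)) \<partial>N))"
    and "Re (\<integral>t. of_real (u t) * (\<integral>z. of_real (W z) * cis (- (t * s z)) \<partial>N) \<partial>lborel)
      = (\<integral>z. W z * (\<integral>t. u t * cos (t * s z) \<partial>lborel) \<partial>N)"
proof -
  interpret N: sigma_finite_measure N by fact
  interpret LN: pair_sigma_finite "lborel :: real measure" N ..
  have [measurable]: "W \<in> borel_measurable N" "u \<in> borel_measurable lborel" using W u by auto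
  define F where "F = (\<lambda>t z. complex_of_real (u t) * (of_real (W z) * cis (- (t * s z))))"
  have Fi: "integrable (lborel \<Otimes>\<^sub>M N) (\<lambda>(t, z). F t z)"
  proof (rule LN.Fubini_integrable)
    show "(\<lambda>(t, z). F t z) \<in> borel_measurable (lborel \<Otimes>\<^sub>M N)" unfolding F_def by measurable
    have "integrable lborel (\<lambda>t. \<bar>u t\<bar> * (\<integral>z. \<bar>W z\<bar> \<partial>N))" using u by (intro integrable_mult_left integrable_abs)
    then show "integrable lborel (\<lambda>t. \<integral>z. norm (case (t, z) of (t, z) \<Rightarrow> F t z) \<partial>N)"
      by (simp add: F_def norm_mult)
    have "integrable N (F t)" for t
    proof (rule Bochner_Integration.integrable_bound[OF integrable_mult_right[OF W, of "u t"]])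
      show "AE z in N. norm (F t z) \<le> norm (u t * W z)" by (simp add: F_def norm_mult abs_mult)
    qed (unfold F_def, measurable)
    then show "AE t in lborel. integrable N (\<lambda>z. case (t, z) of (t, z) \<Rightarrow> F t z)" by simp
  qed
  have eq: "of_real (u t) * (\<integral>z. of_real (W z) * cis (- (t * s z)) \<partial>N) = (\<integral>z. F t z \<partial>N)" for t
    unfolding F_def by simp
  show "integrable lborel (\<lambda>t. of_real (u t) * (\<integral>z. of_real (W z) * cis (- (t * s z)) \<partial>N))"
    unfolding eq using LN.integrable_fst[OF Fi] .
  have "(\<integral>t. \<integral>z. F t z \<partial>N \<partial>lborel) = (\<integral>z. \<integral>t. F t z \<partial>lborel \<partial>N)"
    by (rule LN.Fubini_integral[OF Fi, symmetric])
  then have "Re (\<integral>t. \<integral>z. F t z \<partial>N \<partial>lborel) = (\<integral>z. Re (\<integral>t. F t z \<partial>lborel) \<partial>N)"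
    using integral_Re[OF LN.integrable_snd[OF Fi]] by simp
  also have "\<dots> = (\<integral>z. W z * (\<integral>t. u t * cos (t * s z) \<partial>lborel) \<partial>N)"
  proof (rule Bochner_Integration.integral_cong[OF refl])
    fix z
    have i: "integrable lborel (\<lambda>t. of_real (u t) * cis (- (t * s z)))"
    proof (rule Bochner_Integration.integrable_bound[OF u])
      show "AE t in lborel. norm (of_real (u t) * cis (- (t * s z))) \<le> norm (u t)" by (simp add: norm_mult)
    qed measurable
    have "(\<integral>t. F t z \<partial>lborel) = of_real (W z) * (\<integral>t. of_real (u t) * cis (- (t * s z)) \<partial>lborel)"
      unfolding F_def by (subst integral_mult_right_zero[symmetric]) (simp add: ac_simps)
    then have "Re (\<integral>t. F t z \<partial>lborel) = W z * Re (\<integral>t. of_real (u t) * cis (- (t * s z)) \<partial>lborel)" by simp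
    also have "Re (\<integral>t. of_real (u t) * cis (- (t * s z)) \<partial>lborel) = (\<integral>t. u t * cos (t * s z) \<partial>lborel)"
      using integral_Re[OF i] by simp
    finally show "Re (\<integral>t. F t z \<partial>lborel) = W z * (\<integral>t. u t * cos (t * s z) \<partial>lborel)" .
  qed
  finally show "Re (\<integral>t. of_real (u t) * (\<integral>z. of_real (W z) * cis (- (t * s z)) \<partial>N) \<partial>lborel)
      = (\<integral>z. W z * (\<integral>t. u t * cos (t * s z) \<partial>lborel) \<partial>N)" unfolding eq .
qed

section \<open>Twisted transition operators\<close>

context topical_walk
begin

definition Dsp :: "(real^'d \<Rightarrow> complex) set" where
  "Dsp = {f. continuous_on UNIV f \<and> bounded (range f) \<and> proj_inv f}"

text \<open>The Fourier twist of the transition operator by the increment of \<open>\<phi>\<close>.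
  It corresponds to \<open>Qt\<close> under composition with \<open>jmap\<close>, as shown in
  \<open>Qt_eq\<close>.\<close>

definition Pt :: "real \<Rightarrow> (real^'d \<Rightarrow> complex) \<Rightarrow> real^'d \<Rightarrow> complex" where
  "Pt t f x = (\<integral>b. cis (t * (\<phi> (T b x) - \<phi> x)) * f (T b x) \<partial>M)"

lemma DspD:
  assumes "f \<in> Dsp"
  shows "continuous_on UNIV f" "f \<in> borel_measurable borel" "\<exists>B. \<forall>x. cmod (f x) \<le> B"
  using assms by (auto simp: Dsp_def bounded_iff intro: borel_measurable_continuous_onI)

lemma Dsp_diff: "f \<in> Dsp \<Longrightarrow> g \<in> Dsp \<Longrightarrow> (\<lambda>x. f x - g x) \<in> Dsp"
  unfolding Dsp_def by (auto intro: continuous_on_diff bounded_minus_comp simp: proj_inv_def)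

lemma integrable_Pt:
  assumes f: "f \<in> Dsp"
  shows "integrable M (\<lambda>b. cis (t * (\<phi> (T b x) - \<phi> x)) * f (T b x))"
proof -
  note DspD(2)[OF f, measurable]
  obtain B where "\<And>x. cmod (f x) \<le> B" using DspD(3)[OF f] by blast
  then show ?thesis by (intro integrable_const_bound[of _ B]) (auto simp: norm_mult)
qed

lemma Pt_diff:
  assumes "f \<in> Dsp" "g \<in> Dsp"
  shows "Pt t (\<lambda>x. f x - g x) x = Pt t f x - Pt t g x"
  unfolding Pt_def
  using integrable_Pt[OF assms(1)] integrable_Pt[OF assms(2)] by (simp add: right_diff_distrib)

lemma integrable_Pt_chain:
  assumes f: "f \<in> Dsp"
  shows "integrable S (\<lambda>\<omega>. cis (t * (\<phi> (X n \<omega> x) - c)) * f (X n \<omega> x))"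
proof -
  note DspD(2)[OF f, measurable]
  obtain B where "\<And>x. cmod (f x) \<le> B" using DspD(3)[OF f] by blast
  then show ?thesis by (intro seq.P.integrable_const_bound[of _ B]) (auto simp: norm_mult)
qed

text \<open>The phases of successive increments multiply to the phase of the total increment; the
  induction splits off the first noise and applies the hypothesis from the position it leads
  to.\<close>

lemma Pt_pow:
  assumes f: "f \<in> Dsp"
  shows "(Pt t ^^ n) f x = (\<integral>\<omega>. cis (t * (\<phi> (X n \<omega> x) - \<phi> x)) * f (X n \<omega> x) \<partial>S)"
proof (induction n arbitrary: x)
  case 0
  show ?case by (simp add: seq.P.prob_space)
next
  case (Suc n)
  note DspD(2)[OF f, measurable]
  define F where "F = (\<lambda>b. cis (t * (\<phi> (T b x) - \<phi> x)) * (Pt t ^^ n) f (T b x))"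
  have Fm [measurable]: "F \<in> borel_measurable M" unfolding F_def Suc by measurable
  have inner: "(\<integral>\<omega>'. cis (t * (\<phi> (X n \<omega>' y) - \<phi> x)) * f (X n \<omega>' y) \<partial>S)
      = cis (t * (\<phi> y - \<phi> x)) * (Pt t ^^ n) f y" for y
  proof -
    have "cis (t * (\<phi> (X n \<omega>' y) - \<phi> x)) = cis (t * (\<phi> y - \<phi> x)) * cis (t * (\<phi> (X n \<omega>' y) - \<phi> y))" for \<omega>'
      by (simp add: cis_mult algebra_simps)
    then show ?thesis unfolding Suc by (simp add: mult.assoc)
  qed
  have one: "X (Suc n) (comb_seq 1 \<omega> \<omega>') x = X n \<omega>' (T (\<omega> 0) x)" for \<omega> \<omega>'
    using chain_add_comb_seq[of T 1 n \<omega> \<omega>' x] by simp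
  have "(\<integral>\<omega>. cis (t * (\<phi> (X (Suc n) \<omega> x) - \<phi> x)) * f (X (Suc n) \<omega> x) \<partial>S)
     = (\<integral>\<omega>. \<integral>\<omega>'. cis (t * (\<phi> (X n \<omega>' (T (\<omega> 0) x)) - \<phi> x)) * f (X n \<omega>' (T (\<omega> 0) x)) \<partial>S \<partial>S)"
    using integral_comb_seq(1)[OF integrable_Pt_chain[OF f, of t "Suc n" x "\<phi> x"], where n=1]
    by (simp only: one)
  also have "\<dots> = (\<integral>\<omega>. F (\<omega> 0) \<partial>S)" by (simp add: inner F_def)
  also have "\<dots> = (\<integral>b. F b \<partial>M)" by (rule integral_nth(1)) measurable
  also have "\<dots> = (Pt t ^^ Suc n) f x" by (simp add: F_def Pt_def)
  finally show ?case ..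
qed

lemma Pt_pow_bound:
  assumes f: "f \<in> Dsp" and B: "\<And>x. cmod (f x) \<le> B"
  shows "cmod ((Pt t ^^ n) f x) \<le> B"
proof -
  have "cmod ((Pt t ^^ n) f x) \<le> (\<integral>\<omega>. B \<partial>S)"
    unfolding Pt_pow[OF f]
    by (rule order_trans[OF integral_norm_bound integral_mono])
      (use integrable_norm[OF integrable_Pt_chain[OF f, of t n x "\<phi> x"]] B in \<open>auto simp: norm_mult\<close>)
  then show ?thesis by (simp add: seq.P.prob_space)
qed

lemma Pt_pow_diff:
  assumes "f \<in> Dsp" "g \<in> Dsp"
  shows "(Pt t ^^ n) (\<lambda>x. f x - g x) x = (Pt t ^^ n) f x - (Pt t ^^ n) g x"
  unfolding Pt_pow[OF assms(1)] Pt_pow[OF assms(2)] Pt_pow[OF Dsp_diff[OF assms]]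
  using integrable_Pt_chain[OF assms(1)] integrable_Pt_chain[OF assms(2)] by (simp add: right_diff_distrib)

end

text \<open>Weak non arithmeticity in a form free of suprema: operator norm bounds are expressed by
  pointwise bounds \<open>B\<close>, and invertibility is split into solvability and a lower bound
  for \<open>Id - Pt t\<close>.\<close>

locale renewal_wna = renewal_test M T \<phi> m \<gamma> \<nu>0 h K H
  for M :: "'w measure" and T :: "'w \<Rightarrow> real^'d \<Rightarrow> real^'d" and \<phi> m \<gamma> and \<nu>0 :: "(real^'d) measure"
    and h K H +
  assumes Pt_Dsp: "\<And>t f. f \<in> Dsp \<Longrightarrow> Pt t f \<in> Dsp"
    and Pt_cont: "\<And>t0 e. e > 0 \<Longrightarrow> \<exists>d>0. \<forall>t. \<bar>t - t0\<bar> < d \<longrightarrow>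
       (\<forall>f\<in>Dsp. \<forall>B. (\<forall>x. cmod (f x) \<le> B) \<longrightarrow> (\<forall>x. cmod (Pt t f x - Pt t0 f x) \<le> e * B))"
    and Pt_surj: "\<And>t g. t \<noteq> 0 \<Longrightarrow> g \<in> Dsp \<Longrightarrow> \<exists>f\<in>Dsp. \<forall>x. f x - Pt t f x = g x"
    and Pt_inv: "\<And>t. t \<noteq> 0 \<Longrightarrow> \<exists>C. \<forall>f\<in>Dsp. \<forall>B. (\<forall>x. cmod (f x - Pt t f x) \<le> B) \<longrightarrow>
       (\<forall>x. cmod (f x) \<le> C * B)"
begin

text \<open>Says that the inverse of \<open>Id - Pt t\<close> has norm at most \<open>C\<close>,
  written as a lower bound so that the inverse itself need not be named.\<close>

definition inv_bound :: "real \<Rightarrow> real \<Rightarrow> bool" where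
  "inv_bound C t \<longleftrightarrow> (\<forall>f\<in>Dsp. \<forall>B. (\<forall>x. cmod (f x - Pt t f x) \<le> B) \<longrightarrow> (\<forall>x. cmod (f x) \<le> C * B))"

lemma inv_boundD: "inv_bound C t \<Longrightarrow> f \<in> Dsp \<Longrightarrow> (\<And>x. cmod (f x - Pt t f x) \<le> B) \<Longrightarrow> cmod (f x) \<le> C * B"
  by (auto simp: inv_bound_def)

lemma inv_bound_mono: "inv_bound C t \<Longrightarrow> C \<le> C' \<Longrightarrow> inv_bound C' t"
  unfolding inv_bound_def
proof (intro ballI allI impI)
  fix f B x assume a: "\<forall>f\<in>Dsp. \<forall>B. (\<forall>x. cmod (f x - Pt t f x) \<le> B) \<longrightarrow> (\<forall>x. cmod (f x) \<le> C * B)"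
    "C \<le> C'" "f \<in> Dsp" "\<forall>x. cmod (f x - Pt t f x) \<le> B"
  have "0 \<le> B" using a(4) norm_ge_zero order_trans by blast
  then have "C * B \<le> C' * B" using a(2) by (rule mult_right_mono[rotated])
  then show "cmod (f x) \<le> C' * B" using a by (blast intro: order_trans)
qed

text \<open>If \<open>Pt t\<close> differs from \<open>Pt t0\<close> by at most
  \<open>1 / (2 * C)\<close> in norm, the perturbation consumes half of \<open>f\<close> at most and
  is absorbed; the constant doubles.\<close>

lemma inv_bound_local:
  assumes "t0 \<noteq> 0"
  shows "\<exists>d>0. \<exists>C. \<forall>t. \<bar>t - t0\<bar> < d \<longrightarrow> inv_bound C t"
proof -
  obtain C0 where "inv_bound C0 t0" using Pt_inv[OF assms] by (auto simp: inv_bound_def)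
  then have C1: "inv_bound (max C0 1) t0" by (rule inv_bound_mono) simp
  define C where "C = max C0 1"
  have C: "C \<ge> 1" "inv_bound C t0" using C1 by (simp_all add: C_def)
  obtain d where d: "d > 0" "\<And>t f B x. \<bar>t - t0\<bar> < d \<Longrightarrow> f \<in> Dsp \<Longrightarrow> (\<And>x. cmod (f x) \<le> B) \<Longrightarrow>
      cmod (Pt t f x - Pt t0 f x) \<le> 1 / (2 * C) * B"
    using Pt_cont[of "1 / (2 * C)" t0] C by auto
  have "inv_bound (2 * C) t" if t: "\<bar>t - t0\<bar> < d" for t
    unfolding inv_bound_def
  proof (intro ballI allI impI)
    fix f B x assume f: "f \<in> Dsp" and B: "\<forall>x. cmod (f x - Pt t f x) \<le> B"
    obtain N0 where N0: "\<And>x. cmod (f x) \<le> N0" using DspD(3)[OF f] by blast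
    have "cmod (f x) \<le> 2 * (C * B)"
    proof (rule bounded_absorb_half[where f="\<lambda>x. cmod (f x)", OF N0])
      fix N x assume N: "\<And>y. cmod (f y) \<le> N"
      have "cmod (f y - Pt t0 f y) \<le> B + 1 / (2 * C) * N" for y
      proof -
        have eq: "f y - Pt t0 f y = (f y - Pt t f y) + (Pt t f y - Pt t0 f y)" by simp
        show ?thesis
          unfolding eq
          by (rule order_trans[OF norm_triangle_ineq add_mono[OF B[rule_format] d(2)[OF t f N]]])
      qed
      then have "cmod (f x) \<le> C * (B + 1 / (2 * C) * N)" by (rule inv_boundD[OF C(2) f])
      also have "\<dots> = C * B + N / 2" using C(1) by (simp add: distrib_left)
      finally show "cmod (f x) \<le> C * B + N / 2" .
    qed
    then show "cmod (f x) \<le> 2 * C * B" by simp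
  qed
  then show ?thesis using d(1) by blast
qed

text \<open>The admissible frequencies form a compact set avoiding 0, and finitely many local bounds
  cover it.\<close>

lemma inv_bound_compact:
  assumes "0 < \<delta>"
  shows "\<exists>C\<ge>0. \<forall>t. \<delta> \<le> \<bar>t\<bar> \<longrightarrow> \<bar>t\<bar> \<le> R \<longrightarrow> inv_bound C t"
proof -
  define A where "A = {-R..-\<delta>} \<union> {\<delta>..R}"
  have A: "compact A" unfolding A_def by (intro compact_Un compact_Icc)
  have nz: "t \<noteq> 0" if "t \<in> A" for t using that assms by (auto simp: A_def)
  have "\<forall>t\<in>A. \<exists>d C. d > 0 \<and> (\<forall>t'. \<bar>t' - t\<bar> < d \<longrightarrow> inv_bound C t')"
    using inv_bound_local[OF nz] by blast
  then obtain d C where dC: "\<And>t. t \<in> A \<Longrightarrow> d t > 0"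
      "\<And>t t'. t \<in> A \<Longrightarrow> \<bar>t' - t\<bar> < d t \<Longrightarrow> inv_bound (C t) t'"
    by metis
  have cover: "A \<subseteq> (\<Union>t\<in>A. ball t (d t))" using dC(1) by force
  obtain F where F: "F \<subseteq> A" "finite F" "A \<subseteq> (\<Union>t\<in>F. ball t (d t))"
    by (rule compactE_image[OF A _ cover]) auto
  define C' where "C' = (\<Sum>t\<in>F. \<bar>C t\<bar>)"
  have "inv_bound C' t" if "\<delta> \<le> \<bar>t\<bar>" "\<bar>t\<bar> \<le> R" for t
  proof -
    have "t \<in> A" using that by (auto simp: A_def abs_if split: if_splits)
    then obtain t0 where t0: "t0 \<in> F" "\<bar>t - t0\<bar> < d t0" using F(3) by (auto simp: dist_real_def abs_minus_commute)
    have "inv_bound (C t0) t" using dC(2)[of t0 t] t0 F(1) by auto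
    moreover have "C t0 \<le> C'"
      unfolding C'_def using member_le_sum[of t0 F "\<lambda>t. \<bar>C t\<bar>"] t0 F(2) by auto
    ultimately show ?thesis by (rule inv_bound_mono)
  qed
  moreover have "0 \<le> C'" by (simp add: C'_def sum_nonneg)
  ultimately show ?thesis by blast
qed

text \<open>The Fourier transform of \<open>h\<close> along the fibre through \<open>x\<close>. The
  parameter \<open>s\<close> is the value of \<open>\<phi>\<close> at the point concerned, so the
  transform depends on the class only.\<close>

definition hhat :: "real \<Rightarrow> real^'d \<Rightarrow> complex" where
  "hhat t x = (\<integral>s. of_real (h (x + (s - \<phi> x) *\<^sub>R ones)) * cis (- (t * s)) \<partial>lborel)"

definition Hh :: real where "Hh = H * (2 * K)"

lemma Hh_nonneg: "0 \<le> Hh"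
  using H_nonneg K_nonneg by (simp add: Hh_def)

lemma h_centred_line: "\<bar>h (x + (s - \<phi> x) *\<^sub>R ones)\<bar> \<le> H * indicator {- K..K} s"
proof -
  have "indicator {- K - \<phi> x..K - \<phi> x} (s - \<phi> x) = (indicator {- K..K} s :: real)"
    by (auto simp: indicator_def)
  then show ?thesis using h_line[of x "s - \<phi> x"] by simp
qed

lemma integrable_hhat: "integrable lborel (\<lambda>s. of_real (h (x + (s - \<phi> x) *\<^sub>R ones)) * cis (- (t * s)))"
proof (rule Bochner_Integration.integrable_bound[OF integrable_mult_indicator_Icc])
  show "AE s in lborel. norm (of_real (h (x + (s - \<phi> x) *\<^sub>R ones)) * cis (- (t * s))) \<le> norm (H * indicator {- K..K} s)"
    using h_centred_line[of x] H_nonneg by (intro AE_I2) (simp add: norm_mult)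
qed measurable

lemma hhat_bound: "cmod (hhat t x) \<le> Hh"
proof -
  have "cmod (hhat t x) \<le> (\<integral>s. H * indicator {- K..K} s \<partial>lborel)"
    unfolding hhat_def
  proof (rule order_trans[OF integral_norm_bound integral_mono])
    show "integrable lborel (\<lambda>s. norm (complex_of_real (h (x + (s - \<phi> x) *\<^sub>R ones)) * cis (- (t * s))))"
      by (intro integrable_norm integrable_hhat)
  qed (use h_centred_line[of x] integrable_mult_indicator_Icc in \<open>auto simp: norm_mult\<close>)
  then show ?thesis using K_nonneg by (simp add: Hh_def)
qed

lemma hhat_lipschitz: "cmod (hhat t x - hhat t0 x) \<le> \<bar>t - t0\<bar> * (K * Hh)"
proof -
  have "hhat t x - hhat t0 x = (\<integral>s. of_real (h (x + (s - \<phi> x) *\<^sub>R ones)) * cis (- (t * s))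
      - of_real (h (x + (s - \<phi> x) *\<^sub>R ones)) * cis (- (t0 * s)) \<partial>lborel)"
    unfolding hhat_def by (rule Bochner_Integration.integral_diff[OF integrable_hhat integrable_hhat, symmetric])
  also have "cmod \<dots> \<le> (\<integral>s. (\<bar>t - t0\<bar> * K * H) * indicator {- K..K} s \<partial>lborel)"
  proof (rule order_trans[OF integral_norm_bound integral_mono])
    show "integrable lborel (\<lambda>s. norm (complex_of_real (h (x + (s - \<phi> x) *\<^sub>R ones)) * cis (- (t * s))
      - of_real (h (x + (s - \<phi> x) *\<^sub>R ones)) * cis (- (t0 * s))))"
      by (intro integrable_norm Bochner_Integration.integrable_diff integrable_hhat)
    show "integrable lborel (\<lambda>s. (\<bar>t - t0\<bar> * K * H) * indicator {- K..K} s)"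
      by (rule integrable_mult_indicator_Icc)
    fix s
    let ?h = "h (x + (s - \<phi> x) *\<^sub>R ones)"
    have "norm (complex_of_real ?h * cis (- (t * s)) - of_real ?h * cis (- (t0 * s)))
      = \<bar>?h\<bar> * cmod (cis (- (t * s)) - cis (- (t0 * s)))"
      by (simp add: right_diff_distrib[symmetric] norm_mult)
    also have "\<dots> \<le> (H * indicator {- K..K} s) * (\<bar>t - t0\<bar> * \<bar>s\<bar>)"
    proof (rule mult_mono[OF h_centred_line])
      show "cmod (cis (- (t * s)) - cis (- (t0 * s))) \<le> \<bar>t - t0\<bar> * \<bar>s\<bar>"
        using norm_cis_diff_le[of "- (t * s)" "- (t0 * s)"] abs_mult[of "t0 - t" s]
        by (simp add: left_diff_distrib abs_minus_commute)
    qed (use H_nonneg in auto)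
    also have "\<dots> \<le> (\<bar>t - t0\<bar> * K * H) * indicator {- K..K} s"
    proof (cases "s \<in> {-K..K}")
      case True
      then have "\<bar>s\<bar> \<le> K" by auto
      then have "H * (\<bar>t - t0\<bar> * \<bar>s\<bar>) \<le> H * (\<bar>t - t0\<bar> * K)"
        by (intro mult_left_mono H_nonneg) auto
      then show ?thesis using True by (simp add: ac_simps)
    qed simp
    finally show "norm (complex_of_real ?h * cis (- (t * s)) - of_real ?h * cis (- (t0 * s)))
      \<le> (\<bar>t - t0\<bar> * K * H) * indicator {- K..K} s" .
  qed
  also have "\<dots> = \<bar>t - t0\<bar> * (K * Hh)" using K_nonneg by (simp add: Hh_def)
  finally show ?thesis .
qed

lemma hhat_Dsp: "hhat t \<in> Dsp"
proof -
  have "continuous_on UNIV (hhat t)"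
  proof (rule continuous_on_sequentiallyI)
    fix u a assume u: "(u :: nat \<Rightarrow> real^'d) \<longlonglongrightarrow> a"
    have hc: "isCont h y" "isCont \<phi> y" for y
      using h_cont topical_fun_continuous[OF \<phi>_top] by (auto simp: continuous_on_eq_continuous_at)
    show "(\<lambda>n. hhat t (u n)) \<longlonglongrightarrow> hhat t a"
      unfolding hhat_def
    proof (rule integral_dominated_convergence[where w="\<lambda>s. H * indicator {- K..K} s"])
      show "AE s in lborel. (\<lambda>n. complex_of_real (h (u n + (s - \<phi> (u n)) *\<^sub>R ones)) * cis (- (t * s)))
          \<longlonglongrightarrow> complex_of_real (h (a + (s - \<phi> a) *\<^sub>R ones)) * cis (- (t * s))"
        by (intro AE_I2 tendsto_intros isCont_tendsto_compose[OF hc(1)] isCont_tendsto_compose[OF hc(2)] u)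
      show "integrable lborel (\<lambda>s. H * indicator {- K..K} s)" by (rule integrable_mult_indicator_Icc)
      show "AE s in lborel. norm (complex_of_real (h (u n + (s - \<phi> (u n)) *\<^sub>R ones)) * cis (- (t * s)))
          \<le> H * indicator {- K..K} s" for n
        using h_centred_line[of "u n"] by (intro AE_I2) (simp add: norm_mult)
    qed measurable
  qed
  moreover have "proj_inv (hhat t)"
    unfolding proj_inv_def hhat_def
    by (simp add: topical_funD_add[OF \<phi>_top] add.assoc scaleR_add_left[symmetric])
  moreover have "bounded (range (hhat t))"
    using hhat_bound by (auto simp: bounded_iff)
  ultimately show ?thesis by (simp add: Dsp_def)
qed

text \<open>The resolvent applied to \<open>hhat t\<close>, formally the series of all
  \<open>Pt t ^^ n\<close> applied to \<open>hhat t\<close>, which is the Fourier transform of the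
  renewal functional along the fibre up to a phase.\<close>

definition sol :: "real \<Rightarrow> real^'d \<Rightarrow> complex" where
  "sol t = (SOME f. f \<in> Dsp \<and> (\<forall>x. f x - Pt t f x = hhat t x))"

lemma sol: "t \<noteq> 0 \<Longrightarrow> sol t \<in> Dsp" "t \<noteq> 0 \<Longrightarrow> sol t x - Pt t (sol t) x = hhat t x"
proof -
  have "sol t \<in> Dsp \<and> (\<forall>x. sol t x - Pt t (sol t) x = hhat t x)" if "t \<noteq> 0"
    unfolding sol_def using someI_ex[of "\<lambda>f. f \<in> Dsp \<and> (\<forall>x. f x - Pt t f x = hhat t x)"]
      Pt_surj[OF that hhat_Dsp] by blast
  then show "t \<noteq> 0 \<Longrightarrow> sol t \<in> Dsp" "t \<noteq> 0 \<Longrightarrow> sol t x - Pt t (sol t) x = hhat t x" by auto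
qed

text \<open>Applying \<open>Id - Pt t\<close> to the difference of two solutions gives the
  difference of the right sides plus the variation of \<open>Pt\<close> at the fixed function
  \<open>sol t0\<close>. Both are small near \<open>t0\<close>, and the local bound on the inverse
  is uniform.\<close>

lemma isCont_sol:
  assumes "t0 \<noteq> 0"
  shows "isCont (\<lambda>t. sol t x) t0"
  unfolding continuous_at_eps_delta
proof (intro allI impI)
  fix e :: real assume e: "e > 0"
  obtain d1 C0 where d1: "d1 > 0" "\<And>t. \<bar>t - t0\<bar> < d1 \<Longrightarrow> inv_bound C0 t"
    using inv_bound_local[OF assms] by blast
  define C where "C = \<bar>C0\<bar> + 1"
  have C: "C > 0" by (simp add: C_def)
  have Cb: "inv_bound C t" if "\<bar>t - t0\<bar> < d1" for t
    by (rule inv_bound_mono[OF d1(2)[OF that]]) (simp add: C_def)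
  obtain N0 where "\<And>x. cmod (sol t0 x) \<le> N0" using DspD(3)[OF sol(1)[OF assms]] by blast
  then have N: "cmod (sol t0 x) \<le> \<bar>N0\<bar> + 1" for x by (meson abs_ge_self add_increasing2 order_trans zero_le_one)
  define N where "N = \<bar>N0\<bar> + 1"
  have N0: "N > 0" by (simp add: N_def)
  define e1 where "e1 = e / (3 * C * N)"
  have e1: "e1 > 0" using e C N0 by (simp add: e1_def)
  obtain d2 where d2: "d2 > 0" "\<And>t f B x. \<bar>t - t0\<bar> < d2 \<Longrightarrow> f \<in> Dsp \<Longrightarrow> (\<And>x. cmod (f x) \<le> B) \<Longrightarrow>
      cmod (Pt t f x - Pt t0 f x) \<le> e1 * B"
    using Pt_cont[OF e1, of t0] by auto
  define Q where "Q = K * Hh + 1"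
  have Q: "Q > 0" using K_nonneg Hh_nonneg by (simp add: Q_def add_nonneg_pos)
  \<comment> \<open>The entry \<open>\<bar>t0\<bar>\<close> keeps \<open>t\<close> away from 0. The
    other entries give the inverse bound and make each of two error terms at most
    \<open>e / (3 * C)\<close>, for a total of \<open>2 * e / 3\<close>.\<close>
  define d where "d = Min {d1, d2, \<bar>t0\<bar>, e / (3 * C * Q)}"
  have d: "d > 0" "d \<le> d1" "d \<le> d2" "d \<le> \<bar>t0\<bar>" "d \<le> e / (3 * C * Q)"
    using d1 d2 assms e C Q by (auto simp: d_def)
  have "cmod (sol t x - sol t0 x) < e" if t: "\<bar>t - t0\<bar> < d" for t
  proof -
    have t0: "t \<noteq> 0" using t d(4) by auto
    note D = sol(1)[OF t0] sol(1)[OF assms]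
    have "cmod ((sol t y - sol t0 y) - Pt t (\<lambda>y. sol t y - sol t0 y) y) \<le> e / (3 * C) + e / (3 * C)" for y
    proof -
      have eq: "(sol t y - sol t0 y) - Pt t (\<lambda>y. sol t y - sol t0 y) y
        = (hhat t y - hhat t0 y) + (Pt t (sol t0) y - Pt t0 (sol t0) y)"
        using sol(2)[OF t0, of y] sol(2)[OF assms, of y]
        by (simp add: Pt_diff[OF D] algebra_simps)
      have 1: "cmod (hhat t y - hhat t0 y) \<le> e / (3 * C)"
      proof -
        have "cmod (hhat t y - hhat t0 y) \<le> \<bar>t - t0\<bar> * (K * Hh)" by (rule hhat_lipschitz)
        also have "\<dots> \<le> e / (3 * C * Q) * Q"
          using t d(5) K_nonneg Hh_nonneg e C Q by (intro mult_mono) (auto simp: Q_def)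
        also have "\<dots> = e / (3 * C)" using Q by simp
        finally show ?thesis .
      qed
      have 2: "cmod (Pt t (sol t0) y - Pt t0 (sol t0) y) \<le> e / (3 * C)"
      proof -
        have "cmod (Pt t (sol t0) y - Pt t0 (sol t0) y) \<le> e1 * N"
          using t d(3) N by (intro d2(2) D) (auto simp: N_def)
        also have "\<dots> = e / (3 * C)" using N0 by (simp add: e1_def)
        finally show ?thesis .
      qed
      show ?thesis unfolding eq by (rule order_trans[OF norm_triangle_ineq add_mono[OF 1 2]])
    qed
    then have "cmod (sol t x - sol t0 x) \<le> C * (e / (3 * C) + e / (3 * C))"
      by (rule inv_boundD[OF Cb[OF less_le_trans[OF t d(2)]] Dsp_diff[OF D]])
    also have "\<dots> = 2 * e / 3" using C by (simp add: distrib_left)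
    also have "\<dots> < e" using e by simp
    finally show ?thesis .
  qed
  then show "\<exists>d>0. \<forall>t. dist t t0 < d \<longrightarrow> dist (sol t x) (sol t0 x) < e"
    using d(1) by (auto simp: dist_norm)
qed

lemma sol_bound: "t \<noteq> 0 \<Longrightarrow> inv_bound C t \<Longrightarrow> cmod (sol t x) \<le> C * Hh"
  by (rule inv_boundD[OF _ sol(1)]) (auto simp: sol(2) hhat_bound)

text \<open>Writing \<open>hhat t\<close> as the image of some \<open>g\<close> under the square of \<open>Id - Pt t\<close>, the Cesaro means of the
  partial Neumann series telescope twice, so no decay of the powers of \<open>Pt t\<close> is needed.\<close>

lemma neumann_cesaro:
  assumes t: "t \<noteq> 0" and C: "inv_bound C t" "0 \<le> C" and N: "N > 0"
  shows "cmod ((\<Sum>k<N. \<Sum>n<k. (Pt t ^^ n) (hhat t) x) / of_nat N - sol t x) \<le> 2 * (C * (C * Hh)) / real N"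
proof -
  note f = sol(1)[OF t]
  obtain g where g: "g \<in> Dsp" "\<And>x. g x - Pt t g x = sol t x" using Pt_surj[OF t f] by blast
  have gb: "cmod (g x) \<le> C * (C * Hh)" for x
    by (rule inv_boundD[OF C(1) g(1)]) (simp add: g(2) sol_bound[OF t C(1)])
  have hf: "hhat t = (\<lambda>x. sol t x - Pt t (sol t) x)" using sol(2)[OF t] by auto
  have fg: "sol t = (\<lambda>x. g x - Pt t g x)" using g(2) by auto
  define a where "a = (\<lambda>n. (Pt t ^^ n) (sol t) x)"
  define c where "c = (\<lambda>n. (Pt t ^^ n) g x)"
  have "(Pt t ^^ n) (hhat t) x = a n - a (Suc n)" for n
    by (subst hf, subst Pt_pow_diff[OF f Pt_Dsp[OF f]]) (simp add: a_def funpow_swap1)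
  then have 1: "(\<Sum>n<k. (Pt t ^^ n) (hhat t) x) = sol t x - a k" for k
    by (simp only: sum_lessThan_telescope') (simp add: a_def)
  have "a k = c k - c (Suc k)" for k
    unfolding a_def by (subst fg, subst Pt_pow_diff[OF g(1) Pt_Dsp[OF g(1)]]) (simp add: c_def funpow_swap1)
  then have 2: "(\<Sum>k<N. a k) = g x - (Pt t ^^ N) g x"
    by (simp only: sum_lessThan_telescope') (simp add: c_def)
  have "(\<Sum>k<N. \<Sum>n<k. (Pt t ^^ n) (hhat t) x) = of_nat N * sol t x - (g x - (Pt t ^^ N) g x)"
    unfolding 1 sum_subtractf 2 by simp
  then have "(\<Sum>k<N. \<Sum>n<k. (Pt t ^^ n) (hhat t) x) / of_nat N - sol t x = - (g x - (Pt t ^^ N) g x) / of_nat N"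
    using N by (simp add: field_simps)
  then have "cmod ((\<Sum>k<N. \<Sum>n<k. (Pt t ^^ n) (hhat t) x) / of_nat N - sol t x) = cmod (g x - (Pt t ^^ N) g x) / real N"
    by (simp add: norm_divide norm_minus_commute)
  also have "\<dots> \<le> (C * (C * Hh) + C * (C * Hh)) / real N"
    by (intro divide_right_mono order_trans[OF norm_triangle_ineq4 add_mono] gb Pt_pow_bound[OF g(1)]) auto
  finally show ?thesis by simp
qed

end

section \<open>Fourier inversion and the limits of the renewal functional\<close>

context renewal_wna
begin

lemma integrable_h_chain: "integrable S (\<lambda>\<omega>. h (X n \<omega> y))"
  by (rule seq.P.integrable_const_bound[of _ H]) (use h_bound in auto)

lemma measurable_mean_h [measurable]: "mean n h \<in> borel_measurable borel"
  unfolding mean_def by measurable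

lemma partial_sums_h:
  shows "(\<lambda>n. mean n h y) sums G y" "\<bar>\<Sum>n<k. mean n h y\<bar> \<le> CG"
proof -
  show "(\<lambda>n. mean n h y) sums G y"
    using UO_sums(1)[OF integrable_h_UO[of y]] by (simp add: mean_def G_def)
  have a: "(\<lambda>n. \<integral>\<omega>. \<bar>h (X n \<omega> y)\<bar> \<partial>S) sums (\<integral>z. \<bar>h (visit z y)\<bar> \<partial>UO)"
    using UO_sums(1)[OF integrable_abs[OF integrable_h_UO[of y]]] by simp
  have "\<bar>\<Sum>n<k. mean n h y\<bar> \<le> (\<Sum>n<k. \<integral>\<omega>. \<bar>h (X n \<omega> y)\<bar> \<partial>S)"
    unfolding mean_def by (rule order_trans[OF sum_abs sum_mono]) (rule integral_abs_bound)
  also have "\<dots> \<le> (\<Sum>n. \<integral>\<omega>. \<bar>h (X n \<omega> y)\<bar> \<partial>S)"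
    using a by (intro sum_le_suminf) (auto simp: sums_iff)
  also have "\<dots> \<le> CG" using a integral_abs_h_UO[of y] by (simp add: sums_iff)
  finally show "\<bar>\<Sum>n<k. mean n h y\<bar> \<le> CG" .
qed

text \<open>Links the two sides of the analysis for one time \<open>n\<close>: a frequency integral
  of the twisted power, weighted by \<open>u\<close>, is the smoothing of \<open>mean n h\<close>
  along the fibre by the cosine transform \<open>w\<close> of \<open>u\<close>.\<close>

lemma fourier_term:
  fixes u :: "real \<Rightarrow> real" and x :: "real^'d" and a :: real
  assumes u: "integrable lborel u"
  defines "w \<equiv> \<lambda>s. \<integral>t. u t * cos (t * s) \<partial>lborel"
    and "Z \<equiv> \<lambda>n t. complex_of_real (u t) * (cis (- (t * a)) * cis (t * \<phi> x) * (Pt t ^^ n) (hhat t) x)"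
  shows "integrable lborel (Z n)"
    and "Re (\<integral>t. Z n t \<partial>lborel) = (\<integral>s. mean n h (x - a *\<^sub>R ones + s *\<^sub>R ones) * w s \<partial>lborel)"
    and "integrable lborel (\<lambda>s. mean n h (x - a *\<^sub>R ones + s *\<^sub>R ones) * w s)"
proof -
  interpret SL: pair_sigma_finite S "lborel :: real measure" ..
  have [measurable]: "u \<in> borel_measurable lborel" using u by auto
  define W where "W = (\<lambda>p. h (X n (fst p) x + (snd p - a) *\<^sub>R ones))"
  have Wm [measurable]: "W \<in> borel_measurable (S \<Otimes>\<^sub>M lborel)" unfolding W_def by measurable
  have line: "integrable lborel (\<lambda>s. h (y + (s - a) *\<^sub>R ones))" "(\<integral>s. \<bar>h (y + (s - a) *\<^sub>R ones)\<bar> \<partial>lborel) \<le> Hh" for y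
    using lborel_integrable_real_affine[OF integrable_h_line[of y], of 1 "- a"]
      lborel_integral_real_affine[of 1 "\<lambda>s. \<bar>h (y + s *\<^sub>R ones)\<bar>" "- a"] integral_abs_h_line[of y]
    by (simp_all add: Hh_def algebra_simps)
  have Wi: "integrable (S \<Otimes>\<^sub>M lborel) W"
  proof (rule SL.Fubini_integrable[OF Wm])
    show "integrable S (\<lambda>\<omega>. \<integral>s. norm (W (\<omega>, s)) \<partial>lborel)"
      using line(2) by (intro seq.P.integrable_const_bound[of _ Hh]) (auto simp: W_def)
    show "AE \<omega> in S. integrable lborel (\<lambda>s. W (\<omega>, s))" using line(1) by (simp add: W_def)
  qed
  have sf: "sigma_finite_measure (S \<Otimes>\<^sub>M (lborel :: real measure))"
    by (intro sigma_finite_pair_measure seq.P.sigma_finite_measure_axioms lborel.sigma_finite_measure_axioms)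
  have inner: "(\<integral>p. of_real (W p) * cis (- (t * snd p)) \<partial>(S \<Otimes>\<^sub>M lborel))
      = cis (- (t * a)) * cis (t * \<phi> x) * (Pt t ^^ n) (hhat t) x" for t
  proof -
    have ci: "integrable (S \<Otimes>\<^sub>M lborel) (\<lambda>p. complex_of_real (W p) * cis (- (t * snd p)))"
      by (rule Bochner_Integration.integrable_bound[OF Wi]) (auto simp: norm_mult)
    \<comment> \<open>Substituting \<open>a - \<phi> y + s\<close> for \<open>s\<close> recentres
      the fibre at level 0. The phase splits into those of the level \<open>a\<close>, of the start
      and of the increment.\<close>
    have shift: "(\<integral>s. complex_of_real (h (y + (s - a) *\<^sub>R ones)) * cis (- (t * s)) \<partial>lborel)
       = cis (- (t * a)) * cis (t * \<phi> x) * (cis (t * (\<phi> y - \<phi> x)) * hhat t y)" for y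
    proof -
      have c: "cis (- (t * (a - \<phi> y + s))) = cis (- (t * a)) * cis (t * \<phi> x) * cis (t * (\<phi> y - \<phi> x)) * cis (- (t * s))" for s
        by (simp add: cis_mult algebra_simps)
      have "(\<integral>s. complex_of_real (h (y + (s - a) *\<^sub>R ones)) * cis (- (t * s)) \<partial>lborel)
        = (\<integral>s. complex_of_real (h (y + (a - \<phi> y + s - a) *\<^sub>R ones)) * cis (- (t * (a - \<phi> y + s))) \<partial>lborel)"
        by (subst lborel_integral_real_affine[of 1 _ "a - \<phi> y"]) auto
      also have "\<dots> = (\<integral>s. (cis (- (t * a)) * cis (t * \<phi> x) * cis (t * (\<phi> y - \<phi> x))) *
            (complex_of_real (h (y + (s - \<phi> y) *\<^sub>R ones)) * cis (- (t * s))) \<partial>lborel)"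
        unfolding c by (intro Bochner_Integration.integral_cong refl) (simp add: ac_simps diff_add_eq)
      also have "\<dots> = cis (- (t * a)) * cis (t * \<phi> x) * cis (t * (\<phi> y - \<phi> x)) * hhat t y"
        unfolding hhat_def by (rule integral_mult_right_zero)
      finally show ?thesis by (simp add: mult.assoc)
    qed
    have "(\<integral>p. of_real (W p) * cis (- (t * snd p)) \<partial>(S \<Otimes>\<^sub>M lborel))
       = (\<integral>\<omega>. \<integral>s. complex_of_real (h (X n \<omega> x + (s - a) *\<^sub>R ones)) * cis (- (t * s)) \<partial>lborel \<partial>S)"
      using SL.integral_fst'[OF ci] by (simp add: W_def)
    also have "\<dots> = (\<integral>\<omega>. cis (- (t * a)) * cis (t * \<phi> x) * (cis (t * (\<phi> (X n \<omega> x) - \<phi> x)) * hhat t (X n \<omega> x)) \<partial>S)"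
      by (simp only: shift)
    also have "\<dots> = cis (- (t * a)) * cis (t * \<phi> x) * (Pt t ^^ n) (hhat t) x"
      unfolding Pt_pow[OF hhat_Dsp] by (rule integral_mult_right_zero)
    finally show ?thesis .
  qed
  note ff = fourier_fubini[OF sf Wi u, of snd, unfolded inner]
  show "integrable lborel (Z n)" unfolding Z_def using ff(1) by simp
  have wb: "\<bar>w s\<bar> \<le> (\<integral>t. \<bar>u t\<bar> \<partial>lborel)" for s
    unfolding w_def
  proof (rule order_trans[OF integral_abs_bound integral_mono])
    show "integrable lborel (\<lambda>t. \<bar>u t * cos (t * s)\<bar>)"
    proof (rule Bochner_Integration.integrable_bound[OF u])
      show "AE t in lborel. norm \<bar>u t * cos (t * s)\<bar> \<le> norm (u t)"
        by (intro AE_I2) (simp add: abs_mult mult_left_le)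
    qed measurable
    show "\<bar>u t * cos (t * s)\<bar> \<le> \<bar>u t\<bar>" for t by (simp add: abs_mult mult_left_le)
  qed (use u in simp)
  have wm [measurable]: "w \<in> borel_measurable borel" unfolding w_def by measurable
  have Wwi: "integrable (S \<Otimes>\<^sub>M lborel) (\<lambda>(\<omega>, s). W (\<omega>, s) * w s)"
  proof (rule Bochner_Integration.integrable_bound[OF integrable_mult_right[OF Wi, of "\<integral>t. \<bar>u t\<bar> \<partial>lborel"]])
    show "AE p in S \<Otimes>\<^sub>M lborel. norm (case p of (\<omega>, s) \<Rightarrow> W (\<omega>, s) * w s) \<le> norm ((\<integral>t. \<bar>u t\<bar> \<partial>lborel) * W p)"
    proof (rule AE_I2)
      fix p :: "(nat \<Rightarrow> 'w) \<times> real"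
      show "norm (case p of (\<omega>, s) \<Rightarrow> W (\<omega>, s) * w s) \<le> norm ((\<integral>t. \<bar>u t\<bar> \<partial>lborel) * W p)"
        using mult_right_mono[OF wb[of "snd p"], of "\<bar>W p\<bar>"] by (auto simp: abs_mult split_beta' mult.commute)
    qed
  qed (simp add: split_beta')
  have mean: "(\<integral>\<omega>. W (\<omega>, s) * w s \<partial>S) = mean n h (x - a *\<^sub>R ones + s *\<^sub>R ones) * w s" for s
  proof -
    have "(\<integral>\<omega>. W (\<omega>, s) \<partial>S) = mean n h (x - a *\<^sub>R ones + s *\<^sub>R ones)"
      unfolding mean_def W_def
    proof (rule Bochner_Integration.integral_cong[OF refl])
      fix \<omega> assume "\<omega> \<in> space S"
      then show "h (X n (fst (\<omega>, s)) x + (snd (\<omega>, s) - a) *\<^sub>R ones) = h (X n \<omega> (x - a *\<^sub>R ones + s *\<^sub>R ones))"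
        by (simp add: chain_add_ones chain_diff_ones algebra_simps)
    qed
    then show ?thesis by simp
  qed
  show "integrable lborel (\<lambda>s. mean n h (x - a *\<^sub>R ones + s *\<^sub>R ones) * w s)"
    using SL.integrable_snd[OF Wwi] unfolding mean .
  have "Re (\<integral>t. Z n t \<partial>lborel) = (\<integral>p. W p * w (snd p) \<partial>(S \<Otimes>\<^sub>M lborel))"
    unfolding Z_def w_def using ff(2) by simp
  also have "\<dots> = (\<integral>s. \<integral>\<omega>. W (\<omega>, s) * w s \<partial>S \<partial>lborel)"
    using SL.integral_snd[OF Wwi] by (simp add: split_beta')
  finally show "Re (\<integral>t. Z n t \<partial>lborel) = (\<integral>s. mean n h (x - a *\<^sub>R ones + s *\<^sub>R ones) * w s \<partial>lborel)"
    unfolding mean .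
qed

text \<open>The weight \<open>u\<close> vanishes near frequency 0, so \<open>sol\<close> can stand
  in for the possibly divergent Neumann series wherever it matters. This represents the difference
  of smoothings as a Fourier integral of a continuous compactly supported function, evaluated at
  \<open>a\<close>, and the Riemann-Lebesgue lemma applies.\<close>

lemma Gker_diff_tendsto:
  assumes "0 < \<delta>" "\<delta> < R"
  shows "((\<lambda>a. Gker R (x - a *\<^sub>R ones) - Gker \<delta> (x - a *\<^sub>R ones)) \<longlongrightarrow> 0) at_top"
proof -
  have R: "0 < R" using assms by simp
  define u where "u = (\<lambda>t. trap R t - trap \<delta> t)"
  have ui: "integrable lborel u"
    unfolding u_def using trap_fourier[OF R, of 0] trap_fourier[OF assms(1), of 0]
    by (auto simp: has_bochner_integral_iff)
  have uc: "continuous_on UNIV u"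
    unfolding u_def by (intro continuous_intros continuous_on_trap R assms)
  have u0: "u t = 0" if "\<bar>t\<bar> \<le> \<delta> \<or> 2 * R \<le> \<bar>t\<bar>" for t
    using that assms R by (auto simp: u_def trap_eq_1 trap_eq_0)
  define w where "w = (\<lambda>s. \<integral>t. u t * cos (t * s) \<partial>lborel)"
  have w: "w s = R * vpk (R * s) - \<delta> * vpk (\<delta> * s)" for s
    using has_bochner_integral_diff[OF trap_fourier[OF R, of s] trap_fourier[OF assms(1), of s]]
    unfolding w_def u_def by (simp add: has_bochner_integral_iff left_diff_distrib)
  have wi: "integrable lborel w"
    unfolding w by (intro Bochner_Integration.integrable_diff integrable_vpk_scaled R assms)
  obtain C where C: "C \<ge> 0" "\<And>t. \<delta> \<le> \<bar>t\<bar> \<Longrightarrow> \<bar>t\<bar> \<le> 2 * R \<Longrightarrow> inv_bound C t"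
    using inv_bound_compact[OF assms(1)] by blast
  define F where "F = (\<lambda>t. complex_of_real (u t) * (cis (t * \<phi> x) * sol t x))"
  have Fc: "continuous_on UNIV F"
    unfolding continuous_on_eq_continuous_at[OF open_UNIV]
  proof
    fix t0 :: real
    show "isCont F t0"
    proof (cases "t0 = 0")
      \<comment> \<open>At 0 the value of \<open>sol\<close> carries no information, but
        \<open>u\<close> vanishes on a whole neighbourhood.\<close>
      case True
      have "\<forall>\<^sub>F t in nhds t0. t \<in> {-\<delta><..<\<delta>}"
        using True assms by (intro eventually_nhds_in_open) auto
      then have "\<forall>\<^sub>F t in nhds t0. F t = 0"
      proof eventually_elim
        case (elim t)
        then have "u t = 0" by (intro u0) auto
        then show ?case by (simp add: F_def)
      qed
      then show ?thesis by (subst isCont_cong[of F "\<lambda>_. 0"]) auto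
    next
      case False
      have "isCont u t0" using uc by (simp add: continuous_on_eq_continuous_at)
      moreover have "continuous_on UNIV (\<lambda>t. cis (t * \<phi> x))" by (intro continuous_intros)
      then have "isCont (\<lambda>t. cis (t * \<phi> x)) t0" by (simp add: continuous_on_eq_continuous_at)
      ultimately show ?thesis
        unfolding F_def by (intro continuous_mult isCont_sol[OF False] continuous_of_real)
    qed
  qed
  have [measurable]: "F \<in> borel_measurable borel" by (rule borel_measurable_continuous_onI[OF Fc])
  have Fb: "cmod (F t) \<le> (C * Hh) * \<bar>u t\<bar>" for t
  proof (cases "\<delta> \<le> \<bar>t\<bar> \<and> \<bar>t\<bar> \<le> 2 * R")
    case True
    then have "cmod (sol t x) \<le> C * Hh" using assms by (intro sol_bound C) auto
    then show ?thesis by (simp add: F_def norm_mult mult.commute mult_left_mono)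
  next
    case False
    then have "u t = 0" by (intro u0) auto
    then show ?thesis by (simp add: F_def)
  qed
  have key: "Gker R (x - a *\<^sub>R ones) - Gker \<delta> (x - a *\<^sub>R ones) = Re (\<integral>t. F t * cis (- (t * a)) \<partial>lborel)" for a
  proof -
    define y where "y = (\<lambda>s. x - a *\<^sub>R ones + s *\<^sub>R ones)"
    have ym [measurable]: "y \<in> borel_measurable borel" unfolding y_def by measurable
    define Z where "Z = (\<lambda>n t. complex_of_real (u t) * (cis (- (t * a)) * cis (t * \<phi> x) * (Pt t ^^ n) (hhat t) x))"
    have Z: "integrable lborel (Z n)" "Re (\<integral>t. Z n t \<partial>lborel) = (\<integral>s. mean n h (y s) * w s \<partial>lborel)"
      "integrable lborel (\<lambda>s. mean n h (y s) * w s)" for n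
      using fourier_term[OF ui, where x=x and a=a and n=n] unfolding Z_def y_def w_def by auto
    define A where "A = (\<lambda>k. \<integral>s. (\<Sum>n<k. mean n h (y s)) * w s \<partial>lborel)"
    have wm [measurable]: "w \<in> borel_measurable borel" using wi by auto
    have "A \<longlonglongrightarrow> (\<integral>s. G (y s) * w s \<partial>lborel)"
      unfolding A_def
    proof (rule integral_dominated_convergence[where w="\<lambda>s. CG * \<bar>w s\<bar>"])
      show "AE s in lborel. (\<lambda>k. (\<Sum>n<k. mean n h (y s)) * w s) \<longlonglongrightarrow> G (y s) * w s"
        using partial_sums_h(1) by (intro AE_I2 tendsto_mult tendsto_const) (simp add: sums_def)
      show "AE s in lborel. norm ((\<Sum>n<k. mean n h (y s)) * w s) \<le> CG * \<bar>w s\<bar>" for k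
        using partial_sums_h(2) by (intro AE_I2) (simp add: abs_mult mult_right_mono)
    qed (use wi in auto)
    also have "(\<integral>s. G (y s) * w s \<partial>lborel) = Gker R (x - a *\<^sub>R ones) - Gker \<delta> (x - a *\<^sub>R ones)"
    proof -
      have gk: "integrable lborel (\<lambda>s. G (y s) * (l * vpk (l * s)))" if "l > 0" for l
      proof (rule Bochner_Integration.integrable_bound[OF integrable_mult_right[OF integrable_vpk_scaled[OF that], of CG]])
        show "AE s in lborel. norm (G (y s) * (l * vpk (l * s))) \<le> norm (CG * (l * vpk (l * s)))"
          using G_bound CG_nonneg by (intro AE_I2) (auto simp: abs_mult intro!: mult_right_mono)
      qed measurable
      show ?thesis
        unfolding w Gker_def y_def[symmetric] right_diff_distrib
        using Bochner_Integration.integral_diff[OF gk[OF R] gk[OF assms(1)]] by (simp add: y_def)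
    qed
    \<comment> \<open>The partial sums converge here by dominated convergence, so their Cesaro means
      have the same limit. Averaging matches the frequency side, where \<open>neumann_cesaro\<close>
      controls exactly these means.\<close>
    finally have lim1: "(\<lambda>N. (\<Sum>k<N. A k) / real N) \<longlonglongrightarrow> Gker R (x - a *\<^sub>R ones) - Gker \<delta> (x - a *\<^sub>R ones)"
      by (rule cesaro_mean)
    define V where "V = (\<lambda>N t. (\<Sum>k<N. \<Sum>n<k. Z n t) / of_nat N)"
    have Vi: "integrable lborel (V N)" for N
      unfolding V_def by (intro integrable_divide Bochner_Integration.integrable_sum Z(1))
    have AV: "(\<Sum>k<N. A k) / real N = Re (\<integral>t. V N t \<partial>lborel)" for N
    proof -
      have "A k = (\<Sum>n<k. Re (\<integral>t. Z n t \<partial>lborel))" for k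
        unfolding A_def sum_distrib_right Z(2) by (rule Bochner_Integration.integral_sum) (rule Z(3))
      moreover have "(\<integral>t. V N t \<partial>lborel) = (\<Sum>k<N. \<Sum>n<k. (\<integral>t. Z n t \<partial>lborel)) / of_nat N"
        unfolding V_def using Z(1) by (simp add: Bochner_Integration.integral_sum)
      ultimately show ?thesis by (simp add: Re_divide_of_nat)
    qed
    have Fi: "integrable lborel (\<lambda>t. F t * cis (- (t * a)))"
    proof (rule Bochner_Integration.integrable_bound[OF integrable_mult_right[OF integrable_abs[OF ui], of "C * Hh"]])
      show "AE t in lborel. norm (F t * cis (- (t * a))) \<le> norm (C * Hh * \<bar>u t\<bar>)"
        using Fb by (intro AE_I2) (auto simp: norm_mult intro: order_trans[OF _ abs_ge_self])
    qed measurable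
    define Q where "Q = 2 * (C * (C * Hh))"
    have VF: "cmod (V N t - F t * cis (- (t * a))) \<le> Q / real N * \<bar>u t\<bar>" if N: "N > 0" for N t
    proof (cases "\<delta> \<le> \<bar>t\<bar> \<and> \<bar>t\<bar> \<le> 2 * R")
      case True
      then have t: "t \<noteq> 0" "inv_bound C t" using assms C by auto
      have "V N t = complex_of_real (u t) * (cis (- (t * a)) * cis (t * \<phi> x) *
          ((\<Sum>k<N. \<Sum>n<k. (Pt t ^^ n) (hhat t) x) / of_nat N))"
        unfolding V_def Z_def by (simp only: sum_distrib_left[symmetric] times_divide_eq_right)
      then have "V N t - F t * cis (- (t * a)) = complex_of_real (u t) * (cis (- (t * a)) * cis (t * \<phi> x) *
          ((\<Sum>k<N. \<Sum>n<k. (Pt t ^^ n) (hhat t) x) / of_nat N - sol t x))"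
        by (simp add: F_def right_diff_distrib ac_simps)
      then have "cmod (V N t - F t * cis (- (t * a))) = \<bar>u t\<bar> *
          cmod ((\<Sum>k<N. \<Sum>n<k. (Pt t ^^ n) (hhat t) x) / of_nat N - sol t x)"
        by (simp add: norm_mult)
      also have "\<dots> \<le> \<bar>u t\<bar> * (Q / real N)"
        unfolding Q_def by (intro mult_left_mono neumann_cesaro[OF t C(1) N]) auto
      finally show ?thesis by (simp add: mult.commute)
    next
      case False
      then have "u t = 0" by (intro u0) auto
      then show ?thesis by (simp add: F_def V_def Z_def)
    qed
    have "(\<lambda>N. Re (\<integral>t. V N t \<partial>lborel)) \<longlonglongrightarrow> Re (\<integral>t. F t * cis (- (t * a)) \<partial>lborel)"
    proof (rule LIM_zero_cancel, rule Lim_null_comparison)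
      show "\<forall>\<^sub>F N in sequentially. norm (Re (\<integral>t. V N t \<partial>lborel) - Re (\<integral>t. F t * cis (- (t * a)) \<partial>lborel))
         \<le> (Q * (\<integral>t. \<bar>u t\<bar> \<partial>lborel)) / real N"
        using eventually_gt_at_top[of 0]
      proof eventually_elim
        case (elim N)
        have "norm (Re (\<integral>t. V N t \<partial>lborel) - Re (\<integral>t. F t * cis (- (t * a)) \<partial>lborel))
           \<le> cmod ((\<integral>t. V N t \<partial>lborel) - (\<integral>t. F t * cis (- (t * a)) \<partial>lborel))"
          using abs_Re_le_cmod[of "(\<integral>t. V N t \<partial>lborel) - (\<integral>t. F t * cis (- (t * a)) \<partial>lborel)"] by simp
        also have "\<dots> = cmod (\<integral>t. V N t - F t * cis (- (t * a)) \<partial>lborel)"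
          by (simp only: Bochner_Integration.integral_diff[OF Vi Fi])
        also have "\<dots> \<le> (\<integral>t. Q / real N * \<bar>u t\<bar> \<partial>lborel)"
        proof (rule order_trans[OF integral_norm_bound integral_mono])
          show "integrable lborel (\<lambda>t. cmod (V N t - F t * cis (- (t * a))))"
            by (intro integrable_norm Bochner_Integration.integrable_diff Vi Fi)
          show "integrable lborel (\<lambda>t. Q / real N * \<bar>u t\<bar>)"
            by (intro integrable_mult_right integrable_abs ui)
        qed (rule VF[OF elim])
        also have "\<dots> = (Q * (\<integral>t. \<bar>u t\<bar> \<partial>lborel)) / real N" by simp
        finally show ?case .
      qed
      show "(\<lambda>N. (Q * (\<integral>t. \<bar>u t\<bar> \<partial>lborel)) / real N) \<longlonglongrightarrow> 0" by (rule lim_const_over_n)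
    qed
    then show ?thesis using lim1 unfolding AV by (intro LIMSEQ_unique)
  qed
  have "((\<lambda>a. \<integral>t. F t * cis (- (t * a)) \<partial>lborel) \<longlongrightarrow> 0) at_top"
    by (rule riemann_lebesgue[OF Fc, of "2 * R"]) (simp add: F_def u0)
  then have "((\<lambda>a. Re (\<integral>t. F t * cis (- (t * a)) \<partial>lborel)) \<longlongrightarrow> Re 0) at_top" by (rule tendsto_Re)
  then show ?thesis by (simp only: key zero_complex.sel)
qed

text \<open>Three comparisons chained: \<open>G\<close> with its narrow smoothing, the narrow with
  the wide smoothing, and the wide smoothing with the limit. Each costs at most \<open>e1\<close>, a
  quarter of \<open>e * c0\<close>.\<close>

lemma G_at_top: "((\<lambda>a. G (x - a *\<^sub>R ones)) \<longlongrightarrow> lim_val) at_top"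
proof (rule tendstoI)
  fix e :: real assume e: "e > 0"
  have c0: "c0 > 0" by (rule integral_vpk_pos)
  define e1 where "e1 = e * c0 / 4"
  have e1: "e1 > 0" using e c0 by (simp add: e1_def)
  obtain R where R: "R > 0" "\<And>x. \<bar>Gker R x - G x * c0\<bar> \<le> e1" using Gker_high[OF e1] by blast
  obtain d0 where d0: "d0 > 0" "\<And>d x. 0 < d \<Longrightarrow> d \<le> d0 \<Longrightarrow>
      \<forall>\<^sub>F a in at_top. \<bar>Gker d (x - a *\<^sub>R ones) - lim_val * c0\<bar> \<le> e1"
    using Gker_low[OF e1] by blast
  define d where "d = min d0 (R / 2)"
  have d: "0 < d" "d \<le> d0" "d < R" using d0 R by (auto simp: d_def)
  have "\<forall>\<^sub>F a in at_top. \<bar>Gker R (x - a *\<^sub>R ones) - Gker d (x - a *\<^sub>R ones)\<bar> < e1"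
    using tendstoD[OF Gker_diff_tendsto[OF d(1,3)] e1] by (simp add: dist_real_def)
  with d0(2)[OF d(1,2), of x] show "\<forall>\<^sub>F a in at_top. dist (G (x - a *\<^sub>R ones)) lim_val < e"
  proof eventually_elim
    case (elim a)
    let ?y = "x - a *\<^sub>R ones"
    have "\<bar>G ?y * c0 - lim_val * c0\<bar> < 4 * e1"
      using elim R(2)[of ?y] e1 by linarith
    moreover have "\<bar>G ?y * c0 - lim_val * c0\<bar> = \<bar>G ?y - lim_val\<bar> * c0"
      using c0 abs_mult[of "G ?y - lim_val" c0] by (simp add: left_diff_distrib)
    ultimately have "\<bar>G ?y - lim_val\<bar> * c0 < e * c0" by (simp add: e1_def)
    then show ?case using c0 by (simp add: dist_real_def)
  qed
qed

text \<open>Visits near a very low level require the walk to come down there at some time. Since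
  \<open>\<phi>\<close> tends to infinity along almost every path, its minimum over time is finite,
  and that probability vanishes.\<close>

lemma G_at_bot: "((\<lambda>a. G (x - a *\<^sub>R ones)) \<longlongrightarrow> 0) at_bot"
proof (rule Lim_null_comparison)
  define P where "P = (\<lambda>b. measure S {\<omega> \<in> space S. \<exists>n. \<phi> (X n \<omega> x) \<le> b})"
  show "\<forall>\<^sub>F a in at_bot. norm (G (x - a *\<^sub>R ones)) \<le> H * (Cr * (K + 1) * P (a + K + 2))"
  proof (rule always_eventually, rule allI)
    fix a
    have i: "integrable UO (\<lambda>z. H * indicator (slab x a K) z)"
      by (intro integrable_mult_right integrable_real_indicator sets_slab slab_finite K_nonneg)
    have "\<bar>G (x - a *\<^sub>R ones)\<bar> \<le> (\<integral>z. H * indicator (slab x a K) z \<partial>UO)"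
      unfolding G_def
    proof (rule order_trans[OF integral_abs_bound integral_mono])
      fix z assume z: "z \<in> space UO"
      have "indicator (slab (x - a *\<^sub>R ones) 0 K) z = (indicator (slab x a K) z :: real)"
        using z by (simp add: slab_def indicator_def chain_diff_ones[OF space_UO[OF z]] topical_funD_diff[OF \<phi>_top])
      then show "\<bar>h (visit z (x - a *\<^sub>R ones))\<bar> \<le> H * indicator (slab x a K) z"
        using h_slab[OF z, of "x - a *\<^sub>R ones"] by simp
    qed (use i integrable_h_UO in auto)
    also have "\<dots> = H * measure UO (slab x a K)" by simp
    also have "measure UO (slab x a K) \<le> Cr * (K + 1) * P (a + K + 2)"
      using slab_le_low[OF K_nonneg, of x a] Cr_nonneg K_nonneg
      unfolding measure_def[of UO] P_def
      by (intro enn2real_leI) (auto simp: seq.P.emeasure_eq_measure ennreal_mult' measure_nonneg)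
    finally show "norm (G (x - a *\<^sub>R ones)) \<le> H * (Cr * (K + 1) * P (a + K + 2))"
      using H_nonneg by (simp add: mult_left_mono)
  qed
  have "((\<lambda>t. \<integral>\<omega>. indicator {\<omega> \<in> space S. \<exists>n. \<phi> (X n \<omega> x) \<le> - t} \<omega> \<partial>S) \<longlongrightarrow> (\<integral>\<omega>. (0::real) \<partial>S)) at_top"
  proof (rule integral_dominated_convergence_at_top[where w="\<lambda>_. 1"])
    show "AE \<omega> in S. ((\<lambda>t. indicator {\<omega> \<in> space S. \<exists>n. \<phi> (X n \<omega> x) \<le> - t} \<omega> :: real) \<longlongrightarrow> 0) at_top"
      using drift_at_top
    proof eventually_elim
      case (elim \<omega>)
      then obtain k where k: "\<And>n. n \<ge> k \<Longrightarrow> 0 \<le> \<phi> (X n \<omega> x)"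
        unfolding filterlim_at_top eventually_sequentially by blast
      define b where "b = Min (insert 0 ((\<lambda>n. \<phi> (X n \<omega> x)) ` {..<k}))"
      have b: "b \<le> \<phi> (X n \<omega> x)" for n
      proof (cases "n < k")
        case True then show ?thesis unfolding b_def by (intro Min_le) auto
      next
        case False
        have "b \<le> 0" unfolding b_def by (intro Min_le) auto
        then show ?thesis using k[of n] False by auto
      qed
      have "\<forall>\<^sub>F t in at_top. indicator {\<omega> \<in> space S. \<exists>n. \<phi> (X n \<omega> x) \<le> - t} \<omega> = (0::real)"
        using eventually_gt_at_top[of "- b"]
      proof eventually_elim
        case (elim t)
        then have "\<not> \<phi> (X n \<omega> x) \<le> - t" for n using b[of n] by linarith
        then show ?case by simp
      qed
      then show ?case by (rule tendsto_eventually)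
    qed
  qed (auto simp: indicator_def)
  then have "((\<lambda>t. P (- t)) \<longlongrightarrow> 0) at_top" by (simp add: P_def)
  then have "(P \<longlongrightarrow> 0) at_bot" by (simp add: filterlim_at_bot_mirror)
  moreover have "filterlim (\<lambda>a. a + (K + 2)) at_bot at_bot"
    unfolding filterlim_at_bot
  proof
    fix Z
    show "\<forall>\<^sub>F a in at_bot. a + (K + 2) \<le> Z"
      using eventually_le_at_bot[of "Z - (K + 2)"] by eventually_elim simp
  qed
  ultimately have "((\<lambda>a. P (a + (K + 2))) \<longlongrightarrow> 0) at_bot" by (rule filterlim_compose)
  then have "((\<lambda>a. H * (Cr * (K + 1) * P (a + (K + 2)))) \<longlongrightarrow> H * (Cr * (K + 1) * 0)) at_bot"
    by (intro tendsto_mult tendsto_const)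
  then show "((\<lambda>a. H * (Cr * (K + 1) * P (a + K + 2))) \<longlongrightarrow> 0) at_bot" by (simp add: add.assoc)
qed

text \<open>The limits for fixed starts are integrated over the law \<open>\<rho>\<close> of the
  start. The constant \<open>CG + H\<close> dominates partial sums and limits alike.\<close>

theorem renewal_limits:
  assumes \<rho>: "prob_space \<rho>" "sets \<rho> = sets borel"
  shows "(\<lambda>n. \<integral>x. mean (Suc n) h (x - a *\<^sub>R ones) \<partial>\<rho>) sums (\<integral>x. G (x - a *\<^sub>R ones) - h (x - a *\<^sub>R ones) \<partial>\<rho>)"
    and "((\<lambda>a. \<integral>x. G (x - a *\<^sub>R ones) - h (x - a *\<^sub>R ones) \<partial>\<rho>) \<longlongrightarrow> 0) at_bot"
    and "((\<lambda>a. \<integral>x. G (x - a *\<^sub>R ones) - h (x - a *\<^sub>R ones) \<partial>\<rho>) \<longlongrightarrow> lim_val) at_top"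
proof -
  interpret rho: prob_space \<rho> by fact
  note [measurable_cong] = \<rho>(2)
  have sm: "(\<lambda>n. mean (Suc n) h y) sums (G y - h y)" for y
    using partial_sums_h(1)[of y] sums_iff_shift[of "\<lambda>n. mean n h y" 1 "G y - h y"]
    by (simp add: mean_def seq.P.prob_space)
  have sb: "\<bar>\<Sum>n<k. mean (Suc n) h y\<bar> \<le> CG + H" for k y
  proof -
    have "(\<Sum>n<Suc k. mean n h y) = h y + (\<Sum>n<k. mean (Suc n) h y)"
      by (subst sum.lessThan_Suc_shift) (simp add: mean_def seq.P.prob_space)
    then show ?thesis using partial_sums_h(2)[where k="Suc k" and y=y] h_bound[of y] by linarith
  qed
  have mb: "\<bar>mean n h y\<bar> \<le> H" for n y
    unfolding mean_def by (rule abs_le_bounded_integral[OF seq.P.prob_space_axioms integrable_h_chain h_bound])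
  have mi: "integrable \<rho> (\<lambda>x. mean n h (x - a *\<^sub>R ones))" for n
    by (rule rho.integrable_const_bound[of _ H]) (use mb in auto)
  have "(\<lambda>k. \<integral>x. (\<Sum>n<k. mean (Suc n) h (x - a *\<^sub>R ones)) \<partial>\<rho>) \<longlonglongrightarrow> (\<integral>x. G (x - a *\<^sub>R ones) - h (x - a *\<^sub>R ones) \<partial>\<rho>)"
  proof (rule integral_dominated_convergence[where w="\<lambda>_. CG + H"])
    show "AE x in \<rho>. (\<lambda>k. \<Sum>n<k. mean (Suc n) h (x - a *\<^sub>R ones)) \<longlonglongrightarrow> G (x - a *\<^sub>R ones) - h (x - a *\<^sub>R ones)"
      using sm by (simp add: sums_def)
  qed (use sb in auto)
  then show "(\<lambda>n. \<integral>x. mean (Suc n) h (x - a *\<^sub>R ones) \<partial>\<rho>) sums (\<integral>x. G (x - a *\<^sub>R ones) - h (x - a *\<^sub>R ones) \<partial>\<rho>)"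
    unfolding sums_def using mi by (simp add: Bochner_Integration.integral_sum)
  have bnd: "\<bar>G y - h y\<bar> \<le> CG + H" for y using G_bound[of y] h_bound[of y] by linarith
  have h0: "h (x - a *\<^sub>R ones) = 0" if "\<bar>\<phi> x - a\<bar> > K" for x a
    using h_supp[of "x - a *\<^sub>R ones"] that by (auto simp: topical_funD_diff[OF \<phi>_top])
  have htop: "((\<lambda>a. h (x - a *\<^sub>R ones)) \<longlongrightarrow> 0) at_top" for x
    by (rule tendsto_eventually, rule eventually_mono[OF eventually_gt_at_top[of "\<phi> x + K"]])
      (intro h0, linarith)
  have hbot: "((\<lambda>a. h (x + a *\<^sub>R ones)) \<longlongrightarrow> 0) at_top" for x
  proof (rule tendsto_eventually, rule eventually_mono[OF eventually_gt_at_top[of "K - \<phi> x"]])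
    fix a assume "K - \<phi> x < a"
    then show "h (x + a *\<^sub>R ones) = 0" using h0[of x "- a"] by simp
  qed
  have "((\<lambda>a. \<integral>x. G (x - a *\<^sub>R ones) - h (x - a *\<^sub>R ones) \<partial>\<rho>) \<longlongrightarrow> (\<integral>x. lim_val \<partial>\<rho>)) at_top"
  proof (rule integral_dominated_convergence_at_top[where w="\<lambda>_. CG + H"])
    show "AE x in \<rho>. ((\<lambda>a. G (x - a *\<^sub>R ones) - h (x - a *\<^sub>R ones)) \<longlongrightarrow> lim_val) at_top"
      using tendsto_diff[OF G_at_top htop] by simp
  qed (use bnd in auto)
  then show "((\<lambda>a. \<integral>x. G (x - a *\<^sub>R ones) - h (x - a *\<^sub>R ones) \<partial>\<rho>) \<longlongrightarrow> lim_val) at_top"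
    by (simp add: rho.prob_space)
  have "((\<lambda>a. \<integral>x. G (x + a *\<^sub>R ones) - h (x + a *\<^sub>R ones) \<partial>\<rho>) \<longlongrightarrow> (\<integral>x. 0 \<partial>\<rho>)) at_top"
  proof (rule integral_dominated_convergence_at_top[where w="\<lambda>_. CG + H"])
    have "((\<lambda>a. G (x + a *\<^sub>R ones)) \<longlongrightarrow> 0) at_top" for x
      using G_at_bot[of x] by (simp add: filterlim_at_bot_mirror)
    then show "AE x in \<rho>. ((\<lambda>a. G (x + a *\<^sub>R ones) - h (x + a *\<^sub>R ones)) \<longlongrightarrow> 0) at_top"
      using tendsto_diff[OF _ hbot] by fastforce
  qed (use bnd in auto)
  then show "((\<lambda>a. \<integral>x. G (x - a *\<^sub>R ones) - h (x - a *\<^sub>R ones) \<partial>\<rho>) \<longlongrightarrow> 0) at_bot"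
    by (simp add: filterlim_at_bot_mirror)
qed

end

subsection \<open>Random operators\<close>

text \<open>An operator is only known through its values at countably many points, so evaluation at a
  random point is made jointly measurable by rounding the point.\<close>

definition eval_op :: "(real^'d \<Rightarrow> real^'d) \<Rightarrow> real^'d \<Rightarrow> real^'d" where
  "eval_op B x = lim (\<lambda>k. B (dyadic_round k x))"

lemma eval_op_topical: "topical_op B \<Longrightarrow> eval_op B x = B x"
  unfolding eval_op_def
  by (rule limI, rule isCont_tendsto_compose[OF _ dyadic_round_tendsto])
    (use topical_op_continuous[of B] in \<open>simp add: continuous_on_eq_continuous_at\<close>)

lemma measurable_op_space_eval: "(\<lambda>B. B x) \<in> borel_measurable op_space"
  unfolding op_space_def by (rule measurable_component_singleton) simp

lemma measurable_eval_op [measurable (raw)]: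
  assumes [measurable]: "f \<in> measurable N op_space" "g \<in> borel_measurable N"
  shows "(\<lambda>z. eval_op (f z) (g z)) \<in> borel_measurable N"
proof -
  have [measurable]: "(\<lambda>(B, x). B (dyadic_round k x)) \<in> borel_measurable (op_space \<Otimes>\<^sub>M borel)" for k
    by (rule measurable_eval_dyadic_round[OF measurable_op_space_eval])
  have "(\<lambda>z. (\<lambda>(B, x). B (dyadic_round k x)) (f z, g z)) \<in> borel_measurable N" for k by measurable
  then show ?thesis unfolding eval_op_def by (intro borel_measurable_lim_metric) simp
qed

abbreviation op_seqs :: "(nat \<Rightarrow> real^'d \<Rightarrow> real^'d) measure" where
  "op_seqs \<equiv> (\<Pi>\<^sub>M i\<in>(UNIV::nat set). op_space)"

lemma measurable_chain_eval_op [measurable (raw)]: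
  assumes f [measurable]: "f \<in> measurable N op_seqs" and g [measurable]: "g \<in> borel_measurable N"
  shows "(\<lambda>z. chain eval_op n (f z) (g z)) \<in> borel_measurable N"
proof (induction n)
  case (Suc n)
  have "(\<lambda>z. f z n) \<in> measurable N op_space"
    by (rule measurable_compose[OF f measurable_component_singleton]) simp
  then show ?case using Suc by (auto intro: measurable_eval_op)
qed simp

lemma chain_eval_op:
  assumes "\<And>i. topical_op (\<beta> i)" "\<And>i. \<beta> i = T (\<omega> i)"
  shows "chain eval_op n \<beta> x = chain T n \<omega> x"
  by (induction n) (use assms in \<open>simp_all add: eval_op_topical\<close>)

text \<open>Pairing the identity map with \<open>x\<close> gives a point that \<open>jmap\<close>
  sends to \<open>pnorm x\<close>, so a composition with \<open>jmap\<close> determines an invariant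
  function completely.\<close>

lemma proj_inv_Dsp_Binf:
  assumes f: "proj_inv (f :: real^'d \<Rightarrow> complex)"
  shows "f \<circ> jmap \<in> Binf \<longleftrightarrow> continuous_on UNIV f \<and> bounded (range f)"
proof
  assume "f \<circ> jmap \<in> Binf"
  then obtain k where k: "f \<circ> jmap = k \<circ> jmap" "continuous_on projspace k" "bounded (k ` projspace)"
    by (auto simp: Binf_def)
  have fk: "f = (\<lambda>x. k (pnorm x))"
  proof
    fix x
    have "(f \<circ> jmap) (\<lambda>x. x, x) = (k \<circ> jmap) (\<lambda>x. x, x)" using k(1) by simp
    then show "f x = k (pnorm x)" by (simp add: jmap_def proj_inv_pnorm[OF f])
  qed
  have "continuous_on UNIV f"
    unfolding fk by (rule continuous_on_compose2[OF k(2) continuous_on_pnorm]) auto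
  moreover have "bounded (range f)"
    unfolding fk by (rule bounded_subset[OF k(3)]) auto
  ultimately show "continuous_on UNIV f \<and> bounded (range f)" ..
next
  assume "continuous_on UNIV f \<and> bounded (range f)"
  then have "continuous_on projspace f \<and> bounded (f ` projspace)"
    by (auto intro: continuous_on_subset bounded_subset)
  then show "f \<circ> jmap \<in> Binf" unfolding Binf_def by blast
qed

lemma Binf_obtain:
  assumes "g \<in> Binf"
  obtains f :: "real^'d \<Rightarrow> complex" where "proj_inv f" "g = f \<circ> jmap"
proof -
  obtain k where k: "g = k \<circ> jmap" using assms by (auto simp: Binf_def)
  show thesis
  proof
    show "proj_inv (\<lambda>x. k (pnorm x))" by (simp add: proj_inv_def)
    show "g = (\<lambda>x. k (pnorm x)) \<circ> jmap" by (auto simp: k fun_eq_iff jmap_def)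
  qed
qed

lemma supE_le:
  assumes "\<And>x. cmod (f x) \<le> B"
  shows "supE (f \<circ> jmap) \<le> B"
proof -
  have "(\<lambda>x. x, pnorm 0) \<in> Etop" by (simp add: Etop_def topical_op_id)
  then show ?thesis unfolding supE_def using assms by (intro cSUP_least) auto
qed

lemma le_supE:
  assumes "\<And>x. cmod (f x) \<le> B" and f: "proj_inv (f :: real^'d \<Rightarrow> complex)"
  shows "cmod (f x) \<le> supE (f \<circ> jmap)"
proof -
  have z: "(\<lambda>x. x, pnorm x) \<in> Etop" by (simp add: Etop_def topical_op_id)
  have "cmod ((f \<circ> jmap) (\<lambda>x. x, pnorm x)) \<le> supE (f \<circ> jmap)"
    unfolding supE_def using assms(1) by (intro cSUP_upper z bdd_aboveI2[of _ _ B]) simp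
  then show ?thesis by (simp add: jmap_def proj_inv_pnorm[OF f])
qed

lemma topical_op_chain:
  assumes "\<And>i. topical_op (T (\<omega> i))"
  shows "topical_op (chain T n \<omega>)"
proof (induction n)
  case 0
  have "chain T 0 \<omega> = (\<lambda>x. x)" by (simp add: fun_eq_iff)
  then show ?case by (simp add: topical_op_id)
next
  case (Suc n)
  have "chain T (Suc n) \<omega> = (\<lambda>x. T (\<omega> n) (chain T n \<omega> x))" by (simp add: fun_eq_iff)
  then show ?case using topical_op_comp[OF assms Suc] by simp
qed

lemma continuous_on_compact_abs_bounded:
  fixes f :: "'b::topological_space \<Rightarrow> real"
  assumes "continuous_on UNIV f" "compact C"
  shows "\<exists>B\<ge>0. \<forall>x\<in>C. \<bar>f x\<bar> \<le> B"
proof -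
  have "bounded (f ` C)"
    by (rule compact_imp_bounded[OF compact_continuous_image[OF continuous_on_subset[OF assms(1)] assms(2)]]) simp
  then obtain B where "B > 0" "\<And>y. y \<in> f ` C \<Longrightarrow> norm y \<le> B" unfolding bounded_pos by metis
  then show ?thesis by (intro exI[of _ B]) auto
qed

section \<open>The concrete hypotheses and the passage to independent copies\<close>

locale topical_setting = prob_space M for M :: "'w measure" +
  fixes A :: "nat \<Rightarrow> 'w \<Rightarrow> real^'d \<Rightarrow> real^'d"
    and X0 :: "'w \<Rightarrow> real^'d"
    and \<phi> :: "real^'d \<Rightarrow> real"
    and \<gamma> :: real
    and \<nu>0 :: "(real^'d) measure"
  assumes A_meas: "\<And>n. n \<ge> 1 \<Longrightarrow> A n \<in> measurable M op_space"
    and A_top: "\<And>n \<omega>. n \<ge> 1 \<Longrightarrow> \<omega> \<in> space M \<Longrightarrow> topical_op (A n \<omega>)"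
    and A_indep: "indep_vars (\<lambda>_. op_space) A {1..}"
    and A_ident: "\<And>n. n \<ge> 1 \<Longrightarrow> distr M op_space (A n) = distr M op_space (A 1)"
    and memloss: "memory_loss M A"
    and X0_meas [measurable]: "X0 \<in> borel_measurable M"
    and X0_indep: "indep_set
                     {X0 -` B \<inter> space M | B. B \<in> sets borel}
                     {(\<lambda>\<omega>. \<lambda>n\<in>{1..}. A n \<omega>) -` C \<inter> space M | C.
                        C \<in> sets (Pi\<^sub>M {1..} (\<lambda>_. op_space))}"
    and \<phi>_top: "topical_fun \<phi>"
    and moment2: "(\<integral>\<^sup>+\<omega>. (SUP x. ennreal \<bar>\<phi> (A 1 \<omega> x) - \<phi> x\<bar>) ^ 2 \<partial>M) < \<infinity>"
    and lyap: "AE \<omega> in M. (\<lambda>n. (1 / real n) *\<^sub>R xseq A X0 \<omega> n) \<longlonglongrightarrow> \<gamma> *\<^sub>R ones"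
    and \<nu>0_prob: "prob_space \<nu>0"
    and \<nu>0_sets: "sets \<nu>0 = sets borel"
    and \<nu>0_inv: "\<And>B. B \<in> sets borel \<Longrightarrow>
                   emeasure \<nu>0 B = (\<integral>\<^sup>+x. emeasure M {\<omega> \<in> space M. pnorm (A 1 \<omega> x) \<in> B} \<partial>\<nu>0)"
    and \<gamma>_pos: "\<gamma> > 0"
    and wna: "weakly_non_arith M A \<phi>"
begin

abbreviation "PM \<equiv> (\<Pi>\<^sub>M i\<in>(UNIV::nat set). M)"

text \<open>The operators \<open>A 1, A 2, \<dots>\<close> have the law of independent copies of \<open>A 1\<close>, so that \<open>M\<close> itself
  can serve as the noise space of the abstract walk.\<close>

definition law :: "(real^'d) measure" where "law = distr M borel X0"

definition op_law :: "(real^'d \<Rightarrow> real^'d) measure" where "op_law = distr M op_space (A 1)"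

definition A_seq :: "'w \<Rightarrow> nat \<Rightarrow> real^'d \<Rightarrow> real^'d" where "A_seq \<omega> = (\<lambda>i. A (Suc i) \<omega>)"

definition A1_seq :: "(nat \<Rightarrow> 'w) \<Rightarrow> nat \<Rightarrow> real^'d \<Rightarrow> real^'d" where "A1_seq \<omega> = (\<lambda>i. A 1 (\<omega> i))"

sublocale law: prob_space law unfolding law_def by (rule prob_space_distr) simp

sublocale op_law: prob_space op_law unfolding op_law_def by (rule prob_space_distr[OF A_meas]) simp

sublocale seq: sequence_space M by unfold_locales

sublocale ops: product_prob_space "\<lambda>_::nat. op_law" UNIV by unfold_locales

lemma sets_law [measurable_cong]: "sets law = sets borel" by (simp add: law_def)

lemma sets_op_law [measurable_cong]: "sets op_law = sets op_space" by (simp add: op_law_def)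

lemma measurable_A1 [measurable]: "A 1 \<in> measurable M op_space"
  by (rule A_meas) simp

lemma measurable_A_seq [measurable]: "A_seq \<in> measurable M op_seqs"
  unfolding A_seq_def by (rule measurable_PiM_single') (auto intro: A_meas measurable_space[OF A_meas])

lemma measurable_nth_PM: "(\<lambda>\<omega>. \<omega> i) \<in> measurable PM M"
  by (rule measurable_component_singleton) simp

lemma measurable_A1_seq [measurable]: "A1_seq \<in> measurable PM op_seqs"
  unfolding A1_seq_def
proof (rule measurable_PiM_single')
  show "(\<lambda>\<omega>. A 1 (\<omega> i)) \<in> measurable PM op_space" for i
    by (rule measurable_compose[OF measurable_nth_PM measurable_A1])
qed (use measurable_space[OF measurable_A1] in \<open>auto simp: space_PiM PiE_iff\<close>)

lemma sets_ops: "sets (\<Pi>\<^sub>M i\<in>(UNIV::nat set). op_law) = sets op_seqs"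
  by (intro sets_PiM_cong refl sets_op_law)

lemma distr_A1_seq: "distr PM op_seqs A1_seq = (\<Pi>\<^sub>M i\<in>(UNIV::nat set). op_law)"
proof (rule ops.PiM_eq)
  show "sets (distr PM op_seqs A1_seq) = sets (\<Pi>\<^sub>M i\<in>(UNIV::nat set). op_law)"
    by (simp add: sets_ops)
  fix J F assume J: "finite J" "J \<subseteq> (UNIV::nat set)" "\<And>j. j \<in> J \<Longrightarrow> F j \<in> sets op_law"
  then have F: "\<And>j. j \<in> J \<Longrightarrow> F j \<in> sets op_space" by (simp add: sets_op_law)
  have sp: "space op_law = space op_space" by (simp add: op_law_def)
  let ?P = "\<lambda>j. A 1 -` F j \<inter> space M"
  have eq: "A1_seq -` prod_emb UNIV (\<lambda>_. op_law) J (Pi\<^sub>E J F) \<inter> space PM = prod_emb UNIV (\<lambda>_. M) J (Pi\<^sub>E J ?P)"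
    using measurable_space[OF measurable_A1]
    by (auto simp: prod_emb_def space_PiM PiE_iff A1_seq_def sp)
  have PF: "?P j \<in> sets M" if "j \<in> J" for j
    using F[OF that] by (rule measurable_sets[OF measurable_A1])
  have "emeasure (distr PM op_seqs A1_seq) (prod_emb UNIV (\<lambda>_. op_law) J (Pi\<^sub>E J F))
      = emeasure PM (prod_emb UNIV (\<lambda>_. M) J (Pi\<^sub>E J ?P))"
    unfolding eq[symmetric]
    by (rule emeasure_distr[OF measurable_A1_seq]) (use J in \<open>auto simp: sets_ops[symmetric] intro!: sets_PiM_I\<close>)
  also have "\<dots> = (\<Prod>j\<in>J. emeasure M (?P j))" using J PF by (intro seq.emeasure_PiM_emb) auto
  also have "\<dots> = (\<Prod>j\<in>J. emeasure op_law (F j))"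
    unfolding op_law_def by (intro prod.cong refl emeasure_distr[OF measurable_A1 F, symmetric])
  finally show "emeasure (distr PM op_seqs A1_seq) (prod_emb UNIV (\<lambda>_. op_law) J (Pi\<^sub>E J F))
      = (\<Prod>j\<in>J. emeasure op_law (F j))" .
qed

text \<open>Joint laws are compared on rectangles, where independence of the start and of the
  operators gives the product. The law of the operators alone follows from their mutual independence
  and common distribution.\<close>

lemma distr_joint:
  "distr M (borel \<Otimes>\<^sub>M op_seqs) (\<lambda>\<omega>. (X0 \<omega>, A_seq \<omega>)) = law \<Otimes>\<^sub>M (\<Pi>\<^sub>M i\<in>(UNIV::nat set). op_law)"
  "distr M op_seqs A_seq = (\<Pi>\<^sub>M i\<in>(UNIV::nat set). op_law)"
proof -
  let ?I = "{1::nat..}"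
  let ?PI = "Pi\<^sub>M ?I (\<lambda>_. op_space) :: (nat \<Rightarrow> real^'d \<Rightarrow> real^'d) measure"
  define Y where "Y = (\<lambda>\<omega>. \<lambda>n\<in>?I. A n \<omega>)"
  \<comment> \<open>Relabels the operators numbered from 1 as a sequence indexed from 0, the
    convention of \<open>chain\<close>.\<close>
  define R :: "(nat \<Rightarrow> real^'d \<Rightarrow> real^'d) \<Rightarrow> nat \<Rightarrow> real^'d \<Rightarrow> real^'d" where "R = (\<lambda>\<beta> i. \<beta> (Suc i))"
  have Ym [measurable]: "Y \<in> measurable M ?PI"
    unfolding Y_def by (rule measurable_restrict) (auto intro: A_meas)
  have Rm [measurable]: "R \<in> measurable ?PI op_seqs"
    unfolding R_def
    by (rule measurable_PiM_single') (auto intro!: measurable_component_singleton simp: space_PiM PiE_iff)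
  have RY: "R (Y \<omega>) = A_seq \<omega>" for \<omega> by (auto simp: R_def Y_def A_seq_def)
  have "distr M ?PI Y = Pi\<^sub>M ?I (\<lambda>i. distr M op_space (A i))"
    using A_indep unfolding Y_def
    by (subst (asm) indep_vars_iff_distr_eq_PiM') (auto intro: A_meas)
  also have "\<dots> = Pi\<^sub>M ?I (\<lambda>_. op_law)"
    unfolding op_law_def by (intro PiM_cong refl A_ident) simp
  finally have Yd: "distr M ?PI Y = Pi\<^sub>M ?I (\<lambda>_. op_law)" .
  have "distr M op_seqs A_seq = distr (distr M ?PI Y) op_seqs R"
    by (simp only: distr_distr[OF Rm Ym] comp_def RY)
  also have "\<dots> = distr (Pi\<^sub>M ?I (\<lambda>_. op_law)) (\<Pi>\<^sub>M i\<in>(UNIV::nat set). op_law) (\<lambda>\<beta>. \<lambda>n\<in>UNIV. \<beta> (Suc n))"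
    unfolding Yd by (intro distr_cong sets_ops[symmetric] refl) (simp add: R_def restrict_def)
  also have "\<dots> = (\<Pi>\<^sub>M i\<in>(UNIV::nat set). op_law)"
    by (rule distr_PiM_reindex) (auto simp: op_law.prob_space_axioms)
  finally show Ad: "distr M op_seqs A_seq = (\<Pi>\<^sub>M i\<in>(UNIV::nat set). op_law)" .
  have "law \<Otimes>\<^sub>M (\<Pi>\<^sub>M i\<in>(UNIV::nat set). op_law)
      = distr M (borel \<Otimes>\<^sub>M op_seqs) (\<lambda>\<omega>. (X0 \<omega>, A_seq \<omega>))"
  proof (rule pair_measure_eqI[OF law.sigma_finite_measure_axioms ops.P.sigma_finite_measure_axioms])
    show "sets (law \<Otimes>\<^sub>M (\<Pi>\<^sub>M i\<in>(UNIV::nat set). op_law))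
        = sets (distr M (borel \<Otimes>\<^sub>M op_seqs) (\<lambda>\<omega>. (X0 \<omega>, A_seq \<omega>)))"
      unfolding sets_distr by (intro sets_pair_measure_cong sets_law sets_ops)
    fix B C assume "B \<in> sets law" "C \<in> sets (\<Pi>\<^sub>M i\<in>(UNIV::nat set). op_law)"
    then have B [measurable]: "B \<in> sets borel" and C [measurable]: "C \<in> sets op_seqs"
      by (simp_all add: sets_law sets_ops)
    have "A_seq -` C \<inter> space M = Y -` (R -` C \<inter> space ?PI) \<inter> space M"
      using measurable_space[OF Ym] by (auto simp: RY)
    then have "A_seq -` C \<inter> space M \<in> {(\<lambda>\<omega>. \<lambda>n\<in>{1..}. A n \<omega>) -` C \<inter> space M | C. C \<in> sets ?PI}"
      using measurable_sets[OF Rm C] unfolding Y_def by blast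
    then have ind: "prob ((X0 -` B \<inter> space M) \<inter> (A_seq -` C \<inter> space M))
        = prob (X0 -` B \<inter> space M) * prob (A_seq -` C \<inter> space M)"
      using B by (intro indep_setD[OF X0_indep]) auto
    have "emeasure (distr M (borel \<Otimes>\<^sub>M op_seqs) (\<lambda>\<omega>. (X0 \<omega>, A_seq \<omega>))) (B \<times> C)
        = emeasure M ((X0 -` B \<inter> space M) \<inter> (A_seq -` C \<inter> space M))"
      by (subst emeasure_distr) (auto intro!: arg_cong[where f="emeasure M"])
    also have "\<dots> = emeasure law B * emeasure (\<Pi>\<^sub>M i\<in>(UNIV::nat set). op_law) C"
      unfolding law_def Ad[symmetric] emeasure_distr[OF X0_meas B] emeasure_distr[OF measurable_A_seq C]
      by (simp add: emeasure_eq_measure ind ennreal_mult measure_nonneg)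
    finally show "emeasure law B * emeasure (\<Pi>\<^sub>M i\<in>(UNIV::nat set). op_law) C
        = emeasure (distr M (borel \<Otimes>\<^sub>M op_seqs) (\<lambda>\<omega>. (X0 \<omega>, A_seq \<omega>))) (B \<times> C)" ..
  qed
  then show "distr M (borel \<Otimes>\<^sub>M op_seqs) (\<lambda>\<omega>. (X0 \<omega>, A_seq \<omega>)) = law \<Otimes>\<^sub>M (\<Pi>\<^sub>M i\<in>(UNIV::nat set). op_law)" ..
qed

lemma integral_joint:
  fixes f :: "real^'d \<Rightarrow> (nat \<Rightarrow> real^'d \<Rightarrow> real^'d) \<Rightarrow> real"
  assumes [measurable]: "(\<lambda>p. f (fst p) (snd p)) \<in> borel_measurable (borel \<Otimes>\<^sub>M op_seqs)"
    and B: "\<And>x \<beta>. \<bar>f x \<beta>\<bar> \<le> B"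
  shows "(\<integral>\<omega>. f (X0 \<omega>) (A_seq \<omega>) \<partial>M) = (\<integral>x. \<integral>\<omega>. f x (A1_seq \<omega>) \<partial>PM \<partial>law)"
proof -
  interpret LO: pair_prob_space law "\<Pi>\<^sub>M i\<in>(UNIV::nat set). op_law" ..
  note [measurable_cong] = sets_ops
  have fx: "f x \<in> borel_measurable op_seqs" for x
    using measurable_compose[OF measurable_Pair1' assms(1), of x] by simp
  have i: "integrable (law \<Otimes>\<^sub>M (\<Pi>\<^sub>M i\<in>(UNIV::nat set). op_law)) (\<lambda>p. f (fst p) (snd p))"
    by (rule LO.P.integrable_const_bound[of _ B]) (use B in auto)
  have "(\<integral>\<omega>. f (X0 \<omega>) (A_seq \<omega>) \<partial>M) = (\<integral>p. f (fst p) (snd p) \<partial>distr M (borel \<Otimes>\<^sub>M op_seqs) (\<lambda>\<omega>. (X0 \<omega>, A_seq \<omega>)))"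
    by (subst integral_distr) auto
  also have "\<dots> = (\<integral>x. \<integral>\<beta>. f x \<beta> \<partial>(\<Pi>\<^sub>M i\<in>(UNIV::nat set). op_law) \<partial>law)"
    unfolding distr_joint(1) using LO.integral_fst'[OF i] by simp
  also have "\<dots> = (\<integral>x. \<integral>\<omega>. f x (A1_seq \<omega>) \<partial>PM \<partial>law)"
    unfolding distr_A1_seq[symmetric] by (intro Bochner_Integration.integral_cong refl integral_distr[OF measurable_A1_seq fx])
  finally show ?thesis .
qed

text \<open>An almost sure property under the random start yields one deterministic start for which
  it holds almost surely, since a probability space is not a null set.\<close>

lemma AE_joint:
  assumes [measurable]: "Measurable.pred (borel \<Otimes>\<^sub>M op_seqs) (\<lambda>p. P (fst p) (snd p))"
    and P: "AE \<omega> in M. P (X0 \<omega>) (A_seq \<omega>)"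
  shows "\<exists>x. AE \<omega> in PM. P x (A1_seq \<omega>)"
proof -
  interpret LO: pair_prob_space law "\<Pi>\<^sub>M i\<in>(UNIV::nat set). op_law" ..
  have "AE p in distr M (borel \<Otimes>\<^sub>M op_seqs) (\<lambda>\<omega>. (X0 \<omega>, A_seq \<omega>)). P (fst p) (snd p)"
    using P by (subst AE_distr_iff) auto
  then have "AE x in law. AE \<beta> in (\<Pi>\<^sub>M i\<in>(UNIV::nat set). op_law). P x \<beta>"
    unfolding distr_joint(1) using LO.AE_pair by fastforce
  then have "\<exists>x. AE \<beta> in (\<Pi>\<^sub>M i\<in>(UNIV::nat set). op_law). P x \<beta>"
    by (rule contrapos_pp) (simp add: law.AE_False)
  then obtain x where "AE \<beta> in (\<Pi>\<^sub>M i\<in>(UNIV::nat set). op_law). P x \<beta>" by blast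
  then show ?thesis
    unfolding distr_A1_seq[symmetric] using AE_distrD[OF measurable_A1_seq] by blast
qed

lemma A_seq_topical: "\<omega> \<in> space M \<Longrightarrow> topical_op (A_seq \<omega> i)"
  by (simp add: A_seq_def A_top)

lemma A1_seq_topical: "\<omega> \<in> space PM \<Longrightarrow> topical_op (A1_seq \<omega> i)"
  by (simp add: A1_seq_def A_top space_PiM PiE_iff)

lemma xseq_eq: "\<omega> \<in> space M \<Longrightarrow> xseq A X0 \<omega> n = chain eval_op n (A_seq \<omega>) (X0 \<omega>)"
  by (induction n) (simp_all add: eval_op_topical[OF A_seq_topical], simp add: A_seq_def)

lemma opprod_eq: "\<omega> \<in> space M \<Longrightarrow> opprod A \<omega> n x = chain eval_op n (A_seq \<omega>) x"
  by (induction n) (simp_all add: eval_op_topical[OF A_seq_topical], simp add: A_seq_def)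

section \<open>The regularised operator and its moment bound\<close>

definition dense :: "nat \<Rightarrow> real^'d" where "dense = (SOME d. closure (range d) = UNIV)"

lemma closure_dense: "closure (range dense) = (UNIV :: (real^'d) set)"
proof -
  have "\<exists>d::nat \<Rightarrow> real^'d. closure (range d) = UNIV" using obtain_dense_seq by metis
  then show ?thesis unfolding dense_def by (rule someI_ex)
qed

text \<open>The supremum runs over a dense sequence to be measurable; by continuity it bounds the
  increments at all points (\<open>osc_upper\<close>).\<close>

definition osc :: "'w \<Rightarrow> ennreal" where "osc b = (SUP i. ennreal \<bar>\<phi> (A 1 b (dense i)) - \<phi> (dense i)\<bar>)"

text \<open>On the null set where the increments of \<open>\<phi>\<close> are unbounded, the first operator is replaced by the
  identity, so that the moment bound holds everywhere.\<close>

definition T :: "'w \<Rightarrow> real^'d \<Rightarrow> real^'d" where "T b x = (if osc b < \<infinity> then A 1 b x else x)"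

definition m :: "'w \<Rightarrow> real" where "m b = enn2real (osc b)"

lemma T_top: "b \<in> space M \<Longrightarrow> topical_op (T b)"
  using A_top[of 1 b] by (cases "osc b < \<infinity>") (auto simp: T_def[abs_def] topical_op_id)

lemma measurable_\<phi> [measurable]: "\<phi> \<in> borel_measurable borel"
  by (intro borel_measurable_continuous_onI topical_fun_continuous \<phi>_top)

lemma measurable_A1_eval [measurable]: "(\<lambda>b. A 1 b x) \<in> borel_measurable M"
  using measurable_compose[OF measurable_A1 measurable_op_space_eval] by simp

lemma measurable_osc [measurable]: "osc \<in> borel_measurable M"
  unfolding osc_def by measurable

lemma osc_upper:
  assumes b: "b \<in> space M"
  shows "ennreal \<bar>\<phi> (A 1 b x) - \<phi> x\<bar> \<le> osc b"
proof (rule Collect_dense_all[OF closure_dense])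
  have "continuous_on UNIV (\<lambda>x. \<bar>\<phi> (A 1 b x) - \<phi> x\<bar>)"
    by (intro continuous_intros topical_fun_continuous \<phi>_top topical_fun_comp A_top b) simp
  then show "closed {x. ennreal \<bar>\<phi> (A 1 b x) - \<phi> x\<bar> \<le> osc b}"
    by (intro closed_Collect_le continuous_on_ennreal continuous_on_const)
  show "ennreal \<bar>\<phi> (A 1 b (dense i)) - \<phi> (dense i)\<bar> \<le> osc b" for i
    unfolding osc_def by (rule SUP_upper) simp
qed

lemma osc_sq: "(\<integral>\<^sup>+b. osc b ^ 2 \<partial>M) < \<infinity>"
proof (rule le_less_trans[OF nn_integral_mono moment2])
  show "osc b ^ 2 \<le> (SUP x. ennreal \<bar>\<phi> (A 1 b x) - \<phi> x\<bar>) ^ 2" for b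
    unfolding osc_def by (intro power_mono SUP_least SUP_upper) auto
qed

lemma AE_osc: "AE b in M. osc b < \<infinity>"
proof -
  have "AE b in M. osc b ^ 2 \<noteq> \<infinity>"
    using osc_sq by (intro nn_integral_noteq_infinite) auto
  then show ?thesis
    by eventually_elim (auto simp: less_top power2_eq_square ennreal_mult_eq_top_iff)
qed

lemma AE_T: "AE b in M. T b = A 1 b"
  using AE_osc by eventually_elim (auto simp: T_def fun_eq_iff)

lemma AE_A1_seq_chain: "AE \<omega> in PM. \<forall>n x. chain eval_op n (A1_seq \<omega>) x = chain T n \<omega> x"
proof -
  have "AE \<omega> in PM. T (\<omega> i) = A 1 (\<omega> i)" for i
    using AE_PiM_component[of UNIV "\<lambda>_. M" i "\<lambda>b. T b = A 1 b"] AE_T prob_space_axioms by simp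
  then have "AE \<omega> in PM. \<forall>i. T (\<omega> i) = A 1 (\<omega> i)" by (simp add: AE_all_countable)
  then show ?thesis
    using AE_space
  proof eventually_elim
    case (elim \<omega>)
    then show ?case by (intro allI chain_eval_op A1_seq_topical) (simp_all add: A1_seq_def)
  qed
qed

text \<open>The rank one event is weakened to countably many equalities, transported to the product
  space through the common law, and stripped of the null set where the modified walk differs. On
  what remains, continuity restores rank one.\<close>

lemma memory_T: "\<exists>N. \<exists>E \<in> sets PM. measure PM E > 0 \<and> (\<forall>\<omega>\<in>E. rank_one (chain T N \<omega>))"
proof -
  obtain N where N: "measure M {\<omega> \<in> space M. rank_one (opprod A \<omega> N)} > 0"
    using memloss by (auto simp: memory_loss_def)
  define E1 where "E1 = {\<beta> \<in> space op_seqs. \<forall>i. pnorm (chain eval_op N \<beta> (dense i)) = pnorm (chain eval_op N \<beta> 0)}"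
  have E1 [measurable]: "E1 \<in> sets op_seqs"
    unfolding E1_def by (intro sets.sets_Collect_countable_All measurable_equality_set) measurable
  have "{\<omega> \<in> space M. rank_one (opprod A \<omega> N)} \<subseteq> A_seq -` E1 \<inter> space M"
    using measurable_space[OF measurable_A_seq] by (auto simp: E1_def rank_one_iff opprod_eq)
  then have "measure M {\<omega> \<in> space M. rank_one (opprod A \<omega> N)} \<le> measure M (A_seq -` E1 \<inter> space M)"
    by (rule finite_measure_mono) (rule measurable_sets[OF measurable_A_seq E1])
  also have "\<dots> = measure (\<Pi>\<^sub>M i\<in>(UNIV::nat set). op_law) E1"
    unfolding distr_joint(2)[symmetric] by (rule measure_distr[symmetric]) auto
  also have "\<dots> = measure PM (A1_seq -` E1 \<inter> space PM)"
    unfolding distr_A1_seq[symmetric] by (rule measure_distr) auto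
  finally have pos: "measure PM (A1_seq -` E1 \<inter> space PM) > 0" using N by linarith
  obtain Z where Z: "Z \<in> null_sets PM"
    "{\<omega> \<in> space PM. \<not> (\<forall>n x. chain eval_op n (A1_seq \<omega>) x = chain T n \<omega> x)} \<subseteq> Z"
    using AE_A1_seq_chain by (auto simp: eventually_ae_filter)
  let ?E = "A1_seq -` E1 \<inter> space PM - Z"
  have "measure PM ?E = measure PM (A1_seq -` E1 \<inter> space PM)"
    using Z(1) by (intro measure_Diff_null_set measurable_sets[OF measurable_A1_seq E1])
  moreover have "rank_one (chain T N \<omega>)" if w: "\<omega> \<in> ?E" for \<omega>
  proof -
    have ws: "\<omega> \<in> space PM" using w by auto
    have eq: "chain eval_op n (A1_seq \<omega>) x = chain T n \<omega> x" for n x using Z(2) w by auto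
    have cont: "continuous_on UNIV (chain T N \<omega>)"
      using ws by (intro topical_op_continuous topical_op_chain T_top) (auto simp: space_PiM PiE_iff)
    have "pnorm (chain T N \<omega> x) = pnorm (chain T N \<omega> 0)" for x
    proof (rule Collect_dense_all[OF closure_dense, where P="\<lambda>x. pnorm (chain T N \<omega> x) = pnorm (chain T N \<omega> 0)"])
      show "closed {x. pnorm (chain T N \<omega> x) = pnorm (chain T N \<omega> 0)}"
        by (intro closed_Collect_eq continuous_on_compose2[OF continuous_on_pnorm cont]) auto
      show "pnorm (chain T N \<omega> (dense i)) = pnorm (chain T N \<omega> 0)" for i
        using w by (auto simp: E1_def eq)
    qed
    then show ?thesis by (simp add: rank_one_iff)
  qed
  ultimately show ?thesis
    using pos Z(1) by (intro exI[of _ N] bexI[of _ ?E]) (auto intro: measurable_sets[OF measurable_A1_seq E1])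
qed

text \<open>The Lyapunov limit is known for the random start. It passes to \<open>\<phi>\<close> by
  the Lipschitz bound, then to some deterministic start by \<open>AE_joint\<close>, and finally to
  the origin because walks with the same noise stay at bounded distance in
  \<open>\<phi>\<close>.\<close>

lemma drift_T: "AE \<omega> in PM. (\<lambda>n. \<phi> (chain T n \<omega> 0) / real n) \<longlonglongrightarrow> \<gamma>"
proof -
  define P where "P = (\<lambda>x \<beta>. (\<lambda>n. \<phi> (chain eval_op n \<beta> x) / real n) \<longlonglongrightarrow> \<gamma>)"
  have pm: "Measurable.pred (borel \<Otimes>\<^sub>M op_seqs) (\<lambda>p. P (fst p) (snd p))"
    unfolding P_def by measurable
  have ae: "AE \<omega> in M. P (X0 \<omega>) (A_seq \<omega>)"
    using lyap AE_space
  proof eventually_elim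
    case (elim \<omega>)
    let ?x = "\<lambda>n. xseq A X0 \<omega> n"
    have "(\<lambda>n. \<phi> (?x n) / real n - \<gamma>) \<longlonglongrightarrow> 0"
    proof (rule Lim_null_comparison)
      show "\<forall>\<^sub>F n in sequentially. norm (\<phi> (?x n) / real n - \<gamma>)
          \<le> norm ((1 / real n) *\<^sub>R ?x n - \<gamma> *\<^sub>R ones) + \<bar>\<phi> 0\<bar> / real n"
        using eventually_gt_at_top[of 0]
      proof eventually_elim
        case (elim n)
        have "\<phi> ((real n * \<gamma>) *\<^sub>R ones) = \<phi> 0 + real n * \<gamma>"
          using topical_funD_add[OF \<phi>_top, of 0 "real n * \<gamma>"] by simp
        then have "\<bar>\<phi> (?x n) - (\<phi> 0 + real n * \<gamma>)\<bar> \<le> norm (?x n - (real n * \<gamma>) *\<^sub>R ones)"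
          using topical_fun_dist[OF \<phi>_top, of "?x n" "(real n * \<gamma>) *\<^sub>R ones"] by simp
        then have "\<bar>\<phi> (?x n) - real n * \<gamma>\<bar> \<le> norm (?x n - (real n * \<gamma>) *\<^sub>R ones) + \<bar>\<phi> 0\<bar>" by linarith
        also have "?x n - (real n * \<gamma>) *\<^sub>R ones = real n *\<^sub>R ((1 / real n) *\<^sub>R ?x n - \<gamma> *\<^sub>R ones)"
          using elim by (simp add: scaleR_diff_right)
        finally have "\<bar>\<phi> (?x n) - real n * \<gamma>\<bar> \<le> real n * norm ((1 / real n) *\<^sub>R ?x n - \<gamma> *\<^sub>R ones) + \<bar>\<phi> 0\<bar>"
          by simp
        then have "\<bar>\<phi> (?x n) - real n * \<gamma>\<bar> / real n
            \<le> (real n * norm ((1 / real n) *\<^sub>R ?x n - \<gamma> *\<^sub>R ones) + \<bar>\<phi> 0\<bar>) / real n"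
          by (rule divide_right_mono) simp
        moreover have "\<bar>\<phi> (?x n) - real n * \<gamma>\<bar> / real n = norm (\<phi> (?x n) / real n - \<gamma>)"
        proof -
          have "\<phi> (?x n) / real n - \<gamma> = (\<phi> (?x n) - real n * \<gamma>) / real n"
            using elim by (simp add: diff_divide_distrib)
          then show ?thesis by simp
        qed
        ultimately show ?case using elim by (simp add: add_divide_distrib)
      qed
      have "(\<lambda>n. norm ((1 / real n) *\<^sub>R ?x n - \<gamma> *\<^sub>R ones) + \<bar>\<phi> 0\<bar> / real n) \<longlonglongrightarrow> norm (\<gamma> *\<^sub>R ones - \<gamma> *\<^sub>R ones :: real^'d) + 0"
        by (intro tendsto_add tendsto_norm tendsto_diff elim tendsto_const lim_const_over_n)
      then show "(\<lambda>n. norm ((1 / real n) *\<^sub>R ?x n - \<gamma> *\<^sub>R ones) + \<bar>\<phi> 0\<bar> / real n) \<longlonglongrightarrow> 0" by simp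
    qed
    then show ?case
      unfolding P_def xseq_eq[OF elim(2), symmetric] by (rule LIM_zero_cancel)
  qed
  obtain x where "AE \<omega> in PM. P x (A1_seq \<omega>)" using AE_joint[OF pm ae] by blast
  then show ?thesis
    using AE_A1_seq_chain AE_space
  proof eventually_elim
    case (elim \<omega>)
    have lim: "(\<lambda>n. \<phi> (chain T n \<omega> x) / real n) \<longlonglongrightarrow> \<gamma>"
      using elim(1) unfolding P_def elim(2)[rule_format] .
    have top: "topical_fun (\<lambda>y. \<phi> (chain T n \<omega> y))" for n
    proof (rule topical_fun_comp[OF \<phi>_top topical_op_chain[OF T_top]])
      show "\<omega> i \<in> space M" for i using elim(3) by (auto simp: space_PiM PiE_iff)
    qed
    have "(\<lambda>n. (\<phi> (chain T n \<omega> 0) - \<phi> (chain T n \<omega> x)) / real n) \<longlonglongrightarrow> 0"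
    proof (rule Lim_null_comparison)
      show "\<forall>\<^sub>F n in sequentially. norm ((\<phi> (chain T n \<omega> 0) - \<phi> (chain T n \<omega> x)) / real n) \<le> norm (0 - x) / real n"
        using topical_fun_dist[OF top, of _ 0 x] by (intro always_eventually allI) (simp add: divide_right_mono)
      show "(\<lambda>n. norm (0 - x) / real n) \<longlonglongrightarrow> 0" by (rule lim_const_over_n)
    qed
    then have "(\<lambda>n. (\<phi> (chain T n \<omega> 0) - \<phi> (chain T n \<omega> x)) / real n + \<phi> (chain T n \<omega> x) / real n) \<longlonglongrightarrow> 0 + \<gamma>"
      by (rule tendsto_add[OF _ lim])
    then show ?case by (simp add: add_divide_distrib[symmetric])
  qed
qed

sublocale walk: topical_walk M T \<phi> m \<gamma>
proof
  have [measurable]: "Measurable.pred M (\<lambda>b. osc b < \<infinity>)" by measurable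
  show "(\<lambda>b. T b x) \<in> borel_measurable M" for x unfolding T_def by measurable
  show "topical_op (T b)" if "b \<in> space M" for b by (rule T_top[OF that])
  show "topical_fun \<phi>" by (rule \<phi>_top)
  show m [measurable]: "m \<in> borel_measurable M" unfolding m_def by measurable
  show "0 \<le> m b" for b by (simp add: m_def)
  show "integrable M (\<lambda>b. (m b)\<^sup>2)"
  proof (rule integrableI_nonneg)
    have "(\<integral>\<^sup>+b. ennreal ((m b)\<^sup>2) \<partial>M) \<le> (\<integral>\<^sup>+b. osc b ^ 2 \<partial>M)"
    proof (rule nn_integral_mono)
      fix b
      have "ennreal (m b) \<le> osc b" unfolding m_def by (simp add: ennreal_enn2real_if)
      then have "ennreal (m b) ^ 2 \<le> osc b ^ 2" by (intro power_mono) auto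
      then show "ennreal ((m b)\<^sup>2) \<le> osc b ^ 2" by (simp add: ennreal_power m_def)
    qed
    then show "(\<integral>\<^sup>+b. ennreal ((m b)\<^sup>2) \<partial>M) < \<infinity>" using osc_sq by (rule le_less_trans)
  qed auto
  show "\<bar>\<phi> (T b x) - \<phi> x\<bar> \<le> m b" if b: "b \<in> space M" for b x
  proof (cases "osc b < \<infinity>")
    case True
    have "ennreal \<bar>\<phi> (A 1 b x) - \<phi> x\<bar> \<le> ennreal (m b)"
      using osc_upper[OF b, of x] True by (simp add: m_def less_top)
    then show ?thesis using True by (simp add: T_def m_def)
  qed (simp add: T_def m_def)
qed (fact memory_T drift_T \<gamma>_pos)+

sublocale stat: topical_stationary M T \<phi> m \<gamma> \<nu>0
proof (intro topical_stationary.intro topical_stationary_axioms.intro walk.topical_walk_axioms)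
  show "prob_space \<nu>0" by (rule \<nu>0_prob)
  show "sets \<nu>0 = sets borel" by (rule \<nu>0_sets)
  fix B :: "(real^'d) set" assume B [measurable]: "B \<in> sets borel"
  have "emeasure M {b \<in> space M. pnorm (A 1 b x) \<in> B} = emeasure M {b \<in> space M. pnorm (T b x) \<in> B}" for x
  proof (rule emeasure_eq_AE)
    show "AE b in M. b \<in> {b \<in> space M. pnorm (A 1 b x) \<in> B} \<longleftrightarrow> b \<in> {b \<in> space M. pnorm (T b x) \<in> B}"
      using AE_T by eventually_elim simp
  qed measurable
  then show "emeasure \<nu>0 B = (\<integral>\<^sup>+x. emeasure M {b \<in> space M. pnorm (T b x) \<in> B} \<partial>\<nu>0)"
    using \<nu>0_inv[OF B] by simp
qed

section \<open>From \<open>Q_t\<close> to the twisted operators on classes\<close>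

lemma proj_inv_Pt:
  assumes "proj_inv f" shows "proj_inv (walk.Pt t f)"
  unfolding proj_inv_def walk.Pt_def
  by (intro allI Bochner_Integration.integral_cong refl)
    (simp add: topical_opD_add[OF T_top] topical_funD_add[OF \<phi>_top] proj_invD[OF assms])

text \<open>\<open>Qt\<close> sees its argument only through the class it leads to, so on functions
  composed with \<open>jmap\<close> it acts as \<open>Pt t\<close>; \<open>T\<close> and
  \<open>A 1\<close> agree almost everywhere.\<close>

lemma Qt_eq:
  assumes f: "f \<in> walk.Dsp"
  shows "Qt M A \<phi> t (f \<circ> jmap) = walk.Pt t f \<circ> jmap"
proof
  fix z :: "(real^'d \<Rightarrow> real^'d) \<times> (real^'d)"
  have inv: "proj_inv f" using f by (simp add: walk.Dsp_def)
  note walk.DspD(2)[OF f, measurable]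
  have "Qt M A \<phi> t (f \<circ> jmap) z = (\<integral>b. cis (t * (\<phi> (A 1 b (jmap z)) - \<phi> (jmap z))) * f (A 1 b (jmap z)) \<partial>M)"
    by (simp add: Qt_def xi_def jmap_def cis_conv_exp proj_inv_pnorm[OF inv])
  also have "\<dots> = walk.Pt t f (jmap z)"
    unfolding walk.Pt_def
  proof (rule integral_cong_AE)
    show "AE b in M. cis (t * (\<phi> (A 1 b (jmap z)) - \<phi> (jmap z))) * f (A 1 b (jmap z))
        = cis (t * (\<phi> (T b (jmap z)) - \<phi> (jmap z))) * f (T b (jmap z))"
      using AE_T by eventually_elim simp
  qed measurable
  finally show "Qt M A \<phi> t (f \<circ> jmap) z = (walk.Pt t f \<circ> jmap) z" by simp
qed

lemma Dsp_iff: "f \<in> walk.Dsp \<longleftrightarrow> proj_inv f \<and> f \<circ> jmap \<in> Binf"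
  using proj_inv_Dsp_Binf[of f] by (auto simp: walk.Dsp_def)

lemma jmap_inj:
  assumes "proj_inv f" "proj_inv g" and eq: "f \<circ> jmap = g \<circ> jmap"
  shows "f = g"
proof
  fix x
  have "(f \<circ> jmap) (\<lambda>x. x, x) = (g \<circ> jmap) (\<lambda>x. x, x)" using eq by simp
  then show "f x = g x" by (simp add: jmap_def proj_inv_pnorm[OF assms(1)] proj_inv_pnorm[OF assms(2)])
qed

lemma supE_Dsp:
  assumes "f \<in> walk.Dsp" shows "cmod (f x) \<le> supE (f \<circ> jmap)"
proof -
  obtain B where "\<And>x. cmod (f x) \<le> B" using walk.DspD(3)[OF assms] by blast
  then show ?thesis using assms by (intro le_supE) (auto simp: walk.Dsp_def)
qed

lemma Pt_Dsp:
  assumes f: "f \<in> walk.Dsp" shows "walk.Pt t f \<in> walk.Dsp"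
proof -
  have "Qt M A \<phi> t (f \<circ> jmap) \<in> Binf"
    using wna f unfolding weakly_non_arith_def Dsp_iff by blast
  then show ?thesis using f by (simp add: Qt_eq[OF f] Dsp_iff proj_inv_Pt)
qed

lemma Pt_cont:
  assumes "e > 0"
  shows "\<exists>d>0. \<forall>t. \<bar>t - t0\<bar> < d \<longrightarrow>
       (\<forall>f\<in>walk.Dsp. \<forall>B. (\<forall>x. cmod (f x) \<le> B) \<longrightarrow> (\<forall>x. cmod (walk.Pt t f x - walk.Pt t0 f x) \<le> e * B))"
proof -
  obtain d where d: "d > 0" "\<And>t g. \<bar>t - t0\<bar> < d \<Longrightarrow> g \<in> Binf \<Longrightarrow>
      supE (\<lambda>z. Qt M A \<phi> t g z - Qt M A \<phi> t0 g z) \<le> e * supE g"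
    using wna assms unfolding weakly_non_arith_def by blast
  have "cmod (walk.Pt t f x - walk.Pt t0 f x) \<le> e * B"
    if t: "\<bar>t - t0\<bar> < d" and f: "f \<in> walk.Dsp" and B: "\<forall>x. cmod (f x) \<le> B" for t f B x
  proof -
    have D: "(\<lambda>x. walk.Pt t f x - walk.Pt t0 f x) \<in> walk.Dsp" by (intro walk.Dsp_diff Pt_Dsp f)
    have "cmod (walk.Pt t f x - walk.Pt t0 f x) \<le> supE ((\<lambda>x. walk.Pt t f x - walk.Pt t0 f x) \<circ> jmap)"
      by (rule supE_Dsp[OF D])
    also have "\<dots> = supE (\<lambda>z. Qt M A \<phi> t (f \<circ> jmap) z - Qt M A \<phi> t0 (f \<circ> jmap) z)"
      unfolding Qt_eq[OF f] by (simp add: comp_def)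
    also have "\<dots> \<le> e * supE (f \<circ> jmap)" using f by (intro d(2) t) (simp add: Dsp_iff)
    also have "\<dots> \<le> e * B" using assms B by (intro mult_left_mono supE_le) auto
    finally show ?thesis .
  qed
  then show ?thesis using d(1) by blast
qed

text \<open>The inverse on \<open>Binf\<close> is pulled back through \<open>jmap\<close>, which
  separates invariant functions. Being a right inverse gives solvability; being a bounded left
  inverse gives the lower bound.\<close>

lemma Pt_resolvent:
  assumes "t \<noteq> 0"
  obtains R C where "\<And>f. f \<in> walk.Dsp \<Longrightarrow> R f \<in> walk.Dsp"
    "\<And>f x. f \<in> walk.Dsp \<Longrightarrow> R f x - walk.Pt t (R f) x = f x"
    "\<And>f B x. f \<in> walk.Dsp \<Longrightarrow> (\<And>x. cmod (f x - walk.Pt t f x) \<le> B) \<Longrightarrow> cmod (f x) \<le> C * B"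
proof -
  note w = wna[unfolded weakly_non_arith_def, THEN conjunct2, THEN conjunct2, THEN spec, THEN mp, OF assms]
  obtain R C where RC0: "\<forall>g\<in>Binf. R g \<in> Binf \<and> supE (R g) \<le> C * supE g \<and>
      R (\<lambda>z. g z - Qt M A \<phi> t g z) = g \<and> (\<lambda>z. R g z - Qt M A \<phi> t (R g) z) = g"
    using w by (elim exE) (rule that)
  have RC: "R g \<in> Binf" "supE (R g) \<le> C * supE g" "R (\<lambda>z. g z - Qt M A \<phi> t g z) = g"
    "(\<lambda>z. R g z - Qt M A \<phi> t (R g) z) = g" if "g \<in> Binf" for g
    using bspec[OF RC0 that] by - (elim conjE, assumption)+
  have ex: "\<exists>k\<in>walk.Dsp. \<forall>x. k x - walk.Pt t k x = f x" if f: "f \<in> walk.Dsp" for f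
  proof -
    have fB: "f \<circ> jmap \<in> Binf" "proj_inv f" using f by (simp_all add: Dsp_iff)
    obtain k where k: "proj_inv k" "R (f \<circ> jmap) = k \<circ> jmap"
      using Binf_obtain[OF RC(1)[OF fB(1)]] by blast
    then have kD: "k \<in> walk.Dsp" using RC(1)[OF fB(1)] by (simp add: Dsp_iff)
    have "(\<lambda>x. k x - walk.Pt t k x) \<circ> jmap = f \<circ> jmap"
      using RC(4)[OF fB(1)] unfolding k(2) Qt_eq[OF kD] by (simp add: comp_def)
    moreover have "proj_inv (\<lambda>x. k x - walk.Pt t k x)"
      using k(1) proj_inv_Pt[OF k(1)] by (simp add: proj_inv_def)
    ultimately have "(\<lambda>x. k x - walk.Pt t k x) = f" by (intro jmap_inj fB)
    then have "k x - walk.Pt t k x = f x" for x by (rule fun_cong)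
    then show ?thesis using kD by blast
  qed
  \<comment> \<open>The given constant \<open>C\<close> might be negative, so its positive part is
    used to keep the estimate monotone in \<open>B\<close>.\<close>
  have inv: "cmod (f x) \<le> max C 0 * B"
    if f: "f \<in> walk.Dsp" and B: "\<And>x. cmod (f x - walk.Pt t f x) \<le> B" for f B x
  proof -
    have fB: "f \<circ> jmap \<in> Binf" using f by (simp add: Dsp_iff)
    define k where "k = (\<lambda>x. f x - walk.Pt t f x)"
    have kD: "k \<in> walk.Dsp" unfolding k_def by (intro walk.Dsp_diff Pt_Dsp f)
    then have kB: "k \<circ> jmap \<in> Binf" by (simp add: Dsp_iff)
    have "k \<circ> jmap = (\<lambda>z. (f \<circ> jmap) z - Qt M A \<phi> t (f \<circ> jmap) z)"
      unfolding Qt_eq[OF f] by (simp add: k_def comp_def)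
    then have R: "R (k \<circ> jmap) = f \<circ> jmap" using RC(3)[OF fB] by simp
    have sk: "supE (k \<circ> jmap) \<le> B" using B by (intro supE_le) (simp add: k_def)
    have s0: "0 \<le> supE (k \<circ> jmap)" using supE_Dsp[OF kD, of 0] by (rule order_trans[OF norm_ge_zero])
    have "cmod (f x) \<le> supE (f \<circ> jmap)" by (rule supE_Dsp[OF f])
    also have "\<dots> \<le> C * supE (k \<circ> jmap)" using RC(2)[OF kB] by (simp add: R)
    also have "\<dots> \<le> max C 0 * supE (k \<circ> jmap)" using s0 by (intro mult_right_mono) auto
    also have "\<dots> \<le> max C 0 * B" using sk by (intro mult_left_mono) auto
    finally show ?thesis .
  qed
  define R' where "R' = (\<lambda>f. SOME k. k \<in> walk.Dsp \<and> (\<forall>x. k x - walk.Pt t k x = f x))"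
  have R': "R' f \<in> walk.Dsp \<and> (\<forall>x. R' f x - walk.Pt t (R' f) x = f x)" if "f \<in> walk.Dsp" for f
    using ex[OF that] unfolding R'_def Bex_def by (rule someI_ex)
  show thesis
  proof (rule that)
    show "R' f \<in> walk.Dsp" if "f \<in> walk.Dsp" for f using R'[OF that] ..
    show "R' f x - walk.Pt t (R' f) x = f x" if "f \<in> walk.Dsp" for f x
      using R'[OF that, THEN conjunct2] ..
    show "cmod (f x) \<le> max C 0 * B"
      if "f \<in> walk.Dsp" "\<And>x. cmod (f x - walk.Pt t f x) \<le> B" for f B x by (rule inv[OF that])
  qed
qed

section \<open>The renewal limits for the random start\<close>

theorem renewal:
  assumes \<alpha>_sets: "sets \<alpha> = sets borel"
    and \<alpha>_img: "distr \<alpha> (borel \<Otimes>\<^sub>M borel) (\<lambda>x. (pnorm x, \<phi> x)) = \<nu>0 \<Otimes>\<^sub>M lborel"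
    and h_cont: "continuous_on UNIV h"
    and h_supp: "compact (closure {x. h x \<noteq> 0})"
  shows "(\<lambda>n. \<integral>\<omega>. h (xseq A X0 \<omega> (Suc n) - a *\<^sub>R ones) \<partial>M) sums
      (\<Sum>n. \<integral>\<omega>. h (xseq A X0 \<omega> (Suc n) - a *\<^sub>R ones) \<partial>M)"
    and "((\<lambda>a. \<Sum>n. \<integral>\<omega>. h (xseq A X0 \<omega> (Suc n) - a *\<^sub>R ones) \<partial>M) \<longlongrightarrow> 0) at_bot"
    and "((\<lambda>a. \<Sum>n. \<integral>\<omega>. h (xseq A X0 \<omega> (Suc n) - a *\<^sub>R ones) \<partial>M)
            \<longlongrightarrow> (\<integral>x. h x \<partial>\<alpha>) / \<gamma>) at_top"
proof -
  let ?C = "closure {x. h x \<noteq> 0}"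
  have hC: "x \<in> ?C" if "h x \<noteq> 0" for x
    by (rule subsetD[OF closure_subset]) (use that in simp)
  obtain K where K0: "K \<ge> 0" "\<forall>x\<in>?C. \<bar>\<phi> x\<bar> \<le> K"
    using continuous_on_compact_abs_bounded[OF topical_fun_continuous[OF \<phi>_top] h_supp]
    by (elim exE conjE) (rule that)
  obtain H where H0: "H \<ge> 0" "\<forall>x\<in>?C. \<bar>h x\<bar> \<le> H"
    using continuous_on_compact_abs_bounded[OF h_cont h_supp] by (elim exE conjE) (rule that)
  have H: "\<bar>h x\<bar> \<le> H" for x
    using H0 bspec[OF H0(2) hC[of x]] by (cases "h x = 0") simp_all
  interpret renewal_wna M T \<phi> m \<gamma> \<nu>0 h K H
  proof
    show "continuous_on UNIV h" by (rule h_cont)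
    show "\<bar>\<phi> x\<bar> \<le> K" if "h x \<noteq> 0" for x by (rule bspec[OF K0(2) hC[OF that]])
    show "\<bar>h x\<bar> \<le> H" for x by (rule H)
    show "0 \<le> K" by (rule K0(1))
    show "walk.Pt t f \<in> walk.Dsp" if "f \<in> walk.Dsp" for t f by (rule Pt_Dsp[OF that])
    show "\<exists>d>0. \<forall>t. \<bar>t - t0\<bar> < d \<longrightarrow> (\<forall>f\<in>walk.Dsp. \<forall>B. (\<forall>x. cmod (f x) \<le> B) \<longrightarrow>
        (\<forall>x. cmod (walk.Pt t f x - walk.Pt t0 f x) \<le> e * B))" if "e > 0" for t0 e
      by (rule Pt_cont[OF that])
    show "\<exists>f\<in>walk.Dsp. \<forall>x. f x - walk.Pt t f x = g x" if "t \<noteq> 0" "g \<in> walk.Dsp" for t g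
      by (rule Pt_resolvent[OF that(1)]) (use that(2) in blast)
    show "\<exists>C. \<forall>f\<in>walk.Dsp. \<forall>B. (\<forall>x. cmod (f x - walk.Pt t f x) \<le> B) \<longrightarrow> (\<forall>x. cmod (f x) \<le> C * B)"
      if "t \<noteq> 0" for t
      by (rule Pt_resolvent[OF that]) blast
    show "\<exists>d>0. \<forall>x b. \<bar>b\<bar> < d \<longrightarrow> \<bar>h (x + b *\<^sub>R ones) - h x\<bar> \<le> e" if e: "e > 0" for e
    proof -
      \<comment> \<open>The support thickened along \<open>ones\<close> by at most 1. If
        \<open>h\<close> is nonzero at one end of a shift of size below 1, both ends lie in this
        compact set, where \<open>h\<close> is uniformly continuous.\<close>
      define P where "P = (\<lambda>p. fst p + snd p *\<^sub>R (ones :: real^'d)) ` (?C \<times> {-1..1})"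
      have P: "compact P"
        unfolding P_def by (intro compact_continuous_image continuous_intros compact_Times h_supp) auto
      then have "uniformly_continuous_on P h"
        by (intro compact_uniformly_continuous continuous_on_subset[OF h_cont]) auto
      then obtain d where d: "d > 0" "\<And>x y. x \<in> P \<Longrightarrow> y \<in> P \<Longrightarrow> dist y x < d \<Longrightarrow> dist (h y) (h x) < e"
        using e unfolding uniformly_continuous_on_def by blast
      define n1 where "n1 = norm (ones :: real^'d)"
      have n1: "n1 > 0" by (simp add: n1_def ones_neq_0)
      have "\<bar>h (x + b *\<^sub>R ones) - h x\<bar> \<le> e" if b: "\<bar>b\<bar> < min 1 (d / n1)" for x b
      proof (cases "h (x + b *\<^sub>R ones) = 0 \<and> h x = 0")
        case False
        have PI: "y + s *\<^sub>R ones \<in> P" if "y \<in> ?C" "\<bar>s\<bar> \<le> 1" for y s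
          unfolding P_def by (rule image_eqI[of _ _ "(y, s)"]) (use that in auto)
        have "x \<in> P \<and> x + b *\<^sub>R ones \<in> P"
        proof (cases "h x = 0")
          case True
          then have "x + b *\<^sub>R ones \<in> ?C" using False hC by blast
          from PI[OF this, of "- b"] PI[OF this, of 0] show ?thesis using b by simp
        next
          case False
          from PI[OF hC[OF this], of b] PI[OF hC[OF this], of 0] show ?thesis using b by simp
        qed
        moreover have "dist (x + b *\<^sub>R ones) x < d"
          using b n1 by (simp add: dist_norm n1_def[symmetric] pos_less_divide_eq)
        ultimately show ?thesis using d(2) by (auto simp: dist_real_def intro: less_imp_le)
      qed (use e in simp)
      then show ?thesis using d(1) n1 by (intro exI[of _ "min 1 (d / n1)"]) auto
    qed
  qed
  \<comment> \<open>The joint law of the start and the operators is a product, so each term is a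
    transition average integrated over the law of the start. Homogeneity moves the level
    \<open>a\<close> from the endpoint to the start.\<close>
  have summand: "(\<integral>\<omega>. h (xseq A X0 \<omega> (Suc n) - a *\<^sub>R ones) \<partial>M) = (\<integral>x. walk.mean (Suc n) h (x - a *\<^sub>R ones) \<partial>law)" for n a
  proof -
    have "(\<integral>\<omega>. h (xseq A X0 \<omega> (Suc n) - a *\<^sub>R ones) \<partial>M)
        = (\<integral>\<omega>. h (chain eval_op (Suc n) (A_seq \<omega>) (X0 \<omega>) - a *\<^sub>R ones) \<partial>M)"
      by (intro Bochner_Integration.integral_cong refl) (simp only: xseq_eq)
    also have "\<dots> = (\<integral>x. \<integral>\<omega>. h (chain eval_op (Suc n) (A1_seq \<omega>) x - a *\<^sub>R ones) \<partial>PM \<partial>law)"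
      by (rule integral_joint[OF _ H]) measurable
    also have "\<dots> = (\<integral>x. walk.mean (Suc n) h (x - a *\<^sub>R ones) \<partial>law)"
      unfolding walk.mean_def
    proof (rule Bochner_Integration.integral_cong[OF refl], rule integral_cong_AE)
      fix x
      show "AE \<omega> in PM. h (chain eval_op (Suc n) (A1_seq \<omega>) x - a *\<^sub>R ones) = h (chain T (Suc n) \<omega> (x - a *\<^sub>R ones))"
        using AE_A1_seq_chain AE_space
        by eventually_elim (simp only: walk.chain_diff_ones)
    qed measurable
    finally show ?thesis .
  qed
  have lim: "lim_val = (\<integral>x. h x \<partial>\<alpha>) / \<gamma>"
  proof -
    interpret NL: pair_sigma_finite \<nu>0 "lborel :: real measure" ..
    note [measurable_cong] = \<nu>0_sets \<alpha>_sets
    \<comment> \<open>The function \<open>h\<close> in the coordinates class and level: the point of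
      the class of \<open>y\<close> with \<open>\<phi>\<close> equal to \<open>s\<close> is
      \<open>y + (s - \<phi> y) *\<^sub>R ones\<close>. Integrating out the level leaves
      \<open>htil\<close>.\<close>
    define W where "W = (\<lambda>p. h (fst p + (snd p - \<phi> (fst p)) *\<^sub>R ones))"
    have Wm [measurable]: "W \<in> borel_measurable (borel \<Otimes>\<^sub>M borel)" unfolding W_def by measurable
    have Wx: "h x = W (pnorm x, \<phi> x)" for x
    proof -
      have "\<phi> x = \<phi> (pnorm x) + Max (range (\<lambda>i. x $ i))"
        using pnorm_decomp[of x] topical_funD_add[OF \<phi>_top, of "pnorm x"] by metis
      then show ?thesis using pnorm_decomp[of x] by (simp add: W_def)
    qed
    have line: "integrable lborel (\<lambda>s. h (y + (s - \<phi> y) *\<^sub>R ones))"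
        "(\<integral>s. h (y + (s - \<phi> y) *\<^sub>R ones) \<partial>lborel) = htil y"
        "(\<integral>s. \<bar>h (y + (s - \<phi> y) *\<^sub>R ones)\<bar> \<partial>lborel) \<le> H * (2 * K)" for y
      using lborel_integrable_real_affine[OF integrable_h_line[of y], of 1 "- \<phi> y"]
        lborel_integral_real_affine[of 1 "\<lambda>s. h (y + s *\<^sub>R ones)" "- \<phi> y"]
        lborel_integral_real_affine[of 1 "\<lambda>s. \<bar>h (y + s *\<^sub>R ones)\<bar>" "- \<phi> y"] integral_abs_h_line[of y]
      by (simp_all add: htil_def)
    have Wi: "integrable (\<nu>0 \<Otimes>\<^sub>M lborel) W"
    proof (rule NL.Fubini_integrable)
      show "integrable \<nu>0 (\<lambda>y. \<integral>s. norm (W (y, s)) \<partial>lborel)"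
        using line(3) by (intro stat.nu.integrable_const_bound[of _ "H * (2 * K)"]) (auto simp: W_def)
      show "AE y in \<nu>0. integrable lborel (\<lambda>s. W (y, s))" using line(1) by (simp add: W_def)
    qed measurable
    have "(\<integral>x. h x \<partial>\<alpha>) = (\<integral>p. W p \<partial>distr \<alpha> (borel \<Otimes>\<^sub>M borel) (\<lambda>x. (pnorm x, \<phi> x)))"
      by (subst integral_distr) (auto simp: Wx[symmetric])
    also have "\<dots> = (\<integral>y. htil y \<partial>\<nu>0)"
      unfolding \<alpha>_img using NL.integral_fst'[OF Wi] line(2) by (simp add: W_def)
    finally show ?thesis by (simp add: lim_val_def)
  qed
  note L = renewal_limits[OF law.prob_space_axioms sets_law]
  have sums: "(\<lambda>n. \<integral>\<omega>. h (xseq A X0 \<omega> (Suc n) - a *\<^sub>R ones) \<partial>M)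
      sums (\<integral>x. G (x - a *\<^sub>R ones) - h (x - a *\<^sub>R ones) \<partial>law)" for a
    unfolding summand by (rule L(1))
  show "(\<lambda>n. \<integral>\<omega>. h (xseq A X0 \<omega> (Suc n) - a *\<^sub>R ones) \<partial>M) sums
      (\<Sum>n. \<integral>\<omega>. h (xseq A X0 \<omega> (Suc n) - a *\<^sub>R ones) \<partial>M)"
    using sums by (rule sums_summable[THEN summable_sums])
  show "((\<lambda>a. \<Sum>n. \<integral>\<omega>. h (xseq A X0 \<omega> (Suc n) - a *\<^sub>R ones) \<partial>M) \<longlongrightarrow> 0) at_bot"
    "((\<lambda>a. \<Sum>n. \<integral>\<omega>. h (xseq A X0 \<omega> (Suc n) - a *\<^sub>R ones) \<partial>M)
            \<longlongrightarrow> (\<integral>x. h x \<partial>\<alpha>) / \<gamma>) at_top"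
    unfolding sums_unique[OF sums, symmetric] lim[symmetric] by (rule L(2), rule L(3))
qed

end

theorem theorem2p5:
  fixes M :: "'w measure"
    and A :: "nat \<Rightarrow> 'w \<Rightarrow> real^'d \<Rightarrow> real^'d"
    and X0 :: "'w \<Rightarrow> real^'d"
    and \<phi> :: "real^'d \<Rightarrow> real"
    and \<gamma> :: real
    and \<nu>0 :: "(real^'d) measure"
    and \<alpha> :: "(real^'d) measure"
    and h :: "real^'d \<Rightarrow> real"
  assumes M: "prob_space M"
    and A_meas: "\<And>n. n \<ge> 1 \<Longrightarrow> A n \<in> measurable M op_space"
    and A_top: "\<And>n \<omega>. n \<ge> 1 \<Longrightarrow> \<omega> \<in> space M \<Longrightarrow> topical_op (A n \<omega>)"
    and A_indep: "prob_space.indep_vars M (\<lambda>_. op_space) A {1..}"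
    and A_ident: "\<And>n. n \<ge> 1 \<Longrightarrow> distr M op_space (A n) = distr M op_space (A 1)"
    and memloss: "memory_loss M A"
    and X0_meas: "X0 \<in> borel_measurable M"
    and X0_indep: "prob_space.indep_set M
                     {X0 -` B \<inter> space M | B. B \<in> sets borel}
                     {(\<lambda>\<omega>. \<lambda>n\<in>{1..}. A n \<omega>) -` C \<inter> space M | C.
                        C \<in> sets (Pi\<^sub>M {1..} (\<lambda>_. op_space))}"
    and \<phi>_top: "topical_fun \<phi>"
    and moment2: "(\<integral>\<^sup>+\<omega>. (SUP x. ennreal \<bar>\<phi> (A 1 \<omega> x) - \<phi> x\<bar>) ^ 2 \<partial>M) < \<infinity>"
    and lyap: "AE \<omega> in M. (\<lambda>n. (1 / real n) *\<^sub>R xseq A X0 \<omega> n) \<longlonglongrightarrow> \<gamma> *\<^sub>R ones"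
    and \<nu>0_prob: "prob_space \<nu>0"
    and \<nu>0_sets: "sets \<nu>0 = sets borel"
    and \<nu>0_supp: "AE x in \<nu>0. x \<in> projspace"
    and \<nu>0_inv: "\<And>B. B \<in> sets borel \<Longrightarrow>
                   emeasure \<nu>0 B = (\<integral>\<^sup>+x. emeasure M {\<omega> \<in> space M. pnorm (A 1 \<omega> x) \<in> B} \<partial>\<nu>0)"
    and \<alpha>_sets: "sets \<alpha> = sets borel"
    and \<alpha>_img: "distr \<alpha> (borel \<Otimes>\<^sub>M borel) (\<lambda>x. (pnorm x, \<phi> x)) = \<nu>0 \<Otimes>\<^sub>M lborel"
    and \<gamma>_pos: "\<gamma> > 0"
    and wna: "weakly_non_arith M A \<phi>"
    and h_cont: "continuous_on UNIV h"
    and h_supp: "compact (closure {x. h x \<noteq> 0})"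
  shows "(\<forall>\<^sub>F a in at_bot. summable (\<lambda>n. \<integral>\<omega>. h (xseq A X0 \<omega> (Suc n) - a *\<^sub>R ones) \<partial>M))
       \<and> ((\<lambda>a. \<Sum>n. \<integral>\<omega>. h (xseq A X0 \<omega> (Suc n) - a *\<^sub>R ones) \<partial>M) \<longlongrightarrow> 0) at_bot
       \<and> (\<forall>\<^sub>F a in at_top. summable (\<lambda>n. \<integral>\<omega>. h (xseq A X0 \<omega> (Suc n) - a *\<^sub>R ones) \<partial>M))
       \<and> ((\<lambda>a. \<Sum>n. \<integral>\<omega>. h (xseq A X0 \<omega> (Suc n) - a *\<^sub>R ones) \<partial>M)
            \<longlongrightarrow> (\<integral>x. h x \<partial>\<alpha>) / \<gamma>) at_top"
proof -
  have "topical_setting M A X0 \<phi> \<gamma> \<nu>0"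
    by (rule topical_setting.intro[OF M], rule topical_setting_axioms.intro)
      (fact A_meas A_top A_indep A_ident memloss X0_meas X0_indep \<phi>_top moment2 lyap
        \<nu>0_prob \<nu>0_sets \<nu>0_inv \<gamma>_pos wna)+
  note ren = topical_setting.renewal[OF this \<alpha>_sets \<alpha>_img h_cont h_supp]
  show ?thesis
    using ren(2,3) sums_summable[OF ren(1)] by simp
qed

end
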